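(* Suppose the initial velocity $u_0$ is $C^2$ on $S^1$, let $\sigma=\int_{S^1}u_0(\theta)\,d\theta$, and let $m_0(\theta)=\sigma-u_0''(\theta)$ be the initial momentum. Assume that either $\lambda=2$ or $\lambda=3$. Then the solution $u$ of $$m_t(t,\theta)+u(t,\theta)\,m_\theta(t,\theta)+\lambda u_\theta(t,\theta)\,m(t,\theta)=0,\qquad m(t,\theta)=\sigma(t)-u_{\theta\theta}(t,\theta),\qquad \sigma(t)=\int_{S^1}u(t,\theta)\,d\theta,$$ with $u(0,\theta)=u_0(\theta)$, $t\ge 0$, $\theta\in S^1$, exists and remains in $C^2$ for all time if and only if $m_0$ never changes sign on $S^1$. If $m_0$ does change sign, then $u_\theta(t,\theta_* )$ approaches negative infinity in finite time at a value $\theta_*\in S^1$ where $m_0$ changes from positive to negative.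
   Context: $S^1=\mathbb{R}/\mathbb{Z}$. The mean $\sigma(t)$ is constant in time, so $\sigma(t)=\sigma$. For $u(t,\cdot)\in C^2(S^1)$ the equation is understood in the integrated form $$u_{t\theta}+u\,u_{\theta\theta}+\tfrac{\lambda-1}{2}u_\theta^2-\lambda\sigma u=I(t),\qquad I(t)=\tfrac{\lambda-3}{2}\int_{S^1}u_\theta(t,\theta)^2\,d\theta-\lambda\sigma^2 .$$ "$m_0$ never changes sign" means that $m_0\ge 0$ everywhere on $S^1$ or $m_0\le 0$ everywhere on $S^1$.
   Formalization: u_θ(t,θ_* ) is taken along the particle path starting at θ_*, i.e. u_θ(t,η(t,θ_* )), since at the fixed point θ_* the claim fails; "changes from positive to negative" allows an interval of zeros, with positive values arbitrarily near on the left and negative on the right. *)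

theory Defs
  imports "HOL-Analysis.Analysis"
begin

text \<open>
  Functions on the circle \<open>\<real>/\<int>\<close> are represented by 1-periodic functions on the reals.
\<close>

definition C2_circle :: "(real \<Rightarrow> real) \<Rightarrow> bool" where
  "C2_circle f \<longleftrightarrow>
     (\<forall>\<theta>. f (\<theta> + 1) = f \<theta>) \<and>
     f differentiable_on UNIV \<and>
     deriv f differentiable_on UNIV \<and>
     continuous_on UNIV (deriv (deriv f))"

definition mean :: "(real \<Rightarrow> real) \<Rightarrow> real" where
  "mean f = integral {0..1} f"

definition momentum :: "(real \<Rightarrow> real) \<Rightarrow> real \<Rightarrow> real" where
  "momentum f \<theta> = mean f - deriv (deriv f) \<theta>"

definition never_changes_sign :: "(real \<Rightarrow> real) \<Rightarrow> bool" where
  "never_changes_sign f \<longleftrightarrow> (\<forall>\<theta>. f \<theta> \<ge> 0) \<or> (\<forall>\<theta>. f \<theta> \<le> 0)"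

text \<open>
  A merely continuous function may pass from positive to negative values through an interval of
  zeros, and it may have infinitely many sign changes near a point. Hence \<open>\<theta>\<close> is allowed to lie
  in an interval \<open>{a..b}\<close> of zeros (with \<open>a = b\<close> for an isolated zero), positive values being
  taken arbitrarily close to the left of \<open>a\<close> and negative ones arbitrarily close to the right
  of \<open>b\<close>.
\<close>

definition changes_pos_to_neg_at :: "(real \<Rightarrow> real) \<Rightarrow> real \<Rightarrow> bool" where
  "changes_pos_to_neg_at f \<theta> \<longleftrightarrow>
     (\<exists>a b. a \<le> \<theta> \<and> \<theta> \<le> b \<and> (\<forall>x\<in>{a..b}. f x = 0) \<and>
        (\<exists>\<^sub>F x in at_left a. f x > 0) \<and> (\<exists>\<^sub>F x in at_right b. f x < 0))"

definition time_dom :: "ereal \<Rightarrow> real set" where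
  "time_dom T = {t. 0 \<le> t \<and> ereal t < T}"

text \<open>
  Classical solutions on \<open>[0, T)\<close> with values in \<open>C\<^sup>2\<close>. For periodic functions, joint continuity
  of \<open>u\<close>, \<open>u\<^sub>\<theta>\<close> and \<open>u\<^sub>\<theta>\<^sub>\<theta>\<close> means that \<open>t \<mapsto> u(t, \<cdot>)\<close> is continuous into \<open>C\<^sup>2\<close>. For such \<open>u\<close> the
  equation is the once integrated one, where \<open>D\<close> below is \<open>u\<^sub>t\<^sub>\<theta>(t, \<theta>)\<close> (one-sided at \<open>t = 0\<close>).
  This determines \<open>u\<^sub>t\<close> only up to a function of time, which is fixed by conservation of the mean.
\<close>

definition is_solution ::
  "real \<Rightarrow> (real \<Rightarrow> real) \<Rightarrow> ereal \<Rightarrow> (real \<Rightarrow> real \<Rightarrow> real) \<Rightarrow> bool" where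
  "is_solution lam u0 T u \<longleftrightarrow>
     0 < T \<and> u 0 = u0 \<and>
     (\<forall>t\<in>time_dom T. C2_circle (u t)) \<and>
     continuous_on (time_dom T \<times> UNIV) (\<lambda>(t, \<theta>). u t \<theta>) \<and>
     continuous_on (time_dom T \<times> UNIV) (\<lambda>(t, \<theta>). deriv (u t) \<theta>) \<and>
     continuous_on (time_dom T \<times> UNIV) (\<lambda>(t, \<theta>). deriv (deriv (u t)) \<theta>) \<and>
     (\<forall>t\<in>time_dom T. mean (u t) = mean u0) \<and>
     (\<forall>t\<in>time_dom T. \<forall>\<theta>. \<exists>D.
        ((\<lambda>s. deriv (u s) \<theta>) has_real_derivative D) (at t within time_dom T) \<and>
        D + u t \<theta> * deriv (deriv (u t)) \<theta> + (lam - 1) / 2 * (deriv (u t) \<theta>)\<^sup>2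
          - lam * mean u0 * u t \<theta>
        = (lam - 3) / 2 * integral {0..1} (\<lambda>x. (deriv (u t) x)\<^sup>2) - lam * (mean u0)\<^sup>2)"

text \<open>
  The solution of the initial value problem: \<open>u\<close> on its maximal interval of existence \<open>[0, T)\<close>,
  of which every other solution is a restriction. The values of \<open>u\<close> outside \<open>[0, T)\<close> are
  irrelevant.
\<close>

definition is_maximal_solution ::
  "real \<Rightarrow> (real \<Rightarrow> real) \<Rightarrow> ereal \<Rightarrow> (real \<Rightarrow> real \<Rightarrow> real) \<Rightarrow> bool" where
  "is_maximal_solution lam u0 T u \<longleftrightarrow>
     is_solution lam u0 T u \<and>
     (\<forall>S v. is_solution lam u0 S v \<longrightarrow> S \<le> T \<and> (\<forall>t\<in>time_dom S. v t = u t))"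

text \<open>
  The Lagrangian trajectory \<open>t \<mapsto> \<eta>(t, \<theta>)\<close> with label \<open>\<theta>\<close>, lifted to the real line:
  \<open>\<eta>\<^sub>t = u(t, \<eta>)\<close>, \<open>\<eta>(0, \<theta>) = \<theta>\<close>.
  The momentum is transported along these, \<open>m(t, \<eta>) \<eta>\<^sub>\<theta>\<^sup>\<lambda> = m\<^sub>0\<close>, so a sign change of \<open>m\<^sub>0\<close> belongs to
  a label, and \<open>u\<^sub>\<theta>\<close> at that label is \<open>u\<^sub>\<theta>(t, \<eta>(t, \<theta>))\<close>.
\<close>

definition is_particle_path ::
  "ereal \<Rightarrow> (real \<Rightarrow> real \<Rightarrow> real) \<Rightarrow> real \<Rightarrow> (real \<Rightarrow> real) \<Rightarrow> bool" where
  "is_particle_path T u \<theta> \<gamma> \<longleftrightarrow>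
     \<gamma> 0 = \<theta> \<and>
     (\<forall>t\<in>time_dom T. (\<gamma> has_real_derivative u t (\<gamma> t)) (at t within time_dom T))"

end

theory Submission
  imports Defs
begin

text \<open>
  Write \<open>lam = (p + 2) / p\<close>, so that \<open>p = 2\<close> for \<open>lam = 2\<close> and \<open>p = 1\<close> for \<open>lam = 3\<close>. Follow the fluid: let
  \<open>\<eta>(t, x)\<close> be the position at time \<open>t\<close> of the particle with label \<open>x\<close>, write its Jacobian as
  \<open>\<eta>\<^sub>x = \<phi>\<^sup>p\<close> and put \<open>\<psi> = \<phi>\<^sub>t\<close>. In these variables the equation becomes the central force problem
  \<open>\<phi>\<^sub>t\<^sub>t = F \<phi>\<close>, where \<open>F = (p + 2) / p\<^sup>2 \<sigma> (u \<circ> \<eta> - \<sigma>) - (p - 1) \<integral>\<psi>\<^sup>2\<close> and \<open>u \<circ> \<eta>\<close> is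
  recovered by integrating \<open>(u \<circ> \<eta>)\<^sub>x = p \<phi>\<^bsup>p-1\<^esup> \<psi>\<close> over the labels. The point of the power \<open>p\<close> is
  that this is polynomial in \<open>(\<phi>, \<psi>)\<close>: it is an ordinary differential equation in a Banach space
  with a locally Lipschitz right-hand side, which is regular even where \<open>\<phi>\<close> vanishes
  (\<open>lagrangian_system_exists\<close>). A classical solution \<open>u\<close> can be read off as long as \<open>\<phi> > 0\<close>
  (\<open>u_is_solution\<close>), and it is the only one by an \<open>L\<^sup>2\<close> estimate for the difference of the slopes of
  two solutions (\<open>is_solution_unique\<close>).

  The slope along trajectories, \<open>W = u\<^sub>\<theta> \<circ> \<eta> = p \<psi> / \<phi>\<close>, satisfies two equations. In time it obeys
  the Riccati equation \<open>W\<^sub>t = p F - W\<^sup>2 / p\<close>. In the label it obeys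
  \<open>W\<^sub>x = \<sigma> \<phi>\<^sup>p - m\<^sub>0 / \<phi>\<^sup>2\<close> (\<open>W_x\<close>), which is the transport of the momentum. Since \<open>W \<phi>\<^sup>p\<close> has mean
  zero, a bound \<open>W \<le> M\<close> controls \<open>u - \<sigma>\<close> by the same \<open>M\<close>, so the Riccati equation does not let \<open>W\<close>
  cross a level \<open>M\<close> that is large compared with \<open>\<sigma>\<close> (\<open>W_upper_bound\<close>). Hence \<open>\<phi>\<close> and \<open>\<psi>\<close> stay
  bounded on bounded time intervals, and the only possible breakdown is that \<open>\<phi>\<close> reaches zero
  (\<open>lagrangian_flow_exists\<close>).

  Where this can happen: suppose that \<open>\<phi>\<close> first vanishes at time \<open>T\<close>, at the label \<open>x\<^sub>0\<close>. Then
  \<open>\<psi>(T, x\<^sub>0) < 0\<close>, so \<open>W \<rightarrow> -\<infinity>\<close> at \<open>x\<^sub>0\<close>. If \<open>m\<^sub>0 \<ge> 0\<close> on an interval to the right of \<open>x\<^sub>0\<close>, the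
  equation for \<open>W\<^sub>x\<close> carries \<open>W \<rightarrow> -\<infinity>\<close> over this interval, where \<open>\<phi>(T, \<cdot>)\<close> must then vanish
  as well. But at such labels \<open>\<bar>W\<bar>\<close> grows only like \<open>1 / (T - t)\<close>, whereas a positive mass of
  \<open>m\<^sub>0 / \<phi>\<^sup>2\<close> would have order \<open>1 / (T - t)\<^sup>2\<close>; so \<open>m\<^sub>0 = 0\<close> there. The same holds to the left with
  \<open>m\<^sub>0 \<le> 0\<close>. As \<open>\<phi>(T, \<cdot>)\<close> cannot vanish on the whole circle, \<open>x\<^sub>0\<close> lies in an interval of zeros of
  \<open>m\<^sub>0\<close> which positive values approach from the left and negative ones from the right
  (\<open>vanishing_label_is_sign_change\<close>). In particular \<open>\<phi>\<close> never vanishes, and the solution is global,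
  if \<open>m\<^sub>0\<close> does not change sign.

  Conversely let \<open>m\<^sub>0\<close> change sign (\<open>bounded_lifespan\<close>). For \<open>\<sigma> = 0\<close> the force is attractive, so
  \<open>\<phi>\<close> is concave in time and reaches zero at a label where \<open>u\<^sub>0\<close> decreases. For \<open>\<sigma> \<noteq> 0\<close> take an
  interval of labels on which \<open>\<sigma> m\<^sub>0 < 0\<close>. There the two terms of \<open>W\<^sub>x\<close> have the same sign, hence
  \<open>\<bar>W\<^sub>x\<bar>\<close> is bounded below and \<open>ln \<phi>\<close> at two of these labels drifts apart linearly in time. As long as
  the solution exists, however, \<open>W\<close> is also bounded below (\<open>W_lower_bound\<close>), so the integrals of
  \<open>1 / \<phi>\<^sup>2\<close> and \<open>\<phi>\<^sup>p\<close> over the interval stay bounded and \<open>ln \<phi>\<close> cannot drift apart for long.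
\<close>

section \<open>Calculus for periodic functions and linear equations\<close>

text \<open>
  The quantity \<open>y\<^sup>2 + z\<^sup>2\<close> has a derivative bounded by a multiple of itself, so weighting it with a
  decaying (growing) exponential makes it monotone forwards (backwards) from \<open>t0\<close>. Both directions
  are used: forwards for identities that hold initially, backwards to see that \<open>\<phi>\<close> and \<open>\<psi>\<close> cannot
  vanish together.
\<close>

lemma linear_ode_zero:
  fixes y z c :: "real \<Rightarrow> real"
  assumes y: "\<And>t. t \<in> {0..\<tau>} \<Longrightarrow> (y has_real_derivative z t) (at t within {0..\<tau>})"
    and z: "\<And>t. t \<in> {0..\<tau>} \<Longrightarrow> (z has_real_derivative c t * y t) (at t within {0..\<tau>})"
    and c: "continuous_on {0..\<tau>} c"
    and t0: "t0 \<in> {0..\<tau>}" "y t0 = 0" "z t0 = 0"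
    and t: "t \<in> {0..\<tau>}"
  shows "y t = 0 \<and> z t = 0"
proof -
  obtain C where C: "\<And>t. t \<in> {0..\<tau>} \<Longrightarrow> \<bar>c t\<bar> \<le> C"
    using compact_imp_bounded[OF compact_continuous_image[OF c compact_Icc]]
    unfolding bounded_iff by (metis imageI real_norm_def)
  define K where "K = 1 + \<bar>C\<bar>"
  define e where "e t = (y t)\<^sup>2 + (z t)\<^sup>2" for t
  define e' where "e' t = 2 * y t * z t + 2 * z t * (c t * y t)" for t
  have e: "(e has_real_derivative e' t) (at t within {0..\<tau>})" if "t \<in> {0..\<tau>}" for t
    unfolding e_def e'_def using y[OF that] z[OF that]
    by (auto intro!: derivative_eq_intros)
  have bnd: "\<bar>e' t\<bar> \<le> K * e t" if "t \<in> {0..\<tau>}" for t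
  proof -
    have "\<bar>2 * y t * z t\<bar> \<le> e t"
      unfolding e_def using sum_squares_bound[of "\<bar>y t\<bar>" "\<bar>z t\<bar>"] by (simp add: abs_mult)
    moreover have "\<bar>e' t\<bar> = \<bar>1 + c t\<bar> * \<bar>2 * y t * z t\<bar>"
      unfolding e'_def by (simp add: abs_mult[symmetric] algebra_simps)
    moreover have "\<bar>1 + c t\<bar> \<le> K" using C[OF that] unfolding K_def by linarith
    ultimately show ?thesis
      by (metis abs_ge_zero mult_mono' )
  qed
  have "e t \<le> 0"
  proof (cases "t0 \<le> t")
    case True
    define h where "h s = e s * exp (- K * s)" for s
    have "h t \<le> h t0"
    proof (rule DERIV_nonpos_imp_decreasing_open[OF True])
      show "\<exists>d. (h has_real_derivative d) (at s) \<and> d \<le> 0" if "t0 < s" "s < t" for s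
      proof -
        have s: "s \<in> {0..\<tau>}" "s \<in> {0<..<\<tau>}" using that t t0 by auto
        have "at s within {0..\<tau>} = at s"
          by (rule at_within_interior) (use s in auto)
        then have "(h has_real_derivative (e' s - K * e s) * exp (- K * s)) (at s)"
          unfolding h_def using e[OF s(1)] by (auto intro!: derivative_eq_intros simp: algebra_simps)
        moreover have "(e' s - K * e s) * exp (- K * s) \<le> 0"
          using bnd[OF s(1)] by (intro mult_nonpos_nonneg) auto
        ultimately show ?thesis by blast
      qed
      have "continuous_on {0..\<tau>} h"
        unfolding h_def by (intro continuous_intros DERIV_continuous_on[OF e])
      then show "continuous_on {t0..t} h" by (rule continuous_on_subset) (use t t0 in auto)
    qed
    then show ?thesis using t0 unfolding h_def e_def by (simp add: mult_le_0_iff)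
  next
    case False
    then have le: "t \<le> t0" by simp
    define h where "h s = e s * exp (K * s)" for s
    have "h t \<le> h t0"
    proof (rule DERIV_nonneg_imp_increasing_open[OF le])
      show "\<exists>d. (h has_real_derivative d) (at s) \<and> d \<ge> 0" if "t < s" "s < t0" for s
      proof -
        have s: "s \<in> {0..\<tau>}" "s \<in> {0<..<\<tau>}" using that t t0 by auto
        have "at s within {0..\<tau>} = at s"
          by (rule at_within_interior) (use s in auto)
        then have "(h has_real_derivative (e' s + K * e s) * exp (K * s)) (at s)"
          unfolding h_def using e[OF s(1)] by (auto intro!: derivative_eq_intros simp: algebra_simps)
        moreover have "(e' s + K * e s) * exp (K * s) \<ge> 0"
          using bnd[OF s(1)] by (intro mult_nonneg_nonneg) auto
        ultimately show ?thesis by blast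
      qed
      have "continuous_on {0..\<tau>} h"
        unfolding h_def by (intro continuous_intros DERIV_continuous_on[OF e])
      then show "continuous_on {t..t0} h" by (rule continuous_on_subset) (use t t0 in auto)
    qed
    then show ?thesis using t0 unfolding h_def e_def by (simp add: mult_le_0_iff)
  qed
  then show ?thesis unfolding e_def by (simp add: sum_power2_le_zero_iff)
qed

text \<open>
  The primitive of \<open>g\<close> that vanishes at 0. The rescaling to the unit interval makes it correct for
  negative \<open>x\<close> and reduces continuity in parameters to that of an integral over a fixed interval.
\<close>

definition prim :: "(real \<Rightarrow> real) \<Rightarrow> real \<Rightarrow> real" where
  "prim g x = x * integral {0..1} (\<lambda>r. g (r * x))"

lemma prim_eq:
  assumes H: "\<And>z. z \<in> {min 0 x..max 0 x} \<Longrightarrow> (H has_real_derivative g z) (at z within {min 0 x..max 0 x})"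
  shows "prim g x = H x - H 0"
proof -
  have "((\<lambda>r. x * g (r * x)) has_integral H (1 * x) - H (0 * x)) {0..1}"
  proof (rule fundamental_theorem_of_calculus)
    fix r :: real assume r: "r \<in> {0..1}"
    have im: "(\<lambda>r. r * x) ` {0..1} \<subseteq> {min 0 x..max 0 x}"
      using mult_right_mono_neg[of _ 1 x]
      by (auto simp: min_def max_def mult_le_0_iff zero_le_mult_iff mult_left_le_one_le
          intro: mult_left_le_one_le)
    have "((\<lambda>r. r * x) has_real_derivative x) (at r within {0..1})"
      by (auto intro!: derivative_eq_intros)
    moreover have "(H has_real_derivative g (r * x)) (at (r * x) within (\<lambda>r. r * x) ` {0..1})"
      using H[of "r * x"] im r by (meson has_field_derivative_subset image_subset_iff)
    ultimately have "((H \<circ> (\<lambda>r. r * x)) has_real_derivative g (r * x) * x) (at r within {0..1})"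
      by (rule DERIV_image_chain[rotated])
    then show "((\<lambda>r. H (r * x)) has_vector_derivative x * g (r * x)) (at r within {0..1})"
      by (simp add: o_def has_real_derivative_iff_has_vector_derivative mult.commute)
  qed auto
  then have "integral {0..1} (\<lambda>r. x * g (r * x)) = H x - H 0"
    using integral_unique by (metis mult_1 mult_zero_left)
  then show ?thesis unfolding prim_def by (simp only: integral_mult_right)
qed

lemma prim_has_derivative:
  assumes "continuous_on UNIV g"
  shows "(prim g has_real_derivative g x) (at x)"
proof -
  define a b where "a = - \<bar>x\<bar> - 1" and "b = \<bar>x\<bar> + 1"
  define H where "H z = integral {a..z} g" for z
  have ab: "a < 0" "0 < b" "a < x" "x < b" by (auto simp: a_def b_def)
  have H: "(H has_real_derivative g z) (at z within {a..b})" if "z \<in> {a..b}" for z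
    unfolding H_def has_real_derivative_iff_has_vector_derivative
    by (rule integral_has_vector_derivative) (use that assms in \<open>auto intro: continuous_on_subset\<close>)
  have "prim g z = H z - H 0" if "z \<in> {a<..<b}" for z
    by (rule prim_eq) (rule has_field_derivative_subset[OF H], use that ab in auto)
  moreover have "((\<lambda>z. H z - H 0) has_real_derivative g x) (at x)"
    using H[of x] ab at_within_interior[of x "{a..b}"]
    by (auto intro!: derivative_eq_intros)
  ultimately show ?thesis
    by (subst DERIV_cong_ev[OF refl _ refl, of _ "\<lambda>z. H z - H 0"])
       (use ab in \<open>auto intro!: eventually_mono[OF eventually_nhds_in_open[of "{a<..<b}" x]]\<close>)
qed

lemma prim_0 [simp]: "prim g 0 = 0" by (simp add: prim_def)

lemma prim_1: "prim g 1 = integral {0..1} g" by (simp add: prim_def)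

lemma prim_diff_eq_integral:
  assumes "continuous_on UNIV g" "a \<le> b"
  shows "prim g b - prim g a = integral {a..b} g"
proof -
  have "(g has_integral prim g b - prim g a) {a..b}"
    by (rule fundamental_theorem_of_calculus[OF assms(2)])
      (use prim_has_derivative[OF assms(1)] in
        \<open>auto simp: has_real_derivative_iff_has_vector_derivative[symmetric] intro: has_field_derivative_at_within\<close>)
  then show ?thesis by (simp add: integral_unique)
qed

lemma prim_unique:
  assumes "\<And>z. (H has_real_derivative g z) (at z)"
  shows "prim g x = H x - H 0"
  by (rule prim_eq) (use assms in \<open>auto intro: has_field_derivative_at_within\<close>)

definition periodic1 :: "(real \<Rightarrow> real) \<Rightarrow> bool" where
  "periodic1 f \<longleftrightarrow> (\<forall>x. f (x + 1) = f x)"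

lemma periodic1_int: assumes "periodic1 f" shows "f (x + of_int n) = f x"
proof (induction n rule: int_induct[of _ 0])
  case base then show ?case by simp
next
  case (step1 i) then show ?case using assms unfolding periodic1_def
    by (metis add.assoc of_int_1 of_int_add)
next
  case (step2 i) then show ?case using assms unfolding periodic1_def
    by (metis add.assoc diff_add_cancel of_int_1 of_int_add)
qed

lemma periodic1_frac: assumes "periodic1 f" shows "f (frac x) = f x"
  using periodic1_int[OF assms, of "frac x" "floor x"] by (simp add: frac_def)

text \<open>
  The difference of the two sides has derivative zero.
\<close>

lemma prim_period:
  assumes "continuous_on UNIV g" "periodic1 g"
  shows "prim g (x + 1) = prim g x + integral {0..1} g"
proof -
  define k where "k x = prim g (x + 1) - prim g x" for x
  have "(k has_real_derivative 0) (at x)" for x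
  proof -
    have "((\<lambda>x. prim g (x + 1)) has_real_derivative g (x+1)) (at x)"
      using prim_has_derivative[OF assms(1), of "x+1"] by (simp add: DERIV_shift)
    from DERIV_diff[OF this prim_has_derivative[OF assms(1)]]
    show ?thesis using assms(2) by (simp add: k_def[abs_def] periodic1_def)
  qed
  then have "k x = k 0" by (rule DERIV_isconst_all[rule_format]) 
  then show ?thesis by (simp add: k_def prim_1)
qed

lemma integral_period:
  assumes "continuous_on UNIV g" "periodic1 g"
  shows "integral {a..a+1} g = integral {0..1} g"
  using prim_period[OF assms, of a] prim_diff_eq_integral[OF assms(1), of a "a+1"] by simp

lemma integral_nonneg_eq_0_imp:
  fixes f :: "real \<Rightarrow> real"
  assumes c: "continuous_on {a..b} f" and nn: "\<And>x. x \<in> {a..b} \<Longrightarrow> 0 \<le> f x"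
    and i: "integral {a..b} f \<le> 0" and x: "x \<in> {a..b}" and ab: "a < b"
  shows "f x = 0"
proof -
  have "integral {a..b} f = 0"
    using i integral_nonneg[OF integrable_continuous_interval[OF c]] nn by (auto intro: antisym)
  then have "(f has_integral 0) (cbox a b)"
    using integrable_integral[OF integrable_continuous_interval[OF c]] by simp
  from has_integral_0_cbox_imp_0[OF _ _ this] show ?thesis using c nn x ab
    by (auto simp: box_real)
qed

lemma integral_lower_bound:
  fixes f :: "real \<Rightarrow> real"
  assumes c: "continuous_on {a..b} f" and "a \<le> b" "\<And>x. x \<in> {a..b} \<Longrightarrow> m \<le> f x"
  shows "m * (b - a) \<le> integral {a..b} f"
  using integral_le[of "\<lambda>_. m" "{a..b}" f] assms integrable_continuous_interval[OF c]
  by (auto simp: mult.commute)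

lemma joint_slice:
  assumes "continuous_on (S \<times> T) (\<lambda>(t,x). f t x)" "t \<in> S"
  shows "continuous_on T (f t)"
proof -
  have "continuous_on T (\<lambda>x. (t, x))" by (intro continuous_intros)
  from continuous_on_compose2[OF assms(1) this] show ?thesis using assms(2) by auto
qed

lemma joint_slice2:
  assumes "continuous_on (S \<times> T) (\<lambda>(t,x). f t x)" "x \<in> T"
  shows "continuous_on S (\<lambda>t. f t x)"
proof -
  have "continuous_on S (\<lambda>t. (t, x))" by (intro continuous_intros)
  from continuous_on_compose2[OF assms(1) this] show ?thesis using assms(2) by auto
qed

lemma joint_compose:
  assumes "continuous_on (S \<times> T) (\<lambda>(t,x). f t x)" "continuous_on R a" "continuous_on R b"
    "\<And>z. z \<in> R \<Longrightarrow> a z \<in> S" "\<And>z. z \<in> R \<Longrightarrow> b z \<in> T"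
  shows "continuous_on R (\<lambda>z. f (a z) (b z))"
  using continuous_on_compose2[OF assms(1), of R "\<lambda>z. (a z, b z)"] assms
  by (auto intro!: continuous_intros)

lemma joint_integral:
  fixes f :: "real \<Rightarrow> real \<Rightarrow> real"
  assumes "continuous_on (S \<times> {a..b}) (\<lambda>(t,x). f t x)"
  shows "continuous_on S (\<lambda>t. integral {a..b} (f t))"
  using integral_continuous_on_param[of S a b f] assms by (simp add: cbox_interval)

lemma joint_prim:
  assumes "continuous_on (S \<times> UNIV) (\<lambda>(t,x). g t x)"
  shows "continuous_on (S \<times> UNIV) (\<lambda>(t,x). prim (g t) x)"
proof -
  have "continuous_on ((S \<times> UNIV) \<times> {0..1}) (\<lambda>(z,r). g (fst z) (r * snd z))"
    unfolding split_beta
    by (rule joint_compose[OF assms]) (auto intro!: continuous_intros)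
  then have "continuous_on (S \<times> UNIV) (\<lambda>z. integral {0..1} (\<lambda>r. g (fst z) (r * snd z)))"
    using integral_continuous_on_param[of "S \<times> UNIV" 0 1 "\<lambda>z r. g (fst z) (r * snd z)"]
    by (simp add: cbox_interval)
  then show ?thesis unfolding prim_def split_beta by (intro continuous_intros)
qed

lemma integral_has_derivative_param:
  fixes f f' :: "real \<Rightarrow> real \<Rightarrow> real"
  assumes d: "\<And>t x. t \<in> S \<Longrightarrow> x \<in> {a..b} \<Longrightarrow> ((\<lambda>t. f t x) has_real_derivative f' t x) (at t within S)"
    and c: "\<And>t. t \<in> S \<Longrightarrow> continuous_on {a..b} (f t)"
    and c': "continuous_on (S \<times> {a..b}) (\<lambda>(t,x). f' t x)"
    and S: "convex S" "t \<in> S"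
  shows "((\<lambda>t. integral {a..b} (f t)) has_real_derivative integral {a..b} (f' t)) (at t within S)"
  using leibniz_rule_field_derivative[of S a b f f' t] assms
  by (simp add: cbox_interval integrable_continuous_interval)

lemma periodic_bounded_joint:
  fixes f :: "real \<Rightarrow> real \<Rightarrow> real"
  assumes c: "continuous_on ({a..b} \<times> UNIV) (\<lambda>(t,x). f t x)" and p: "\<And>t. t \<in> {a..b} \<Longrightarrow> periodic1 (f t)"
  obtains C where "\<And>t x. t \<in> {a..b} \<Longrightarrow> \<bar>f t x\<bar> \<le> C" "C > 0"
proof -
  have "compact ((\<lambda>(t,x). f t x) ` ({a..b} \<times> {0..1}))"
    by (intro compact_continuous_image continuous_on_subset[OF c] compact_Times compact_Icc) auto
  then obtain C where C: "\<And>t x. t \<in> {a..b} \<Longrightarrow> x \<in> {0..1} \<Longrightarrow> \<bar>f t x\<bar> \<le> C"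
    by (force dest!: compact_imp_bounded simp: bounded_iff)
  have "\<bar>f t x\<bar> \<le> max C 1" if "t \<in> {a..b}" for t x
    using C[OF that, of "frac x"] periodic1_frac[OF p[OF that], of x]
    by (simp add: frac_ge_0 frac_lt_1 less_imp_le)
  then show ?thesis by (rule that) auto
qed

lemma frac_in_unit: "frac (x::real) \<in> {0..1}"
  using frac_lt_1[of x] by simp

text \<open>
  Continuity arguments in time take the following form: up to the first time at which a periodic
  function of the label fails to be positive somewhere, it is positive everywhere. The set of bad
  times is compact because one period of labels suffices.
\<close>

lemma first_nonpositive_time:
  fixes f :: "real \<Rightarrow> real \<Rightarrow> real"
  assumes c: "continuous_on ({0..T} \<times> UNIV) (\<lambda>(t,x). f t x)"
    and per: "\<And>t. t \<in> {0..T} \<Longrightarrow> periodic1 (f t)"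
    and t1: "t1 \<in> {0..T}" "f t1 x1 \<le> 0"
  obtains s y where "s \<in> {0..T}" "f s y \<le> 0" "\<And>t x. 0 \<le> t \<Longrightarrow> t < s \<Longrightarrow> f t x > 0"
proof -
  define Z where "Z = {t \<in> {0..T}. \<exists>x\<in>{0..1}. f t x \<le> 0}"
  have inZ: "t \<in> Z" if "t \<in> {0..T}" "f t x \<le> 0" for t x
  proof -
    have "f t (frac x) = f t x" by (rule periodic1_frac[OF per[OF that(1)]])
    then have "f t (frac x) \<le> 0" using that(2) by linarith
    then show ?thesis unfolding Z_def using frac_in_unit[of x] that(1) by blast
  qed
  have Z_eq: "Z = fst ` (({0..T} \<times> {0..1}) \<inter> (\<lambda>(t,x). f t x) -` {..0})"
    unfolding Z_def by force
  have "closed (({0..T} \<times> {0..1}) \<inter> (\<lambda>(t,x). f t x) -` {..0})"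
    by (intro continuous_closed_preimage continuous_on_subset[OF c] closed_Times) auto
  from compact_Int_closed[OF compact_Times[OF compact_Icc[of 0 T] compact_Icc[of 0 1]] this]
  have "compact (({0..T} \<times> {0..1}) \<inter> (\<lambda>(t,x). f t x) -` {..0})" by (simp only: inf_left_idem)
  then have Zc: "compact Z"
    unfolding Z_eq by (rule compact_continuous_image[rotated]) (intro continuous_intros)
  define s where "s = Inf Z"
  have bb: "bdd_below Z" by (auto simp: Z_def)
  have "Z \<noteq> {}" using inZ[OF t1] by blast
  then have sZ: "s \<in> Z"
    unfolding s_def by (rule closed_contains_Inf[OF _ bb compact_imp_closed[OF Zc]])
  then obtain y where y: "s \<in> {0..T}" "f s y \<le> 0" by (auto simp: Z_def)
  show ?thesis
  proof (rule that[OF y])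
    fix t x assume t: "0 \<le> t" "t < s"
    show "f t x > 0"
    proof (rule ccontr)
      assume "\<not> ?thesis"
      then have "t \<in> Z" using inZ[of t x] t y(1) by auto
      then have "s \<le> t" unfolding s_def by (rule cInf_lower[OF _ bb])
      then show False using t by simp
    qed
  qed
qed

lemma DERIV_nonpos_within:
  assumes d: "\<And>t. t \<in> {a..b} \<Longrightarrow> (f has_real_derivative f' t) (at t within {a..b})"
    and n: "\<And>t. a < t \<Longrightarrow> t < b \<Longrightarrow> f' t \<le> 0" and ab: "a \<le> b"
  shows "f b \<le> (f a :: real)"
proof (rule DERIV_nonpos_imp_decreasing_open[OF ab])
  show "\<exists>d. (f has_real_derivative d) (at s) \<and> d \<le> 0" if "a < s" "s < b" for s
    using d[of s] n[OF that] that at_within_interior[of s "{a..b}"] by auto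
  show "continuous_on {a..b} f" by (rule DERIV_continuous_on[OF d])
qed

section \<open>Ordinary differential equations in Banach spaces\<close>

lemma exp_weight_integral:
  fixes L t :: real
  assumes "L > 0" "t \<ge> 0"
  shows "((\<lambda>s. L * exp (2 * L * s)) has_integral (exp (2 * L * t) - 1) / 2) {0..t}"
proof -
  have "((\<lambda>s. L * exp (2 * L * s)) has_integral exp (2 * L * t) / 2 - exp (2 * L * 0) / 2) {0..t}"
    by (rule fundamental_theorem_of_calculus[OF assms(2)])
       (auto intro!: derivative_eq_intros simp: has_real_derivative_iff_has_vector_derivative[symmetric])
  then show ?thesis by (simp add: diff_divide_distrib)
qed

text \<open>
  Picard iteration on all of \<open>[0, N]\<close> at once: for \<open>y(t) = exp (- 2 L t) x(t)\<close> the integral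
  operator is a contraction with constant \<open>1/2\<close> in the supremum norm. Clamping the time to \<open>[0, N]\<close>
  turns curves on the interval into bounded continuous functions on the line.
\<close>

lemma lipschitz_ode_exists:
  fixes f :: "'a::banach \<Rightarrow> 'a"
  assumes lip: "\<And>x y. norm (f x - f y) \<le> L * norm (x - y)" and L: "L > 0" and N: "N \<ge> 0"
  obtains x where "x 0 = x0"
    "\<And>t. t \<in> {0..N} \<Longrightarrow> (x has_vector_derivative f (x t)) (at t within {0..N})"
proof -
  define c where "c t = max 0 (min N t)" for t :: real
  have c: "c t \<in> {0..N}" for t using N by (auto simp: c_def)
  have c_id: "c t = t" if "t \<in> {0..N}" for t using that by (auto simp: c_def)
  have c_cont: "continuous_on UNIV c" unfolding c_def by (intro continuous_intros)
  have f_cont: "continuous_on UNIV f"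
  proof -
    have "L-lipschitz_on UNIV f"
      by (rule lipschitz_onI) (use lip L in \<open>auto simp: dist_norm\<close>)
    then show ?thesis by (rule lipschitz_on_continuous_on)
  qed
  have fy_cont: "continuous_on S (\<lambda>s. f (exp (2 * L * s) *\<^sub>R apply_bcontfun y s))"
    for y :: "real \<Rightarrow>\<^sub>C 'a" and S
    by (rule continuous_on_compose2[OF f_cont]) (auto intro!: continuous_intros)
  define I where "I y t = integral {0..t} (\<lambda>s. f (exp (2 * L * s) *\<^sub>R apply_bcontfun y s))"
    for y :: "real \<Rightarrow>\<^sub>C 'a" and t
  have I: "(I y has_vector_derivative f (exp (2 * L * t) *\<^sub>R apply_bcontfun y t)) (at t within {0..N})"
    if "t \<in> {0..N}" for y t
    unfolding I_def by (rule integral_has_vector_derivative[OF fy_cont that])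
  have I_cont: "continuous_on {0..N} (I y)" for y
    by (rule continuous_on_vector_derivative[OF I])
  define P where "P y t = exp (- 2 * L * c t) *\<^sub>R (x0 + I y (c t))" for y t
  have P: "P y \<in> bcontfun" for y
  proof -
    have cn: "continuous_on {0..N} (\<lambda>t. exp (- 2 * L * t) *\<^sub>R (x0 + I y t))"
      by (intro continuous_intros I_cont)
    have "continuous_on UNIV (P y)"
      unfolding P_def[abs_def] by (rule continuous_on_compose2[OF cn c_cont]) (use c in auto)
    moreover have "bounded (range (P y))"
      by (rule bounded_subset[OF compact_imp_bounded[OF compact_continuous_image[OF cn compact_Icc]]])
         (use c in \<open>auto simp: P_def[abs_def]\<close>)
    ultimately show ?thesis by (simp add: bcontfun_def)
  qed
  define \<Phi> where "\<Phi> y = Bcontfun (P y)" for y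
  have \<Phi>: "apply_bcontfun (\<Phi> y) t = P y t" for y t
    using P by (simp add: \<Phi>_def Bcontfun_inverse)
  \<comment> \<open>the weight integrates to at most \<open>exp (2 L s) / 2\<close>, which the prefactor cancels\<close>
  have contr: "dist (\<Phi> y) (\<Phi> z) \<le> (1/2) * dist y z" for y z
  proof (rule dist_bound)
    fix t
    define s where "s = c t"
    have s: "s \<in> {0..N}" using c by (simp add: s_def)
    have "norm (I y s - I z s) \<le> (exp (2 * L * s) - 1) / 2 * dist y z"
    proof -
      have "I y s - I z s = integral {0..s} (\<lambda>r. f (exp (2 * L * r) *\<^sub>R apply_bcontfun y r) - f (exp (2 * L * r) *\<^sub>R apply_bcontfun z r))"
        unfolding I_def by (rule integral_diff[symmetric]) (auto intro!: integrable_continuous_interval fy_cont)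
      also have "norm \<dots> \<le> integral {0..s} (\<lambda>r. L * exp (2 * L * r) * dist y z)"
      proof (rule integral_norm_bound_integral)
        show "norm (f (exp (2 * L * r) *\<^sub>R apply_bcontfun y r) - f (exp (2 * L * r) *\<^sub>R apply_bcontfun z r))
            \<le> L * exp (2 * L * r) * dist y z" for r
        proof -
          have "norm (f (exp (2 * L * r) *\<^sub>R apply_bcontfun y r) - f (exp (2 * L * r) *\<^sub>R apply_bcontfun z r))
            \<le> L * norm (exp (2 * L * r) *\<^sub>R (apply_bcontfun y r - apply_bcontfun z r))"
            using lip by (simp add: scaleR_diff_right)
          also have "\<dots> = L * exp (2 * L * r) * dist (apply_bcontfun y r) (apply_bcontfun z r)"
            by (simp add: dist_norm)
          also have "\<dots> \<le> L * exp (2 * L * r) * dist y z"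
            using L dist_bounded[of y r z] by (intro mult_left_mono) auto
          finally show ?thesis .
        qed
      qed (auto intro!: integrable_continuous_interval continuous_intros fy_cont)
      also have "\<dots> = (exp (2 * L * s) - 1) / 2 * dist y z"
        using has_integral_mult_left[OF exp_weight_integral[OF L, of s], of "dist y z"] s
        by (intro integral_unique) simp
      finally show ?thesis .
    qed
    also have "\<dots> \<le> exp (2 * L * s) / 2 * dist y z"
      by (intro mult_right_mono) auto
    finally have *: "norm (I y s - I z s) \<le> exp (2 * L * s) / 2 * dist y z" .
    have "dist (apply_bcontfun (\<Phi> y) t) (apply_bcontfun (\<Phi> z) t) = norm (exp (- 2 * L * s) *\<^sub>R (I y s - I z s))"
      by (simp add: \<Phi> P_def dist_norm s_def scaleR_diff_right[symmetric])
    also have "\<dots> = exp (- 2 * L * s) * norm (I y s - I z s)" by simp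
    also have "\<dots> \<le> exp (- 2 * L * s) * (exp (2 * L * s) / 2 * dist y z)"
      using * by (intro mult_left_mono) auto
    also have "\<dots> = 1/2 * dist y z" by (simp add: exp_minus field_simps)
    finally show "dist (apply_bcontfun (\<Phi> y) t) (apply_bcontfun (\<Phi> z) t) \<le> 1/2 * dist y z" .
  qed
  have "\<exists>!y. y \<in> UNIV \<and> \<Phi> y = y"
    by (rule Banach_fix[of UNIV "1/2"]) (use contr complete_UNIV in auto)
  then obtain y where y: "\<Phi> y = y" by auto
  define x where "x t = exp (2 * L * t) *\<^sub>R apply_bcontfun y t" for t
  have x_eq: "x t = x0 + I y t" if "t \<in> {0..N}" for t
  proof -
    have "apply_bcontfun y t = exp (- 2 * L * t) *\<^sub>R (x0 + I y t)"
      using \<Phi>[of y t] y c_id[OF that] by (simp add: P_def)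
    then show ?thesis by (simp add: x_def exp_minus)
  qed
  show ?thesis
  proof
    show "x 0 = x0" using x_eq[of 0] N by (simp add: I_def)
    fix t assume t: "t \<in> {0..N}"
    have "((\<lambda>t. x0 + I y t) has_vector_derivative f (x t)) (at t within {0..N})"
      using I[OF t] unfolding x_def by (auto intro!: derivative_eq_intros)
    then show "(x has_vector_derivative f (x t)) (at t within {0..N})"
      by (rule has_vector_derivative_transform[OF t, rotated]) (simp add: x_eq)
  qed
qed

definition lip_on_balls :: "('a::real_normed_vector \<Rightarrow> 'b::real_normed_vector) \<Rightarrow> bool" where
  "lip_on_balls f \<longleftrightarrow> (\<forall>R. \<exists>L. \<forall>x y. norm x \<le> R \<longrightarrow> norm y \<le> R \<longrightarrow> norm (f x - f y) \<le> L * norm (x - y))"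

lemma lip_on_balls_obtain:
  assumes "lip_on_balls f"
  obtains L where "L > 0" "\<And>x y. norm x \<le> R \<Longrightarrow> norm y \<le> R \<Longrightarrow> norm (f x - f y) \<le> L * norm (x - y)"
proof -
  obtain L where L: "\<forall>x y. norm x \<le> R \<longrightarrow> norm y \<le> R \<longrightarrow> norm (f x - f y) \<le> L * norm (x - y)"
    using assms unfolding lip_on_balls_def by blast
  show ?thesis
  proof (rule that[of "max L 1"])
    show "norm (f x - f y) \<le> max L 1 * norm (x - y)" if "norm x \<le> R" "norm y \<le> R" for x y
      using L that by (smt (verit) max.cobounded1 mult_right_mono norm_ge_zero)
  qed auto
qed

lemma radial_retraction_lipschitz:
  fixes x y :: "'a::real_normed_vector"
  assumes R: "R > 0"
  shows "norm ((R / max R (norm x)) *\<^sub>R x - (R / max R (norm y)) *\<^sub>R y) \<le> 2 * norm (x - y)"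
proof -
  define a b where "a = max R (norm x)" and "b = max R (norm y)"
  have ab: "a > 0" "b > 0" "R \<le> a" "norm y \<le> b" using R by (auto simp: a_def b_def)
  have d: "\<bar>b - a\<bar> \<le> norm (x - y)"
    using norm_triangle_ineq3[of x y] unfolding a_def b_def by linarith
  have "(R / a) *\<^sub>R x - (R / b) *\<^sub>R y = (R / a) *\<^sub>R (x - y) + (R / a - R / b) *\<^sub>R y"
    by (simp add: algebra_simps)
  then have "norm ((R / a) *\<^sub>R x - (R / b) *\<^sub>R y) \<le> (R / a) * norm (x - y) + \<bar>R / a - R / b\<bar> * norm y"
    using norm_triangle_ineq[of "(R / a) *\<^sub>R (x - y)" "(R / a - R / b) *\<^sub>R y"] R ab by simp
  also have "(R / a) * norm (x - y) \<le> 1 * norm (x - y)"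
    using ab R by (intro mult_right_mono) auto
  also have "\<bar>R / a - R / b\<bar> * norm y = (R / a) * (norm y / b) * \<bar>b - a\<bar>"
  proof -
    have "R / a - R / b = R * (b - a) / (a * b)" using ab by (simp add: field_simps)
    then show ?thesis using ab R by (simp add: abs_mult abs_divide)
  qed
  also have "\<dots> \<le> 1 * 1 * norm (x - y)"
    using ab R d by (intro mult_mono) (auto simp: divide_le_eq)
  finally show ?thesis by (simp add: a_def b_def)
qed

text \<open>
  Composing the vector field with the radial retraction onto the ball of radius \<open>R\<close> makes it globally
  Lipschitz without changing it inside the ball; the solution is genuine until it leaves the ball.
\<close>

lemma locally_lipschitz_ode_exit:
  fixes f :: "'a::banach \<Rightarrow> 'a"
  assumes lip: "lip_on_balls f" and R: "norm x0 < R" and N: "N > 0"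
  obtains x \<tau> where "0 < \<tau>" "\<tau> \<le> N" "x 0 = x0"
    "\<And>t. t \<in> {0..\<tau>} \<Longrightarrow> (x has_vector_derivative f (x t)) (at t within {0..\<tau>})"
    "\<tau> = N \<or> norm (x \<tau>) = R"
proof -
  have R0: "R > 0" using R norm_ge_zero[of x0] by linarith
  define r where "r x = (R / max R (norm x)) *\<^sub>R x" for x :: 'a
  have r_norm: "norm (r x) \<le> R" for x
    unfolding r_def using R0 by (auto simp: field_simps max_def)
  have r_id: "r x = x" if "norm x \<le> R" for x
    using that R0 by (simp add: r_def max_def)
  obtain L where L: "L > 0" "\<And>x y. norm x \<le> R \<Longrightarrow> norm y \<le> R \<Longrightarrow> norm (f x - f y) \<le> L * norm (x - y)"
    using lip_on_balls_obtain[OF lip] by metis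
  have "norm (f (r x) - f (r y)) \<le> (2 * L) * norm (x - y)" for x y
  proof -
    have "norm (f (r x) - f (r y)) \<le> L * norm (r x - r y)" using L r_norm by blast
    also have "\<dots> \<le> L * (2 * norm (x - y))"
      using radial_retraction_lipschitz[OF R0, of x y] L by (intro mult_left_mono) (auto simp: r_def)
    finally show ?thesis by simp
  qed
  from lipschitz_ode_exists[OF this, of N x0] obtain x where
    x: "x 0 = x0" "\<And>t. t \<in> {0..N} \<Longrightarrow> (x has_vector_derivative f (r (x t))) (at t within {0..N})"
    using L N by (metis less_imp_le mult_pos_pos zero_less_numeral)
  have xc: "continuous_on {0..N} x" by (rule continuous_on_vector_derivative[OF x(2)])
  define B where "B = {t \<in> {0..N}. norm (x t) \<ge> R}"
  have Bc: "closed B"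
  proof -
    have "B = {0..N} \<inter> (\<lambda>t. norm (x t)) -` {R..}" by (auto simp: B_def)
    then show ?thesis
      using continuous_closed_preimage[OF continuous_on_norm[OF xc], of "{R..}"] by simp
  qed
  show ?thesis
  proof (cases "B = {}")
    case True
    then have n: "norm (x t) < R" if "t \<in> {0..N}" for t using that True by (force simp: B_def)
    show ?thesis
    proof (rule that[of N x])
      show "(x has_vector_derivative f (x t)) (at t within {0..N})" if "t \<in> {0..N}" for t
        using x(2)[OF that] r_id n[OF that] by simp
    qed (use N x in auto)
  next
    case False
    define \<tau> where "\<tau> = Inf B"
    have bb: "bdd_below B" by (auto simp: B_def)
    have \<tau>B: "\<tau> \<in> B" unfolding \<tau>_def by (rule closed_contains_Inf[OF False bb Bc])
    have lt: "norm (x t) < R" if "0 \<le> t" "t < \<tau>" for t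
    proof (rule ccontr)
      assume "\<not> ?thesis"
      then have "t \<in> B" using that \<tau>B by (auto simp: B_def)
      then have "\<tau> \<le> t" unfolding \<tau>_def by (rule cInf_lower[OF _ bb])
      then show False using that by simp
    qed
    have \<tau>: "0 < \<tau>" "\<tau> \<le> N" "norm (x \<tau>) \<ge> R"
      using \<tau>B x(1) R by (auto simp: B_def order_less_le)
    have "norm (x \<tau>) \<le> R"
    proof (rule tendsto_upperbound)
      show "((\<lambda>t. norm (x t)) \<longlongrightarrow> norm (x \<tau>)) (at \<tau> within {0..<\<tau>})"
      proof (intro tendsto_norm, rule tendsto_within_subset)
        show "(x \<longlongrightarrow> x \<tau>) (at \<tau> within {0..N})" using xc \<tau> by (auto simp: continuous_on_def)
      qed (use \<tau> in auto)
      show "\<forall>\<^sub>F t in at \<tau> within {0..<\<tau>}. norm (x t) \<le> R"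
        by (auto simp: eventually_at_filter intro!: always_eventually less_imp_le[OF lt])
      show "at \<tau> within {0..<\<tau>} \<noteq> bot"
        using \<tau> by (simp add: at_within_eq_bot_iff)
    qed
    with \<tau> have eq: "norm (x \<tau>) = R" by simp
    show ?thesis
    proof (rule that[of \<tau> x])
      fix t assume t: "t \<in> {0..\<tau>}"
      have "norm (x t) \<le> R" using lt[of t] eq t by (cases "t = \<tau>") auto
      then show "(x has_vector_derivative f (x t)) (at t within {0..\<tau>})"
        using has_vector_derivative_within_subset[OF x(2)[of t], of "{0..\<tau>}"] t \<tau> r_id by auto
    qed (use \<tau> x eq in auto)
  qed
qed

lemma lip_on_balls_linear:
  assumes "bounded_linear f" shows "lip_on_balls f"
proof -
  interpret bounded_linear f by fact
  obtain K where "\<And>x. norm (f x) \<le> norm x * K" using bounded by blast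
  then show ?thesis unfolding lip_on_balls_def by (metis diff mult.commute)
qed

lemma lip_on_balls_const: "lip_on_balls (\<lambda>x. c)"
  unfolding lip_on_balls_def by (auto intro!: exI[of _ 0])

lemma lip_on_balls_bounded:
  assumes "lip_on_balls f" obtains B where "B > 0" "\<And>x. norm x \<le> R \<Longrightarrow> norm (f x) \<le> B"
proof -
  obtain L where L: "L > 0" "\<And>x y. norm x \<le> \<bar>R\<bar> \<Longrightarrow> norm y \<le> \<bar>R\<bar> \<Longrightarrow> norm (f x - f y) \<le> L * norm (x - y)"
    using lip_on_balls_obtain[OF assms] by metis
  show ?thesis
  proof (rule that[of "norm (f 0) + L * \<bar>R\<bar> + 1"])
    show "norm (f 0) + L * \<bar>R\<bar> + 1 > 0" using L by (simp add: add_nonneg_pos)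
    fix x :: 'a assume x: "norm x \<le> R"
    have "norm (f x) \<le> norm (f 0) + norm (f x - f 0)" using norm_triangle_sub by blast
    also have "norm (f x - f 0) \<le> L * norm x" using L(2)[of x 0] x by auto
    also have "L * norm x \<le> L * \<bar>R\<bar>" using L x by (intro mult_left_mono) auto
    finally show "norm (f x) \<le> norm (f 0) + L * \<bar>R\<bar> + 1" by simp
  qed
qed

lemma lip_on_balls_bilinear:
  fixes f :: "'d::real_normed_vector \<Rightarrow> 'a::real_normed_vector"
    and g :: "'d \<Rightarrow> 'b::real_normed_vector" and h :: "'a \<Rightarrow> 'b \<Rightarrow> 'c::real_normed_vector"
  assumes h: "bounded_bilinear h" and f: "lip_on_balls f" and g: "lip_on_balls g"
  shows "lip_on_balls (\<lambda>x. h (f x) (g x))"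
  unfolding lip_on_balls_def
proof
  fix R
  interpret bounded_bilinear h by fact
  obtain K where K: "K > 0" "\<And>a b. norm (h a b) \<le> norm a * norm b * K" using pos_bounded by blast
  obtain L where L: "L > 0" "\<And>x y. norm x \<le> R \<Longrightarrow> norm y \<le> R \<Longrightarrow> norm (f x - f y) \<le> L * norm (x - y)"
    using lip_on_balls_obtain[OF f] by metis
  obtain M where M: "M > 0" "\<And>x y. norm x \<le> R \<Longrightarrow> norm y \<le> R \<Longrightarrow> norm (g x - g y) \<le> M * norm (x - y)"
    using lip_on_balls_obtain[OF g] by metis
  obtain A where A: "A > 0" "\<And>x. norm x \<le> R \<Longrightarrow> norm (f x) \<le> A" using lip_on_balls_bounded[OF f] by metis
  obtain B where B: "B > 0" "\<And>x. norm x \<le> R \<Longrightarrow> norm (g x) \<le> B" using lip_on_balls_bounded[OF g] by metis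
  show "\<exists>C. \<forall>x y. norm x \<le> R \<longrightarrow> norm y \<le> R \<longrightarrow> norm (h (f x) (g x) - h (f y) (g y)) \<le> C * norm (x - y)"
  proof (intro exI allI impI)
    fix x y :: 'd assume xy: "norm x \<le> R" "norm y \<le> R"
    have "h (f x) (g x) - h (f y) (g y) = h (f x - f y) (g x) + h (f y) (g x - g y)"
      by (simp add: diff_left diff_right)
    then have "norm (h (f x) (g x) - h (f y) (g y)) \<le> norm (h (f x - f y) (g x)) + norm (h (f y) (g x - g y))"
      by (metis norm_triangle_ineq)
    also have "norm (h (f x - f y) (g x)) \<le> L * norm (x - y) * B * K"
      using K(2)[of "f x - f y" "g x"] L(2)[OF xy] B(2)[OF xy(1)] K(1) L(1) B(1)
      by (smt (verit) mult_mono mult_nonneg_nonneg norm_ge_zero)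
    also have "norm (h (f y) (g x - g y)) \<le> A * (M * norm (x - y)) * K"
      using K(2)[of "f y" "g x - g y"] M(2)[OF xy] A(2)[OF xy(2)] K(1) M(1) A(1)
      by (smt (verit) mult_mono mult_nonneg_nonneg norm_ge_zero)
    finally show "norm (h (f x) (g x) - h (f y) (g y)) \<le> (L * B * K + A * M * K) * norm (x - y)"
      by (simp add: algebra_simps)
  qed
qed

lemma lip_on_balls_compose_linear:
  assumes h: "bounded_linear h" and f: "lip_on_balls f"
  shows "lip_on_balls (\<lambda>x. h (f x))"
  unfolding lip_on_balls_def
proof
  fix R
  interpret bounded_linear h by fact
  obtain K where K: "K > 0" "\<And>a. norm (h a) \<le> norm a * K" using pos_bounded by blast
  obtain L where L: "\<And>x y. norm x \<le> R \<Longrightarrow> norm y \<le> R \<Longrightarrow> norm (f x - f y) \<le> L * norm (x - y)"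
    using lip_on_balls_obtain[OF f] by metis
  have "norm (h (f x) - h (f y)) \<le> K * L * norm (x - y)" if "norm x \<le> R" "norm y \<le> R" for x y
    using order_trans[OF K(2)[of "f x - f y"] mult_right_mono[OF L[OF that], of K]] K(1)
    by (simp add: diff algebra_simps)
  then show "\<exists>C. \<forall>x y. norm x \<le> R \<longrightarrow> norm y \<le> R \<longrightarrow> norm (h (f x) - h (f y)) \<le> C * norm (x - y)"
    by blast
qed

lemma lip_on_balls_diff:
  assumes f: "lip_on_balls f" and g: "lip_on_balls g" shows "lip_on_balls (\<lambda>x. f x - g x)"
  unfolding lip_on_balls_def
proof
  fix R
  obtain L where L: "\<And>x y. norm x \<le> R \<Longrightarrow> norm y \<le> R \<Longrightarrow> norm (f x - f y) \<le> L * norm (x - y)"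
    using lip_on_balls_obtain[OF f] by metis
  obtain M where M: "\<And>x y. norm x \<le> R \<Longrightarrow> norm y \<le> R \<Longrightarrow> norm (g x - g y) \<le> M * norm (x - y)"
    using lip_on_balls_obtain[OF g] by metis
  show "\<exists>C. \<forall>x y. norm x \<le> R \<longrightarrow> norm y \<le> R \<longrightarrow> norm ((f x - g x) - (f y - g y)) \<le> C * norm (x - y)"
  proof (intro exI allI impI)
    fix x y :: 'a assume xy: "norm x \<le> R" "norm y \<le> R"
    have "(f x - g x) - (f y - g y) = (f x - f y) - (g x - g y)" by simp
    then show "norm ((f x - g x) - (f y - g y)) \<le> (L + M) * norm (x - y)"
      using norm_triangle_ineq4[of "f x - f y" "g x - g y"] L[OF xy] M[OF xy]
      by (simp only:) (simp add: algebra_simps)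
  qed
qed

lemma lip_on_balls_Pair:
  assumes f: "lip_on_balls f" and g: "lip_on_balls g" shows "lip_on_balls (\<lambda>x. (f x, g x))"
  unfolding lip_on_balls_def
proof
  fix R
  obtain L where L: "\<And>x y. norm x \<le> R \<Longrightarrow> norm y \<le> R \<Longrightarrow> norm (f x - f y) \<le> L * norm (x - y)"
    using lip_on_balls_obtain[OF f] by metis
  obtain M where M: "\<And>x y. norm x \<le> R \<Longrightarrow> norm y \<le> R \<Longrightarrow> norm (g x - g y) \<le> M * norm (x - y)"
    using lip_on_balls_obtain[OF g] by metis
  show "\<exists>C. \<forall>x y. norm x \<le> R \<longrightarrow> norm y \<le> R \<longrightarrow> norm ((f x, g x) - (f y, g y)) \<le> C * norm (x - y)"
  proof (intro exI allI impI)
    fix x y :: 'a assume xy: "norm x \<le> R" "norm y \<le> R"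
    show "norm ((f x, g x) - (f y, g y)) \<le> (L + M) * norm (x - y)"
      using norm_Pair_le[of "f x - f y" "g x - g y"] L[OF xy] M[OF xy]
      by (simp add: algebra_simps)
  qed
qed

section \<open>The Lagrangian system and its local solution\<close>

text \<open>
  Near any point only the two unit intervals around the nearest integer matter; on each of them
  the function is a translate of \<open>h\<close>, and the two pieces agree at that integer by \<open>h 0 = h 1\<close>.
\<close>

lemma continuous_on_frac_compose:
  assumes h: "continuous_on {0..1} h" and h01: "h 0 = h (1::real)"
  shows "continuous_on UNIV (\<lambda>x. h (frac x))"
  unfolding continuous_on_eq_continuous_within
proof
  fix x :: real
  define n :: real where "n = of_int \<lfloor>x + 1/2\<rfloor>"
  have x: "n - 1 < x" "x < n + 1" unfolding n_def by linarith+
  have left: "h (frac y) = h (y - (n - 1))" if "y \<in> {n-1..n}" for y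
  proof (cases "y = n")
    case True then show ?thesis using h01 by (simp add: n_def)
  next
    case False
    then have "frac y = y - (n - 1)" using that unfolding n_def
      by (intro frac_unique_iff[THEN iffD2]) auto
    then show ?thesis by simp
  qed
  have right: "h (frac y) = h (y - n)" if "y \<in> {n..n+1}" for y
  proof (cases "y = n + 1")
    case True then show ?thesis using h01 by (simp add: n_def)
  next
    case False
    then have "frac y = y - n" using that unfolding n_def
      by (intro frac_unique_iff[THEN iffD2]) auto
    then show ?thesis by simp
  qed
  have "continuous_on ({n-1..n} \<union> {n..n+1}) (\<lambda>y. h (frac y))"
  proof (rule continuous_on_closed_Un)
    have "continuous_on {n-1..n} (\<lambda>y. h (y - (n - 1)))"
      by (rule continuous_on_compose2[OF h]) (auto intro!: continuous_intros)
    then show "continuous_on {n-1..n} (\<lambda>y. h (frac y))"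
      using left by (rule continuous_on_cong[THEN iffD2, OF refl, rotated])
    have "continuous_on {n..n+1} (\<lambda>y. h (y - n))"
      by (rule continuous_on_compose2[OF h]) (auto intro!: continuous_intros)
    then show "continuous_on {n..n+1} (\<lambda>y. h (frac y))"
      using right by (rule continuous_on_cong[THEN iffD2, OF refl, rotated])
  qed auto
  then show "isCont (\<lambda>x. h (frac x)) x"
    by (rule continuous_on_interior)
      (use x ivl_disj_un_two_touch(4)[of "n-1" n "n+1"] in simp)
qed

text \<open>
  Subtracting a linear function and passing to the fractional part yields a bounded continuous
  function for every \<open>g\<close>, so that the vector field below is defined on the whole Banach space. If \<open>g\<close>
  is periodic with mean zero, this is the primitive of \<open>g\<close>.
\<close>

definition per_prim :: "(real \<Rightarrow> real) \<Rightarrow> real \<Rightarrow> real" where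
  "per_prim g x = prim g (frac x) - frac x * integral {0..1} g"

lemma prim_continuous: "continuous_on UNIV g \<Longrightarrow> continuous_on S (prim g)"
  by (meson DERIV_isCont continuous_at_imp_continuous_on prim_has_derivative)

lemma per_prim_continuous: assumes "continuous_on UNIV g" shows "continuous_on UNIV (per_prim g)"
  unfolding per_prim_def
  by (rule continuous_on_frac_compose[of "\<lambda>z. prim g z - z * integral {0..1} g"])
     (auto intro!: continuous_intros prim_continuous assms simp: prim_1)

lemma per_prim_eq_prim:
  assumes "continuous_on UNIV g" "periodic1 g" "integral {0..1} g = 0"
  shows "per_prim g = prim g"
proof
  fix x
  have "periodic1 (prim g)" using prim_period[OF assms(1,2)] assms(3) by (simp add: periodic1_def)
  then show "per_prim g x = prim g x" using assms(3) by (simp add: per_prim_def periodic1_frac)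
qed

lemma per_prim_periodic: "per_prim g (x + 1) = per_prim g x"
  by (simp add: per_prim_def frac_1_eq)

lemma prim_bound:
  assumes "continuous_on UNIV g" "\<And>x. \<bar>g x\<bar> \<le> B" shows "\<bar>prim g x\<bar> \<le> \<bar>x\<bar> * B"
proof -
  have "norm (integral {0..1} (\<lambda>r. g (r * x))) \<le> B * (1 - 0)"
    by (rule integral_bound) (use assms in \<open>auto intro!: continuous_on_compose2[OF assms(1)] continuous_intros\<close>)
  then show ?thesis by (simp add: prim_def abs_mult mult_left_mono)
qed

lemma per_prim_bound:
  assumes "continuous_on UNIV g" "\<And>x. \<bar>g x\<bar> \<le> B" shows "\<bar>per_prim g x\<bar> \<le> 2 * B"
proof -
  have B: "B \<ge> 0" using assms(2)[of 0] by linarith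
  have "frac x * B \<le> 1 * B"
    by (intro mult_right_mono) (auto simp: B frac_lt_1 less_imp_le)
  moreover have "\<bar>prim g (frac x)\<bar> \<le> frac x * B"
    using prim_bound[OF assms, of "frac x"] by simp
  moreover have "\<bar>frac x * integral {0..1} g\<bar> \<le> frac x * B"
    using prim_bound[OF assms, of 1] by (simp add: prim_1 abs_mult mult_left_mono)
  ultimately show ?thesis unfolding per_prim_def by linarith
qed

instance bcontfun :: (metric_space, banach) banach ..

type_synonym bfun = "real \<Rightarrow>\<^sub>C real"

lemma bcontfun_abs_le: "\<bar>apply_bcontfun f x\<bar> \<le> norm (f::bfun)"
  using norm_bounded[of f x] by simp

definition bmult :: "bfun \<Rightarrow> bfun \<Rightarrow> bfun" where
  "bmult f g = Bcontfun (\<lambda>x. f x * g x)"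

lemma bmult_apply [simp]: "bmult f g x = f x * g x"
proof -
  have "(\<lambda>x. f x * g x) \<in> bcontfun"
  proof (rule bcontfun_normI)
    show "norm (f x * g x) \<le> norm f * norm g" for x
      using mult_mono[OF bcontfun_abs_le[of f x] bcontfun_abs_le[of g x]] by (simp add: abs_mult)
  qed (intro continuous_intros continuous_on_apply_bcontfun)
  then show ?thesis by (simp add: bmult_def Bcontfun_inverse)
qed

lemma bounded_bilinear_bmult: "bounded_bilinear bmult"
proof (rule bounded_bilinear.intro)
  show "\<exists>K. \<forall>a b. norm (bmult a b) \<le> norm a * norm b * K"
  proof (intro exI[of _ 1] allI)
    fix a b show "norm (bmult a b) \<le> norm a * norm b * 1"
      by (rule norm_bound) (use mult_mono[OF bcontfun_abs_le[of a] bcontfun_abs_le[of b]] in \<open>simp add: abs_mult\<close>)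
  qed
qed (auto intro!: bcontfun_eqI simp: algebra_simps)

primrec bpow :: "bfun \<Rightarrow> nat \<Rightarrow> bfun" where
  "bpow f 0 = const_bcontfun 1"
| "bpow f (Suc n) = bmult f (bpow f n)"

lemma bpow_apply [simp]: "bpow f n x = f x ^ n"
  by (induction n) (auto simp: const_bcontfun.rep_eq)

definition bint :: "bfun \<Rightarrow> real" where "bint f = integral {0..1} f"

lemma bounded_linear_bint: "bounded_linear bint"
proof (rule bounded_linear_intro[of _ 1])
  show "bint (f + g) = bint f + bint g" for f g
    unfolding bint_def plus_bcontfun.rep_eq
    by (intro integral_add integrable_continuous_interval continuous_on_apply_bcontfun)
  show "bint (c *\<^sub>R f) = c *\<^sub>R bint f" for c f
    unfolding bint_def scaleR_bcontfun.rep_eq by simp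
  show "norm (bint f) \<le> norm f * 1" for f
    using integral_bound[of 0 1 "apply_bcontfun f" "norm f"] bcontfun_abs_le by (simp add: bint_def)
qed

definition bprim :: "bfun \<Rightarrow> bfun" where "bprim f = Bcontfun (per_prim f)"

lemma bprim_apply [simp]: "bprim f x = per_prim f x"
proof -
  have "per_prim f \<in> bcontfun"
    by (rule bcontfun_normI[of _ "2 * norm f"])
       (auto intro!: per_prim_continuous per_prim_bound bcontfun_abs_le)
  then show ?thesis by (simp add: bprim_def Bcontfun_inverse)
qed

lemma bounded_linear_bprim: "bounded_linear bprim"
proof (rule bounded_linear_intro[of _ 2])
  have c: "continuous_on {0..1} (\<lambda>r. apply_bcontfun f (r * x))" for f :: bfun and x :: real
    by (rule continuous_on_compose2[OF continuous_on_apply_bcontfun[of UNIV]]) (auto intro!: continuous_intros)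
  show "bprim (f + g) = bprim f + bprim g" for f g
    by (rule bcontfun_eqI)
       (simp add: per_prim_def prim_def integral_add integrable_continuous_interval c algebra_simps)
  show "bprim (a *\<^sub>R f) = a *\<^sub>R bprim f" for a f
    by (rule bcontfun_eqI) (simp add: per_prim_def prim_def algebra_simps)
  show "norm (bprim f) \<le> norm f * 2" for f
    by (rule norm_bound) (use per_prim_bound[of f, OF _ bcontfun_abs_le] in \<open>simp add: mult.commute\<close>)
qed

lemma bounded_linear_const_bcontfun: "bounded_linear (const_bcontfun :: real \<Rightarrow> bfun)"
  by (rule bounded_linear_intro[of _ 1])
     (auto intro!: bcontfun_eqI norm_bound simp: const_bcontfun.rep_eq)

text \<open>
  The time derivative \<open>p \<phi>\<^bsup>p-1\<^esup> \<psi>\<close> of the Jacobian \<open>\<phi>\<^sup>p\<close>, which is also the label derivative of the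
  velocity along trajectories.
\<close>

definition jac_rate :: "nat \<Rightarrow> (real \<Rightarrow> real) \<Rightarrow> (real \<Rightarrow> real) \<Rightarrow> real \<Rightarrow> real" where
  "jac_rate p f g x = of_nat p * f x ^ (p - 1) * g x"

text \<open>
  The first term is \<open>lam \<sigma> / p\<close> times the deviation of the velocity from its mean: the velocity is the
  primitive of \<open>jac_rate\<close>, and the integral subtracted from it is its mean over space, with the
  Jacobian \<open>f\<^sup>p\<close> as volume element.
\<close>

definition force :: "nat \<Rightarrow> real \<Rightarrow> (real \<Rightarrow> real) \<Rightarrow> (real \<Rightarrow> real) \<Rightarrow> real \<Rightarrow> real" where
  "force p \<sigma> f g x =
     (of_nat p + 2) / (of_nat p)\<^sup>2 * \<sigma> *
       (per_prim (jac_rate p f g) x - integral {0..1} (\<lambda>y. per_prim (jac_rate p f g) y * f y ^ p))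
     - (of_nat p - 1) * integral {0..1} (\<lambda>y. (g y)\<^sup>2)"

definition bforce :: "nat \<Rightarrow> real \<Rightarrow> bfun \<times> bfun \<Rightarrow> bfun" where
  "bforce p \<sigma> z =
    (let A = bprim (of_nat p *\<^sub>R bmult (bpow (fst z) (p - 1)) (snd z))
     in ((of_nat p + 2) / (of_nat p)\<^sup>2 * \<sigma>) *\<^sub>R (A - const_bcontfun (bint (bmult A (bpow (fst z) p))))
        - (of_nat p - 1) *\<^sub>R const_bcontfun (bint (bmult (snd z) (snd z))))"

lemma bforce_apply: "bforce p \<sigma> z x = force p \<sigma> (fst z) (snd z) x"
proof -
  have "apply_bcontfun (of_nat p *\<^sub>R bmult (bpow (fst z) (p - 1)) (snd z)) = jac_rate p (fst z) (snd z)"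
    by (rule ext) (simp add: jac_rate_def)
  moreover have "apply_bcontfun (bmult a b) = (\<lambda>x. a x * b x)" for a b by (rule ext) simp
  ultimately show ?thesis
    unfolding bforce_def force_def Let_def bint_def
    by (simp add: const_bcontfun.rep_eq power2_eq_square)
qed

lemma lip_on_balls_bpow:
  assumes "lip_on_balls f" shows "lip_on_balls (\<lambda>z. bpow (f z) n)"
proof (induction n)
  case 0 then show ?case by (simp add: lip_on_balls_const)
next
  case (Suc n) then show ?case using lip_on_balls_bilinear[OF bounded_bilinear_bmult assms Suc] by simp
qed

lemma lip_on_balls_vector_field:
  "lip_on_balls (\<lambda>z. (snd z, bmult (bforce p \<sigma> z) (fst z)))"
proof -
  note m = lip_on_balls_bilinear[OF bounded_bilinear_bmult]
  note s = lip_on_balls_compose_linear[OF bounded_linear_scaleR_right]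
  note c = lip_on_balls_compose_linear[OF bounded_linear_const_bcontfun]
  note i = lip_on_balls_compose_linear[OF bounded_linear_bint]
  have f: "lip_on_balls (fst :: bfun \<times> bfun \<Rightarrow> bfun)" and g: "lip_on_balls (snd :: bfun \<times> bfun \<Rightarrow> bfun)"
    by (auto intro!: lip_on_balls_linear bounded_linear_fst bounded_linear_snd)
  have A: "lip_on_balls (\<lambda>z::bfun \<times> bfun. bprim (of_nat p *\<^sub>R bmult (bpow (fst z) (p - 1)) (snd z)))"
    by (intro lip_on_balls_compose_linear[OF bounded_linear_bprim] s m lip_on_balls_bpow f g)
  have "lip_on_balls (bforce p \<sigma>)"
    unfolding bforce_def[abs_def] Let_def
    by (intro lip_on_balls_diff s A c i m lip_on_balls_bpow f g)
  then show ?thesis by (intro lip_on_balls_Pair g m f)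
qed

text \<open>
  The system \<open>\<phi>\<^sub>t = \<psi>\<close>, \<open>\<psi>\<^sub>t = F \<phi>\<close> on \<open>[0, \<tau>]\<close> for the initial slope \<open>v\<close>. Positivity of \<open>\<phi>\<close>
  is not demanded, so that the final time may be the one at which \<open>\<phi>\<close> vanishes.
\<close>

definition lagrangian_system ::
  "nat \<Rightarrow> real \<Rightarrow> (real \<Rightarrow> real) \<Rightarrow> real \<Rightarrow> (real \<Rightarrow> real \<Rightarrow> real) \<Rightarrow> (real \<Rightarrow> real \<Rightarrow> real) \<Rightarrow> bool" where
  "lagrangian_system p \<sigma> v \<tau> \<phi> \<psi> \<longleftrightarrow>
     0 < \<tau> \<and> \<phi> 0 = (\<lambda>x. 1) \<and> \<psi> 0 = (\<lambda>x. v x / of_nat p) \<and>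
     continuous_on ({0..\<tau>} \<times> UNIV) (\<lambda>(t,x). \<phi> t x) \<and>
     continuous_on ({0..\<tau>} \<times> UNIV) (\<lambda>(t,x). \<psi> t x) \<and>
     (\<forall>t\<in>{0..\<tau>}. \<forall>x. ((\<lambda>s. \<phi> s x) has_real_derivative \<psi> t x) (at t within {0..\<tau>})) \<and>
     (\<forall>t\<in>{0..\<tau>}. \<forall>x. ((\<lambda>s. \<psi> s x) has_real_derivative force p \<sigma> (\<phi> t) (\<psi> t) x * \<phi> t x) (at t within {0..\<tau>}))"

text \<open>
  Convergence in the supremum norm is uniform in \<open>x\<close>, hence continuity in \<open>t\<close> into the function space
  gives joint continuity.
\<close>

lemma joint_continuous_bcontfun:
  fixes X :: "real \<Rightarrow> bfun"
  assumes "continuous_on S X"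
  shows "continuous_on (S \<times> UNIV) (\<lambda>(t,x). X t x)"
  unfolding continuous_on_iff
proof (intro ballI allI impI)
  fix q :: "real \<times> real" and e :: real
  assume q: "q \<in> S \<times> UNIV" and e: "0 < e"
  obtain t x where tx: "q = (t, x)" by (cases q)
  obtain d1 where d1: "d1 > 0" "\<And>s. s \<in> S \<Longrightarrow> dist s t < d1 \<Longrightarrow> dist (X s) (X t) < e/2"
    using assms q half_gt_zero[OF e] unfolding tx continuous_on_iff mem_Sigma_iff by blast
  have "continuous_on UNIV (apply_bcontfun (X t))" by simp
  then obtain d2 where d2: "d2 > 0" "\<And>y. dist y x < d2 \<Longrightarrow> dist (X t y) (X t x) < e/2"
    using e unfolding continuous_on_iff by (metis UNIV_I half_gt_zero)
  show "\<exists>d>0. \<forall>z\<in>S \<times> UNIV. dist z q < d \<longrightarrow>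
      dist (case z of (t, x) \<Rightarrow> X t x) (case q of (t, x) \<Rightarrow> X t x) < e"
  proof (intro exI[of _ "min d1 d2"] conjI ballI impI)
    show "0 < min d1 d2" using d1 d2 by simp
    fix z assume z: "z \<in> S \<times> (UNIV::real set)" "dist z q < min d1 d2"
    obtain s y where sy: "z = (s, y)" by (cases z)
    have "dist s t < d1" "dist y x < d2"
      using z dist_fst_le[of z "(t,x)"] dist_snd_le[of z "(t,x)"] by (auto simp: sy tx)
    then have "dist (X s y) (X t y) < e/2" "dist (X t y) (X t x) < e/2"
      using d1(2)[of s] d2(2)[of y] z dist_bounded[of "X s" y "X t"] by (auto simp: sy)
    then show "dist (case z of (t, x) \<Rightarrow> X t x) (case q of (t, x) \<Rightarrow> X t x) < e"
      using dist_triangle[of "X s y" "X t x" "X t y"] by (simp add: sy tx)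
  qed
qed

lemma bounded_linear_eval: "bounded_linear (\<lambda>f::bfun. f x)"
  by (rule bounded_linear_intro[of _ 1]) (use bcontfun_abs_le in auto)

lemma has_derivative_eval:
  fixes X :: "real \<Rightarrow> bfun"
  assumes "(X has_vector_derivative Y) (at t within S)"
  shows "((\<lambda>s. X s x) has_real_derivative Y x) (at t within S)"
  using bounded_linear.has_vector_derivative[OF bounded_linear_eval assms]
  by (simp add: has_real_derivative_iff_has_vector_derivative)

text \<open>
  The vector field is built from bounded linear and bilinear maps, hence Lipschitz on balls, and a
  solution can only stop before time \<open>N\<close> by leaving a ball that was fixed in advance. The radii
  \<open>r1\<close> and \<open>r2\<close> are free, so that a priori bounds can be inserted later.
\<close>

lemma lagrangian_system_exists:
  assumes v: "continuous_on UNIV v" "\<And>x. \<bar>v x\<bar> \<le> B" and p: "p > 0" and N: "N > 0"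
  obtains \<tau> \<phi> \<psi> where "lagrangian_system p \<sigma> v \<tau> \<phi> \<psi>" "\<tau> \<le> N"
    "\<tau> = N \<or> (\<exists>x. \<bar>\<phi> \<tau> x\<bar> > r1 \<or> \<bar>\<psi> \<tau> x\<bar> > r2)"
proof -
  define w where "w = Bcontfun (\<lambda>x. v x / of_nat p)"
  have w: "apply_bcontfun w = (\<lambda>x. v x / of_nat p)"
    unfolding w_def
  proof (rule Bcontfun_inverse, rule bcontfun_normI)
    show "norm (v x / of_nat p) \<le> B / of_nat p" for x using v(2)[of x] p by (simp add: divide_right_mono)
  qed (use p in \<open>auto intro!: continuous_intros v(1)\<close>)
  define z0 where "z0 = (const_bcontfun 1 :: bfun, w)"
  define R where "R = norm z0 + \<bar>r1\<bar> + \<bar>r2\<bar> + 1"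
  have "norm z0 < R" by (simp add: R_def)
  from locally_lipschitz_ode_exit[OF lip_on_balls_vector_field[of p \<sigma>] this N]
  obtain z \<tau> where z: "0 < \<tau>" "\<tau> \<le> N" "z 0 = z0"
    "\<And>t. t \<in> {0..\<tau>} \<Longrightarrow> (z has_vector_derivative (snd (z t), bmult (bforce p \<sigma> (z t)) (fst (z t)))) (at t within {0..\<tau>})"
    "\<tau> = N \<or> norm (z \<tau>) = R" by blast
  define \<phi> \<psi> where "\<phi> t = apply_bcontfun (fst (z t))" and "\<psi> t = apply_bcontfun (snd (z t))" for t
  have c: "continuous_on {0..\<tau>} z" by (rule continuous_on_vector_derivative[OF z(4)])
  have d1: "((\<lambda>t. fst (z t)) has_vector_derivative snd (z t)) (at t within {0..\<tau>})" if "t \<in> {0..\<tau>}" for t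
    using bounded_linear.has_vector_derivative[OF bounded_linear_fst z(4)[OF that]] by simp
  have d2: "((\<lambda>t. snd (z t)) has_vector_derivative bmult (bforce p \<sigma> (z t)) (fst (z t))) (at t within {0..\<tau>})"
    if "t \<in> {0..\<tau>}" for t
    using bounded_linear.has_vector_derivative[OF bounded_linear_snd z(4)[OF that]] by simp
  show ?thesis
  proof (rule that[of \<tau> \<phi> \<psi>])
    show "lagrangian_system p \<sigma> v \<tau> \<phi> \<psi>"
      unfolding lagrangian_system_def
    proof (intro conjI ballI allI)
      show "continuous_on ({0..\<tau>} \<times> UNIV) (\<lambda>(t,x). \<phi> t x)"
        unfolding \<phi>_def by (intro joint_continuous_bcontfun continuous_on_fst c)
      show "continuous_on ({0..\<tau>} \<times> UNIV) (\<lambda>(t,x). \<psi> t x)"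
        unfolding \<psi>_def by (intro joint_continuous_bcontfun continuous_on_snd c)
      show "((\<lambda>s. \<phi> s x) has_real_derivative \<psi> t x) (at t within {0..\<tau>})" if "t \<in> {0..\<tau>}" for t x
        using has_derivative_eval[OF d1[OF that]] by (simp add: \<phi>_def \<psi>_def)
      show "((\<lambda>s. \<psi> s x) has_real_derivative force p \<sigma> (\<phi> t) (\<psi> t) x * \<phi> t x) (at t within {0..\<tau>})"
        if "t \<in> {0..\<tau>}" for t x
        using has_derivative_eval[OF d2[OF that], of x] by (simp add: \<phi>_def \<psi>_def bforce_apply)
    qed (use z in \<open>auto simp: \<phi>_def \<psi>_def z0_def w const_bcontfun.rep_eq\<close>)
    show "\<tau> = N \<or> (\<exists>x. \<bar>\<phi> \<tau> x\<bar> > r1 \<or> \<bar>\<psi> \<tau> x\<bar> > r2)"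
    proof (rule ccontr)
      assume *: "\<not> ?thesis"
      then have "norm (fst (z \<tau>)) \<le> r1" "norm (snd (z \<tau>)) \<le> r2"
        by (auto intro!: norm_bound simp: \<phi>_def \<psi>_def not_less)
      then have "norm (z \<tau>) \<le> r1 + r2"
        using norm_Pair_le[of "fst (z \<tau>)" "snd (z \<tau>)"] by simp
      moreover have "norm (z \<tau>) = R" using * z(5) by simp
      ultimately show False using norm_ge_zero[of z0] unfolding R_def by linarith
    qed
  qed (use z in auto)
qed

section \<open>Conservation laws and a priori bounds along trajectories\<close>

lemma C2_circleD:
  assumes "C2_circle f"
  shows "periodic1 f"
    and "(f has_real_derivative deriv f x) (at x)"
    and "(deriv f has_real_derivative deriv (deriv f) x) (at x)"
    and "continuous_on S f" "continuous_on S (deriv f)" "continuous_on S (deriv (deriv f))"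
    and "periodic1 (deriv f)" "periodic1 (deriv (deriv f))"
    and "integral {0..1} (deriv f) = 0"
proof -
  have per: "f (x + 1) = f x" for x using assms by (simp add: C2_circle_def)
  then show "periodic1 f" by (simp add: periodic1_def)
  have d: "(f has_real_derivative deriv f x) (at x)" for x
    using assms by (simp add: C2_circle_def differentiable_on_def DERIV_deriv_iff_real_differentiable)
  show "(f has_real_derivative deriv f x) (at x)" by (rule d)
  have d2: "(deriv f has_real_derivative deriv (deriv f) x) (at x)" for x
    using assms by (simp add: C2_circle_def differentiable_on_def DERIV_deriv_iff_real_differentiable)
  show "(deriv f has_real_derivative deriv (deriv f) x) (at x)" by (rule d2)
  show "continuous_on S f" by (meson DERIV_isCont continuous_at_imp_continuous_on d)
  show c: "continuous_on S (deriv f)" for S by (meson DERIV_isCont continuous_at_imp_continuous_on d2)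
  show "continuous_on S (deriv (deriv f))"
    using assms by (auto simp: C2_circle_def intro: continuous_on_subset)
  have p1: "deriv f (x + 1) = deriv f x" for x
  proof -
    have "((\<lambda>x. f (x + 1)) has_real_derivative deriv f (x + 1)) (at x)"
      by (rule DERIV_shift[THEN iffD1, OF d])
    then show ?thesis unfolding per by (rule DERIV_imp_deriv[symmetric])
  qed
  have p2: "deriv (deriv f) (x + 1) = deriv (deriv f) x" for x
  proof -
    have "((\<lambda>x. deriv f (x + 1)) has_real_derivative deriv (deriv f) (x + 1)) (at x)"
      by (rule DERIV_shift[THEN iffD1, OF d2])
    then show ?thesis unfolding p1 by (rule DERIV_imp_deriv[symmetric])
  qed
  show "periodic1 (deriv f)" "periodic1 (deriv (deriv f))" using p1 p2 by (auto simp: periodic1_def)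
  have "integral {0..1} (deriv f) = prim (deriv f) 1" by (simp add: prim_1)
  also have "\<dots> = f 1 - f 0" by (rule prim_unique[OF d])
  finally show "integral {0..1} (deriv f) = 0" using per[of 0] by simp
qed

lemma C2_circle_deriv_bounded:
  assumes "C2_circle u0" obtains B where "\<And>x. \<bar>deriv u0 x\<bar> \<le> B"
proof -
  have "continuous_on ({0..0::real} \<times> UNIV) (\<lambda>(t, x). deriv u0 x)"
    unfolding split_beta
    by (intro continuous_on_compose2[OF C2_circleD(5)[OF assms, of UNIV]] continuous_intros) auto
  from periodic_bounded_joint[OF this] C2_circleD(7)[OF assms] show ?thesis
    using that by (metis atLeastAtMost_iff order_refl)
qed

lemma per_prim_on_unit:
  assumes "x \<in> {0..1}" shows "per_prim g x = prim g x - x * integral {0..1} g"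
proof (cases "x = 1")
  case False then show ?thesis using assms by (simp add: per_prim_def frac_eq[THEN iffD2])
qed (simp add: per_prim_def prim_1)

text \<open>
  The mean value of \<open>g t\<close> between \<open>x\<close> and \<open>y\<close>; multiplied by \<open>y - x\<close> it is an increment of the
  primitive, which gives difference quotients that remain continuous at \<open>y = x\<close>.
\<close>

lemma joint_average:
  fixes g :: "real \<Rightarrow> real \<Rightarrow> real"
  assumes "continuous_on (S \<times> UNIV) (\<lambda>(t,x). g t x)"
  shows "continuous_on (S \<times> UNIV) (\<lambda>(t,y). integral {0..1} (\<lambda>r. g t (x + r * (y - x))))"
proof -
  have "continuous_on ((S \<times> UNIV) \<times> {0..1}) (\<lambda>(z,r). g (fst z) (x + r * (snd z - x)))"
    unfolding split_beta
    by (rule joint_compose[OF assms]) (auto intro!: continuous_intros)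
  then show ?thesis
    using integral_continuous_on_param[of "S \<times> UNIV" 0 1 "\<lambda>z r. g (fst z) (x + r * (snd z - x))"]
    by (simp add: cbox_interval split_beta)
qed

locale lagrangian_motion =
  fixes p :: nat and u0 :: "real \<Rightarrow> real" and \<tau> :: real and \<phi> \<psi> :: "real \<Rightarrow> real \<Rightarrow> real"
  assumes p: "p = 1 \<or> p = 2" and u0: "C2_circle u0"
    and sys: "lagrangian_system p (mean u0) (deriv u0) \<tau> \<phi> \<psi>"
begin

abbreviation "\<sigma> \<equiv> mean u0"
abbreviation "v \<equiv> deriv u0"
definition "g t = jac_rate p (\<phi> t) (\<psi> t)"
definition "F t = force p \<sigma> (\<phi> t) (\<psi> t)"
definition "\<kappa> = (real p + 2) / (real p)\<^sup>2 * \<sigma>"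
definition "energy t = integral {0..1} (\<lambda>y. (\<psi> t y)\<^sup>2)"

lemma p_pos: "p > 0" using p by auto

lemma \<tau>_pos: "\<tau> > 0" and phi_0: "\<phi> 0 x = 1" and psi_0: "\<psi> 0 x = v x / p"
  and phi_cont: "continuous_on ({0..\<tau>} \<times> UNIV) (\<lambda>(t,x). \<phi> t x)"
  and psi_cont: "continuous_on ({0..\<tau>} \<times> UNIV) (\<lambda>(t,x). \<psi> t x)"
  using sys by (auto simp: lagrangian_system_def)

lemma phi_t: "t \<in> {0..\<tau>} \<Longrightarrow> ((\<lambda>s. \<phi> s x) has_real_derivative \<psi> t x) (at t within {0..\<tau>})"
  and psi_t: "t \<in> {0..\<tau>} \<Longrightarrow> ((\<lambda>s. \<psi> s x) has_real_derivative F t x * \<phi> t x) (at t within {0..\<tau>})"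
  using sys by (auto simp: lagrangian_system_def F_def)

lemmas phi_comp = joint_compose[OF phi_cont] and psi_comp = joint_compose[OF psi_cont]

lemma g_eq: "g t x = p * \<phi> t x ^ (p - 1) * \<psi> t x"
  by (simp add: g_def jac_rate_def)

lemma g_cont: "continuous_on ({0..\<tau>} \<times> UNIV) (\<lambda>(t,x). g t x)"
  unfolding g_eq split_beta
  by (intro continuous_intros phi_comp psi_comp) auto

lemmas g_comp = joint_compose[OF g_cont]

lemma slices: assumes "t \<in> {0..\<tau>}"
  shows "continuous_on S (\<phi> t)" "continuous_on S (\<psi> t)" "continuous_on S (g t)"
  using joint_slice[OF phi_cont assms] joint_slice[OF psi_cont assms] joint_slice[OF g_cont assms]
  by (auto intro: continuous_on_subset)

text \<open>
  Until \<open>g t\<close> is known to have mean zero, only this corrected primitive is available; afterwards it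
  coincides with \<open>A\<close>.
\<close>

definition "A0 t = per_prim (g t)"
definition "A0mean t = integral {0..1} (\<lambda>y. A0 t y * \<phi> t y ^ p)"

lemma F_eq: "F t x = \<kappa> * (A0 t x - A0mean t) - (real p - 1) * energy t"
  by (simp add: F_def force_def \<kappa>_def A0_def g_def energy_def A0mean_def)

lemma energy_cont: "continuous_on {0..\<tau>} energy"
  unfolding energy_def[abs_def]
  by (rule joint_integral) (auto simp: split_beta intro!: continuous_intros psi_comp)

lemma A0_cont01: "continuous_on ({0..\<tau>} \<times> {0..1}) (\<lambda>(t,x). A0 t x)"
proof -
  have "continuous_on ({0..\<tau>} \<times> {0..1}) (\<lambda>(t,x). prim (g t) x - x * integral {0..1} (g t))"
    unfolding split_beta
    by (intro continuous_intros joint_compose[OF joint_prim[OF g_cont]]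
        continuous_on_compose2[OF joint_integral[of "{0..\<tau>}" 0 1 g]] continuous_on_subset[OF g_cont]) auto
  then show ?thesis
    by (rule continuous_on_cong[THEN iffD1, OF refl, rotated]) (auto simp: A0_def per_prim_on_unit)
qed

lemma A0mean_cont: "continuous_on {0..\<tau>} A0mean"
  unfolding A0mean_def[abs_def]
  by (rule joint_integral)
     (auto simp: split_beta intro!: continuous_intros phi_comp joint_compose[OF A0_cont01])

lemma F_cont_t: "continuous_on {0..\<tau>} (\<lambda>t. F t x)"
proof -
  have "A0 t x = A0 t (frac x)" for t
    by (simp add: A0_def per_prim_def)
  moreover have "continuous_on {0..\<tau>} (\<lambda>t. A0 t (frac x))"
    by (rule joint_slice2[OF A0_cont01]) (simp add: less_imp_le[OF frac_lt_1])
  ultimately show ?thesis unfolding F_eq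
    by (auto intro!: continuous_intros energy_cont A0mean_cont)
qed

text \<open>
  The force is periodic by construction, so the increments over one period solve the same linear
  equation with zero initial values.
\<close>

lemma phi_psi_periodic:
  assumes "t \<in> {0..\<tau>}" shows "periodic1 (\<phi> t)" "periodic1 (\<psi> t)"
proof -
  have *: "\<phi> t (x + 1) - \<phi> t x = 0 \<and> \<psi> t (x + 1) - \<psi> t x = 0" for x
  proof (rule linear_ode_zero[of \<tau> "\<lambda>t. \<phi> t (x + 1) - \<phi> t x" "\<lambda>t. \<psi> t (x + 1) - \<psi> t x" "\<lambda>t. F t x" 0])
    fix t assume t: "t \<in> {0..\<tau>}"
    show "((\<lambda>t. \<phi> t (x + 1) - \<phi> t x) has_real_derivative \<psi> t (x + 1) - \<psi> t x) (at t within {0..\<tau>})"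
      by (intro DERIV_diff phi_t t)
    have "F t (x + 1) = F t x" by (simp add: F_eq A0_def per_prim_periodic)
    then show "((\<lambda>t. \<psi> t (x + 1) - \<psi> t x) has_real_derivative F t x * (\<phi> t (x + 1) - \<phi> t x)) (at t within {0..\<tau>})"
      using DERIV_diff[OF psi_t[OF t, of "x+1"] psi_t[OF t, of x]] by (simp add: algebra_simps)
  qed (use F_cont_t assms \<tau>_pos phi_0 psi_0 C2_circleD(7)[OF u0] in \<open>auto simp: periodic1_def\<close>)
  show "periodic1 (\<phi> t)" "periodic1 (\<psi> t)" using * by (auto simp: periodic1_def)
qed

lemma g_periodic: "t \<in> {0..\<tau>} \<Longrightarrow> periodic1 (g t)"
  using phi_psi_periodic[of t] by (auto simp: periodic1_def g_eq)

lemma phi_pow_t: "t \<in> {0..\<tau>} \<Longrightarrow> ((\<lambda>s. \<phi> s x ^ p) has_real_derivative g t x) (at t within {0..\<tau>})"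
  using phi_t[of t x] by (auto intro!: derivative_eq_intros simp: g_eq)

lemma g_t:
  assumes "t \<in> {0..\<tau>}"
  shows "((\<lambda>s. g s x) has_real_derivative p * (real p - 1) * (\<psi> t x)\<^sup>2 + p * F t x * \<phi> t x ^ p) (at t within {0..\<tau>})"
  using p phi_t[OF assms, of x] psi_t[OF assms, of x] unfolding g_eq
  by (auto intro!: derivative_eq_intros simp: power2_eq_square algebra_simps)

text \<open>
  With \<open>N = \<integral>\<phi>\<^sup>p\<close> one finds \<open>N' = \<integral>g\<close> and \<open>N'' = - c (N - 1)\<close> for a continuous \<open>c\<close>, and both
  \<open>N - 1\<close> and \<open>N'\<close> vanish initially. The two conclusions say that the flow map has degree one and that
  the velocity is periodic.
\<close>

lemma normalisation:
  assumes t: "t \<in> {0..\<tau>}"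
  shows "integral {0..1} (\<lambda>x. \<phi> t x ^ p) = 1" and "integral {0..1} (g t) = 0"
proof -
  define N where "N t = integral {0..1} (\<lambda>x. \<phi> t x ^ p)" for t
  \<comment> \<open>the cases \<open>p = 1\<close> and \<open>p = 2\<close> combine: the time derivative of \<open>g\<close> is \<open>p (p - 1) \<psi>\<^sup>2 + p F \<phi>\<^sup>p\<close> in both\<close>
  define c where "c t = p * \<kappa> * A0mean t + p * (real p - 1) * energy t" for t
  have N_t: "(N has_real_derivative integral {0..1} (g t)) (at t within {0..\<tau>})" if "t \<in> {0..\<tau>}" for t
    unfolding N_def[abs_def]
    by (rule integral_has_derivative_param[where S="{0..\<tau>}"])
      (use that in \<open>auto intro!: phi_pow_t continuous_intros slices continuous_on_subset[OF g_cont]\<close>)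
  have F01: "continuous_on ({0..\<tau>} \<times> {0..1}) (\<lambda>(t,x). F t x)"
    unfolding F_eq split_beta
    by (intro continuous_intros joint_compose[OF A0_cont01]
        continuous_on_compose2[OF A0mean_cont] continuous_on_compose2[OF energy_cont]) auto
  have a_t: "((\<lambda>t. integral {0..1} (g t)) has_real_derivative - c t * (N t - 1)) (at t within {0..\<tau>})"
    if t: "t \<in> {0..\<tau>}" for t
  proof -
    have "((\<lambda>t. integral {0..1} (g t)) has_real_derivative
      integral {0..1} (\<lambda>x. p * (real p - 1) * (\<psi> t x)\<^sup>2 + p * F t x * \<phi> t x ^ p)) (at t within {0..\<tau>})"
    proof (rule integral_has_derivative_param[where S="{0..\<tau>}"])
      show "continuous_on ({0..\<tau>} \<times> {0..1}) (\<lambda>(t,x). p * (real p - 1) * (\<psi> t x)\<^sup>2 + p * F t x * \<phi> t x ^ p)"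
        unfolding split_beta
        by (intro continuous_intros joint_compose[OF F01] phi_comp psi_comp) auto
    qed (use t in \<open>auto intro!: g_t slices\<close>)
    also have "integral {0..1} (\<lambda>x. p * (real p - 1) * (\<psi> t x)\<^sup>2 + p * F t x * \<phi> t x ^ p)
       = integral {0..1} (\<lambda>x. p * (real p - 1) * (\<psi> t x)\<^sup>2 + (p * \<kappa>) * (A0 t x * \<phi> t x ^ p)
            + (- p * \<kappa> * A0mean t - p * (real p - 1) * energy t) * \<phi> t x ^ p)"
      by (intro integral_cong) (simp add: F_eq algebra_simps)
    also have "\<dots> = p * (real p - 1) * energy t + (p * \<kappa>) * A0mean t
            + (- p * \<kappa> * A0mean t - p * (real p - 1) * energy t) * N t"
    proof -
      have c: "continuous_on {0..1} (\<lambda>x. \<phi> t x ^ p)" "continuous_on {0..1} (\<lambda>x. (\<psi> t x)\<^sup>2)"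
        "continuous_on {0..1} (\<lambda>x. A0 t x * \<phi> t x ^ p)"
        using joint_slice[OF A0_cont01 t] t by (auto intro!: continuous_intros slices)
      show ?thesis
        unfolding energy_def N_def A0mean_def
        by (subst integral_add, (intro integrable_continuous_interval continuous_intros c)+)+
           (simp add: integral_mult_right)
    qed
    finally show ?thesis by (simp add: c_def algebra_simps)
  qed
  have "(\<lambda>t. N t - 1) t = 0 \<and> integral {0..1} (g t) = 0"
  proof (rule linear_ode_zero[of \<tau> "\<lambda>t. N t - 1" "\<lambda>t. integral {0..1} (g t)" "\<lambda>t. - c t" 0])
    show "continuous_on {0..\<tau>} (\<lambda>t. - c t)" unfolding c_def
      by (intro continuous_intros A0mean_cont energy_cont)
    show "((\<lambda>t. N t - 1) has_real_derivative integral {0..1} (g t)) (at t within {0..\<tau>})"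
      if "t \<in> {0..\<tau>}" for t using N_t[OF that] by (auto intro!: derivative_eq_intros)
    have "g 0 = v" by (rule ext) (use p_pos in \<open>simp add: g_eq phi_0 psi_0\<close>)
    then show "integral {0..1} (g 0) = 0" using C2_circleD(9)[OF u0] by simp
  qed (use a_t t \<tau>_pos in \<open>auto simp: N_def phi_0\<close>)
  then show "integral {0..1} (\<lambda>x. \<phi> t x ^ p) = 1" "integral {0..1} (g t) = 0" by (auto simp: N_def)
qed

lemma phi_pow_periodic: "t \<in> {0..\<tau>} \<Longrightarrow> periodic1 (\<lambda>x. \<phi> t x ^ p)"
  using phi_psi_periodic[of t] by (auto simp: periodic1_def)

definition "A t = prim (g t)"
text \<open>
  The velocity along trajectories.
\<close>

definition "U t x = \<sigma> + A t x - A0mean t"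

lemma A0_eq: "t \<in> {0..\<tau>} \<Longrightarrow> A0 t = A t"
  unfolding A0_def A_def by (intro per_prim_eq_prim slices g_periodic normalisation)

lemma A_cont: "continuous_on ({0..\<tau>} \<times> UNIV) (\<lambda>(t,x). A t x)"
  unfolding A_def by (rule joint_prim[OF g_cont])

lemma U_cont: "continuous_on ({0..\<tau>} \<times> UNIV) (\<lambda>(t,x). U t x)"
  unfolding U_def split_beta
  by (intro continuous_intros joint_compose[OF A_cont] continuous_on_compose2[OF A0mean_cont]) auto

lemma A_x: "t \<in> {0..\<tau>} \<Longrightarrow> (A t has_real_derivative g t x) (at x)"
  unfolding A_def by (intro prim_has_derivative slices)

lemma U_x: "t \<in> {0..\<tau>} \<Longrightarrow> (U t has_real_derivative g t x) (at x)"
  unfolding U_def[abs_def] using A_x[of t x] by (auto intro!: derivative_eq_intros)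

lemma U_slice: "t \<in> {0..\<tau>} \<Longrightarrow> continuous_on S (U t)"
  using joint_slice[OF U_cont] by (auto intro: continuous_on_subset)

lemma F_eq_U: "t \<in> {0..\<tau>} \<Longrightarrow> F t x = \<kappa> * (U t x - \<sigma>) - (real p - 1) * energy t"
  by (simp add: F_eq A0_eq U_def)

lemma F_cont: "continuous_on ({0..\<tau>} \<times> UNIV) (\<lambda>(t,x). F t x)"
proof -
  have "continuous_on ({0..\<tau>} \<times> UNIV) (\<lambda>(t,x). \<kappa> * (U t x - \<sigma>) - (real p - 1) * energy t)"
    unfolding split_beta
    by (intro continuous_intros joint_compose[OF U_cont] continuous_on_compose2[OF energy_cont]) auto
  then show ?thesis
    by (rule continuous_on_cong[THEN iffD1, OF refl, rotated]) (auto simp: F_eq_U)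
qed

lemma U_periodic: "t \<in> {0..\<tau>} \<Longrightarrow> periodic1 (U t)"
  using prim_period[OF slices(3) g_periodic, of t] normalisation(2)[of t] by (simp add: periodic1_def U_def A_def)

lemma U_mean:
  assumes t: "t \<in> {0..\<tau>}" shows "integral {0..1} (\<lambda>x. U t x * \<phi> t x ^ p) = \<sigma>"
proof -
  have c: "continuous_on {0..1} (\<lambda>x. \<phi> t x ^ p)" "continuous_on {0..1} (\<lambda>x. A t x * \<phi> t x ^ p)"
    using joint_slice[OF A_cont t] t by (auto intro!: continuous_intros slices intro: continuous_on_subset)
  have "integral {0..1} (\<lambda>x. U t x * \<phi> t x ^ p) = integral {0..1} (\<lambda>x. A t x * \<phi> t x ^ p + (\<sigma> - A0mean t) * \<phi> t x ^ p)"
    by (intro integral_cong) (simp add: U_def algebra_simps)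
  also have "\<dots> = A0mean t + (\<sigma> - A0mean t) * 1"
    by (subst integral_add, (intro integrable_continuous_interval continuous_intros c)+)
       (simp add: normalisation[OF t] A0mean_def A0_eq[OF t])
  finally show ?thesis by simp
qed

lemma U_0: "U 0 x = u0 x"
proof -
  have g0: "g 0 = v" by (rule ext) (use p_pos in \<open>simp add: g_eq phi_0 psi_0\<close>)
  have A: "A 0 x = u0 x - u0 0" for x
    unfolding A_def g0 by (rule prim_unique) (rule C2_circleD[OF u0])
  have "A0mean 0 = integral {0..1} (\<lambda>y. u0 y - u0 0)"
    using A0_eq[of 0] \<tau>_pos by (simp add: A0mean_def A phi_0)
  also have "\<dots> = \<sigma> - u0 0"
    unfolding mean_def by (subst integral_diff) (auto intro!: integrable_continuous_interval C2_circleD[OF u0])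
  finally show ?thesis by (simp add: U_def A)
qed

text \<open>
  For \<open>p = 2\<close> the derivative of the energy is the integral of \<open>F U\<^sub>x\<close>, and \<open>F\<close> is an affine function of
  \<open>U\<close>; so the integrand is the derivative of a periodic function.
\<close>

lemma energy_conserved:
  assumes "t \<in> {0..\<tau>}" shows "(real p - 1) * energy t = (real p - 1) * energy 0"
proof (cases "p = 1")
  case False
  with p have p2: "p = 2" by simp
  have "(energy has_real_derivative 0) (at t within {0..\<tau>})" if t: "t \<in> {0..\<tau>}" for t
  proof -
    have "(energy has_real_derivative integral {0..1} (\<lambda>x. 2 * \<psi> t x * (F t x * \<phi> t x))) (at t within {0..\<tau>})"
      unfolding energy_def[abs_def]
    proof (rule integral_has_derivative_param[where S="{0..\<tau>}"])
      show "continuous_on ({0..\<tau>} \<times> {0..1}) (\<lambda>(t,x). 2 * \<psi> t x * (F t x * \<phi> t x))"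
        unfolding split_beta
        by (intro continuous_intros joint_compose[OF F_cont] phi_comp psi_comp) auto
      show "((\<lambda>t. (\<psi> t x)\<^sup>2) has_real_derivative 2 * \<psi> t x * (F t x * \<phi> t x)) (at t within {0..\<tau>})"
        if "t \<in> {0..\<tau>}" for t x
        using psi_t[OF that, of x] by (auto intro!: derivative_eq_intros)
    qed (use t in \<open>auto intro!: continuous_intros slices\<close>)
    moreover have "((\<lambda>x. 2 * \<psi> t x * (F t x * \<phi> t x)) has_integral
        (\<lambda>x. \<kappa> * (U t x - \<sigma>)\<^sup>2 / 2 - energy t * U t x) 1 - (\<lambda>x. \<kappa> * (U t x - \<sigma>)\<^sup>2 / 2 - energy t * U t x) 0) {0..1}"
    proof (rule fundamental_theorem_of_calculus)
      show "((\<lambda>x. \<kappa> * (U t x - \<sigma>)\<^sup>2 / 2 - energy t * U t x) has_vector_derivative 2 * \<psi> t x * (F t x * \<phi> t x))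
          (at x within {0..1})" for x
      proof -
        have p': "real p = 2" "p - 1 = 1" using p2 by simp_all
        have "F t x = \<kappa> * (U t x - \<sigma>) - energy t" "g t x = 2 * \<phi> t x * \<psi> t x"
          unfolding F_eq_U[OF t] g_eq p' by simp_all
        then have e: "2 * \<psi> t x * (F t x * \<phi> t x) = \<kappa> * (U t x - \<sigma>) * g t x - energy t * g t x"
          by (simp only:) (simp add: algebra_simps)
        show ?thesis
          unfolding has_real_derivative_iff_has_vector_derivative[symmetric] e
          using has_field_derivative_at_within[OF U_x[OF t, of x], of "{0..1}"]
          by (auto intro!: derivative_eq_intros simp: field_simps)
      qed
    qed simp
    ultimately show ?thesis using U_periodic[OF t, unfolded periodic1_def, rule_format, of 0]
      by (simp add: integral_unique)
  qed
  then have "energy t = energy 0"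
    using has_field_derivative_zero_constant[of "{0..\<tau>}" energy] assms \<tau>_pos by fastforce
  then show ?thesis by simp
qed simp

lemma energy_nonneg: "t \<in> {0..\<tau>} \<Longrightarrow> (real p - 1) * energy t \<ge> 0"
  using p unfolding energy_def
  by (auto intro!: mult_nonneg_nonneg integral_nonneg integrable_continuous_interval continuous_intros slices)

end

locale lagrangian_flow = lagrangian_motion +
  assumes pos: "\<And>t x. 0 \<le> t \<Longrightarrow> t < \<tau> \<Longrightarrow> \<phi> t x > 0"
begin

text \<open>
  The slope \<open>u\<^sub>\<theta>\<close> along trajectories.
\<close>

definition "W t x = p * \<psi> t x / \<phi> t x"

lemma W_jac: "0 \<le> t \<Longrightarrow> t < \<tau> \<Longrightarrow> W t x * \<phi> t x ^ p = g t x"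
  using pos[of t x] p by (auto simp: W_def g_eq power2_eq_square)

lemma W_cont: "continuous_on ({0..<\<tau>} \<times> UNIV) (\<lambda>(t,x). W t x)"
  unfolding W_def split_beta
  using pos by (intro continuous_intros phi_comp psi_comp) (auto, metis less_irrefl)

lemma W_0: "W 0 x = v x" using p_pos by (simp add: W_def phi_0 psi_0)

lemma W_t:
  assumes t: "0 \<le> t" "t < \<tau>"
  shows "((\<lambda>s. W s x) has_real_derivative p * F t x - (W t x)\<^sup>2 / p) (at t within {0..\<tau>})"
  unfolding W_def
  using phi_t[of t x] psi_t[of t x] pos[OF t, of x] t p_pos
  by (auto intro!: derivative_eq_intros simp: field_simps power2_eq_square)

lemma W_periodic: "t \<in> {0..\<tau>} \<Longrightarrow> periodic1 (W t)"
  using phi_psi_periodic[of t] by (auto simp: periodic1_def W_def)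

text \<open>
  For two labels the Wronskian \<open>\<phi>(x) \<psi>(y) - \<psi>(x) \<phi>(y)\<close> is \<open>\<phi>(x) \<phi>(y) / p\<close> times the increment of
  \<open>W\<close>, and its time derivative contains only the increment of the force, which is differentiable in
  the label. Dividing by \<open>y - x\<close> gives the derivative of \<open>W\<close>, although \<open>\<phi>\<close> is only known to be
  continuous in the label. In the limit \<open>y \<rightarrow> x\<close> the integrand is
  an exact time derivative of a multiple of \<open>\<phi>\<^bsup>p+2\<^esup>\<close>.
\<close>

lemma W_x:
  assumes t: "0 \<le> t" "t < \<tau>"
  shows "(W t has_real_derivative \<sigma> * \<phi> t x ^ p - momentum u0 x / (\<phi> t x)\<^sup>2) (at x)"
proof -
  define h where "h s y = integral {0..1} (\<lambda>r. g s (x + r * (y - x)))" for s y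
  have h_cont: "continuous_on ({0..\<tau>} \<times> UNIV) (\<lambda>(s,y). h s y)"
    unfolding h_def by (rule joint_average[OF g_cont])
  have h_eq: "A s y - A s x = (y - x) * h s y" if "s \<in> {0..\<tau>}" for s y
  proof -
    have "prim (\<lambda>z. g s (z + x)) (y - x) = A s ((y - x) + x) - A s (0 + x)"
      by (rule prim_unique[where H="\<lambda>z. A s (z + x)"])
         (rule DERIV_shift[THEN iffD1, OF A_x[OF that]])
    then show ?thesis by (simp add: prim_def h_def add.commute)
  qed
  define B where "B y = integral {0..t} (\<lambda>s. \<phi> s x * \<phi> s y * h s y)" for y
  have "continuous_on (UNIV \<times> {0..t}) (\<lambda>(y,s). \<phi> s x * \<phi> s y * h s y)"
    unfolding split_beta using t
    by (intro continuous_intros joint_compose[OF h_cont] phi_comp) auto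
  then have B_cont: "continuous_on UNIV B"
    unfolding B_def[abs_def] by (rule joint_integral)
  \<comment> \<open>the terms \<open>F \<phi> \<phi>\<close> cancel in the derivative of the Wronskian, except for the increment of \<open>F\<close>\<close>
  have wronskian: "\<phi> t x * \<psi> t y - \<psi> t x * \<phi> t y = (v y - v x) / p + \<kappa> * ((y - x) * B y)" for y
  proof -
    define w where "w s = \<phi> s x * \<psi> s y - \<psi> s x * \<phi> s y" for s
    have "((\<lambda>s. \<kappa> * ((y - x) * (\<phi> s x * \<phi> s y * h s y))) has_integral w t - w 0) {0..t}"
    proof (rule fundamental_theorem_of_calculus[OF t(1)])
      fix s assume s: "s \<in> {0..t}"
      then have s': "s \<in> {0..\<tau>}" using t by auto
      have "(w has_real_derivative \<phi> s x * \<phi> s y * (F s y - F s x)) (at s within {0..\<tau>})"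
        unfolding w_def using phi_t[OF s', of x] phi_t[OF s', of y] psi_t[OF s', of x] psi_t[OF s', of y]
        by (auto intro!: derivative_eq_intros simp: algebra_simps)
      moreover have "F s y - F s x = \<kappa> * (A s y - A s x)"
        by (simp add: F_eq_U[OF s'] U_def algebra_simps)
      ultimately show "(w has_vector_derivative \<kappa> * ((y - x) * (\<phi> s x * \<phi> s y * h s y))) (at s within {0..t})"
        unfolding has_real_derivative_iff_has_vector_derivative[symmetric] h_eq[OF s']
        using t by (auto intro: has_field_derivative_subset simp: algebra_simps)
    qed
    from integral_unique[OF this] show ?thesis
      by (simp add: w_def B_def phi_0 psi_0 diff_divide_distrib integral_mult_right)
  qed
  \<comment> \<open>Caratheodory form of differentiability, for \<open>v\<close> and then for \<open>W t\<close>\<close>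
  obtain q where q: "\<And>y. v y - v x = q y * (y - x)" "isCont q x" "q x = deriv v x"
    using C2_circleD(3)[OF u0, of x] unfolding CARAT_DERIV by blast
  have phi_ne: "\<phi> t y \<noteq> 0" for y using pos[OF t, of y] by simp
  have "(W t has_real_derivative (q x + p * \<kappa> * B x) / (\<phi> t x * \<phi> t x)) (at x)"
    unfolding CARAT_DERIV
  proof (intro exI[of _ "\<lambda>y. (q y + p * \<kappa> * B y) / (\<phi> t x * \<phi> t y)"] conjI allI)
    fix y
    have "W t y - W t x = p * (\<phi> t x * \<psi> t y - \<psi> t x * \<phi> t y) / (\<phi> t x * \<phi> t y)"
      using phi_ne[of x] phi_ne[of y] by (simp add: W_def field_simps)
    also have "p * (\<phi> t x * \<psi> t y - \<psi> t x * \<phi> t y) = (q y + p * \<kappa> * B y) * (y - x)"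
      unfolding wronskian q(1) using p_pos by (simp add: field_simps)
    finally show "W t y - W t x = (q y + p * \<kappa> * B y) / (\<phi> t x * \<phi> t y) * (y - x)" by simp
  next
    have "isCont B x" "isCont (\<phi> t) x"
      using B_cont slices(1)[of t UNIV] t by (auto simp: continuous_on_eq_continuous_at)
    then show "isCont (\<lambda>y. (q y + p * \<kappa> * B y) / (\<phi> t x * \<phi> t y)) x"
      using q(2) phi_ne by (intro continuous_intros) auto
  qed simp
  moreover have pkB: "p * \<kappa> * B x = \<sigma> * (\<phi> t x ^ (p + 2) - 1)"
  proof -
    have "((\<lambda>s. \<phi> s x * \<phi> s x * g s x) has_integral
        p / (real p + 2) * \<phi> t x ^ (p + 2) - p / (real p + 2) * \<phi> 0 x ^ (p + 2)) {0..t}"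
    proof (rule fundamental_theorem_of_calculus[OF t(1)])
      fix s assume s: "s \<in> {0..t}"
      then have s': "s \<in> {0..\<tau>}" using t by auto
      have "((\<lambda>s. p / (real p + 2) * \<phi> s x ^ (p + 2)) has_real_derivative \<phi> s x * \<phi> s x * g s x) (at s within {0..\<tau>})"
        using phi_t[OF s', of x] p
        by (auto intro!: derivative_eq_intros simp: g_eq field_simps power2_eq_square eval_nat_numeral)
      then show "((\<lambda>s. p / (real p + 2) * \<phi> s x ^ (p + 2)) has_vector_derivative \<phi> s x * \<phi> s x * g s x) (at s within {0..t})"
        unfolding has_real_derivative_iff_has_vector_derivative[symmetric]
        by (rule has_field_derivative_subset) (use t in auto)
    qed
    then have "B x = p / (real p + 2) * (\<phi> t x ^ (p + 2) - 1)"
      by (simp add: B_def h_def phi_0 integral_unique algebra_simps)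
    moreover have "r * (q / r\<^sup>2 * s) * (r / q * X) = s * X" if "r \<noteq> 0" "q \<noteq> 0" for r q s X :: real
      using that by (simp add: power2_eq_square)
    moreover have "real p \<noteq> 0" "real p + 2 \<noteq> 0" using p by auto
    ultimately show ?thesis unfolding \<kappa>_def by presburger
  qed
  moreover have "(q x + p * \<kappa> * B x) / (\<phi> t x * \<phi> t x) = \<sigma> * \<phi> t x ^ p - momentum u0 x / (\<phi> t x)\<^sup>2"
    unfolding pkB q(3) momentum_def using phi_ne[of x] by (simp add: field_simps power2_eq_square power_add)
  ultimately show ?thesis by (simp only:)
qed

lemma F_le: 
  assumes "t \<in> {0..\<tau>}" "\<bar>U t x - \<sigma>\<bar> \<le> M" shows "F t x \<le> 3 * \<bar>\<sigma>\<bar> * M"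
proof -
  have "F t x \<le> \<kappa> * (U t x - \<sigma>)" using F_eq_U energy_nonneg assms by simp
  also have "\<dots> \<le> \<bar>\<kappa>\<bar> * \<bar>U t x - \<sigma>\<bar>" by (simp add: abs_mult[symmetric])
  also have "\<dots> \<le> (3 * \<bar>\<sigma>\<bar>) * M"
    using p assms by (intro mult_mono) (auto simp: \<kappa>_def abs_mult)
  finally show ?thesis .
qed

text \<open>
  With \<open>J\<close> the primitive of the Jacobian, \<open>U - M J\<close> is nonincreasing, and \<open>J\<close> increases by one over a
  period. Hence \<open>U\<close> rises by at most \<open>M\<close> from any label to any other one to its right in the same
  period, and by periodicity all values of \<open>U\<close> lie within \<open>M\<close> of each other and of their mean \<open>\<sigma>\<close>.
\<close>

lemma U_minus_mean_bound:
  assumes t: "0 \<le> t" "t < \<tau>" and W: "\<And>x. W t x \<le> M"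
  shows "\<bar>U t x - \<sigma>\<bar> \<le> M"
proof -
  have t': "t \<in> {0..\<tau>}" using t by simp
  have step: "U t z - U t y \<le> M" if yz: "y \<le> z" "z \<le> y + 1" for y z
  proof -
    define J where "J = prim (\<lambda>x. \<phi> t x ^ p)"
    have c: "continuous_on S (\<lambda>x. \<phi> t x ^ p)" for S by (intro continuous_intros slices t')
    have J: "(J has_real_derivative \<phi> t x ^ p) (at x)" for x
      unfolding J_def by (rule prim_has_derivative) (rule c)
    have "U t z - M * J z \<le> U t y - M * J y"
    proof (rule DERIV_nonpos_imp_nonincreasing[OF yz(1)])
      fix x
      have "((\<lambda>x. U t x - M * J x) has_real_derivative g t x - M * \<phi> t x ^ p) (at x)"
        using U_x[OF t', of x] J[of x] by (auto intro!: derivative_eq_intros)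
      moreover have "g t x - M * \<phi> t x ^ p \<le> 0"
        using mult_right_mono[OF W[of x], of "\<phi> t x ^ p"] pos[OF t, of x] W_jac[OF t, of x]
        by (simp add: less_imp_le)
      ultimately show "\<exists>d. ((\<lambda>x. U t x - M * J x) has_real_derivative d) (at x) \<and> d \<le> 0" by blast
    qed
    moreover have "J y \<le> J z"
      by (rule DERIV_nonneg_imp_nondecreasing[OF yz(1)]) (use J pos[OF t] in \<open>meson less_imp_le zero_le_power\<close>)
    moreover have "J z \<le> J (y + 1)"
      by (rule DERIV_nonneg_imp_nondecreasing[OF yz(2)]) (use J pos[OF t] in \<open>meson less_imp_le zero_le_power\<close>)
    moreover have "J (y + 1) = J y + 1"
      unfolding J_def using prim_period[OF c phi_pow_periodic[OF t'], of y] normalisation(1)[OF t'] by simp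
    moreover have "M \<ge> 0"
    proof (rule ccontr)
      assume "\<not> M \<ge> 0"
      then have "g t x < 0" for x
        using W[of x] W_jac[OF t, of x] pos[OF t, of x]
        by (metis le_less_trans mult_neg_pos not_le zero_less_power)
      moreover have "- g t 0 = 0"
        by (rule integral_nonneg_eq_0_imp[of 0 1 "\<lambda>x. - g t x"])
          (use normalisation(2)[OF t'] calculation in \<open>auto intro!: continuous_intros slices t' simp: less_imp_le\<close>)
      ultimately show False by (metis less_irrefl neg_equal_0_iff_equal)
    qed
    ultimately show ?thesis
      using mult_left_mono[of "J z - J y" 1 M] by (simp add: algebra_simps)
  qed
  have diff: "\<bar>U t y - U t x\<bar> \<le> M" for y
  proof -
    have per: "U t (frac z) = U t z" for z by (rule periodic1_frac[OF U_periodic[OF t']])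
    have *: "U t a - U t b \<le> M" for a b
    proof (cases "frac b \<le> frac a")
      case True
      then show ?thesis using step[of "frac b" "frac a"] per
        by (metis add.commute add_increasing2 frac_ge_0 frac_lt_1 less_imp_le order_trans)
    next
      case False
      then show ?thesis using step[of "frac b" "frac a + 1"] per U_periodic[OF t', unfolded periodic1_def]
        by (metis add.commute add_le_cancel_left add_mono frac_ge_0 frac_lt_1 le_cases less_imp_le order_trans add_increasing)
    qed
    show ?thesis using *[of y x] *[of x y] by simp
  qed
  have cU: "continuous_on {0..1} (\<lambda>y. U t y * \<phi> t y ^ p)" "continuous_on {0..1} (\<lambda>y. \<phi> t y ^ p)"
    by (intro continuous_intros slices t' U_slice)+
  have "\<sigma> \<le> integral {0..1} (\<lambda>y. (U t x + M) * \<phi> t y ^ p)"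
    unfolding U_mean[OF t', symmetric]
    using diff pos[OF t]
    by (intro integral_le integrable_continuous_interval continuous_intros cU mult_right_mono)
      (auto simp: less_imp_le abs_le_iff algebra_simps)
  moreover have "integral {0..1} (\<lambda>y. (U t x - M) * \<phi> t y ^ p) \<le> \<sigma>"
    unfolding U_mean[OF t', symmetric]
    using diff pos[OF t]
    by (intro integral_le integrable_continuous_interval continuous_intros cU mult_right_mono)
      (auto simp: less_imp_le abs_le_iff algebra_simps)
  ultimately show ?thesis using normalisation(1)[OF t'] by (simp add: abs_le_iff)
qed

lemma pF_le: 
  assumes "t \<in> {0..\<tau>}" "\<bar>U t x - \<sigma>\<bar> \<le> M" shows "p * F t x \<le> 3 * \<bar>\<sigma>\<bar> * M"
proof -
  have "F t x \<le> \<kappa> * (U t x - \<sigma>)" using F_eq_U energy_nonneg assms by simp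
  from mult_left_mono[OF this, of p] have "p * F t x \<le> p * \<kappa> * (U t x - \<sigma>)" by simp
  also have "\<dots> \<le> \<bar>p * \<kappa>\<bar> * \<bar>U t x - \<sigma>\<bar>" by (simp add: abs_mult[symmetric])
  also have "\<dots> \<le> (3 * \<bar>\<sigma>\<bar>) * M"
    using p assms by (intro mult_mono) (auto simp: \<kappa>_def abs_mult)
  finally show ?thesis .
qed

text \<open>
  At the first time at which \<open>W\<close> reaches the level \<open>M\<close>, the bound \<open>W \<le> M\<close> still holds at all labels,
  so that \<open>p F \<le> 3 \<bar>\<sigma>\<bar> M\<close>. The Riccati equation with \<open>p \<le> 2\<close> then gives
  \<open>W\<^sub>t \<le> 3 \<bar>\<sigma>\<bar> M - M\<^sup>2 / 2\<close>, which is negative because \<open>M > 6 \<bar>\<sigma>\<bar>\<close>; so \<open>W\<close> was larger just before.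
\<close>

lemma W_upper_bound:
  assumes B: "\<And>x. \<bar>v x\<bar> \<le> B" and t: "0 \<le> t" "t < \<tau>"
  shows "W t x < B + 6 * \<bar>\<sigma>\<bar> + 1"
proof (rule ccontr)
  define M where "M = B + 6 * \<bar>\<sigma>\<bar> + 1"
  have M: "M > 6 * \<bar>\<sigma>\<bar>" "M > 0" "\<And>x. v x < M"
  proof -
    have "B \<ge> 0" using B[of 0] by linarith
    then show "M > 6 * \<bar>\<sigma>\<bar>" "M > 0" by (auto simp: M_def)
    show "v x < M" for x using B[of x] unfolding M_def by linarith
  qed
  assume "\<not> ?thesis"
  then have x: "W t x \<ge> M" by (simp add: M_def)
  have Wc: "continuous_on ({0..t} \<times> UNIV) (\<lambda>(t,x). W t x)"
    by (rule continuous_on_subset[OF W_cont]) (use t in auto)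
  have "continuous_on ({0..t} \<times> UNIV) (\<lambda>(t,x). M - W t x)"
    using continuous_on_diff[OF continuous_on_const Wc] by (simp add: split_beta)
  moreover have "periodic1 (\<lambda>x. M - W r x)" if "r \<in> {0..t}" for r
    using W_periodic[of r] that t by (simp add: periodic1_def)
  ultimately obtain s y where s: "s \<in> {0..t}" and y: "M - W s y \<le> 0"
    and before: "\<And>r z. 0 \<le> r \<Longrightarrow> r < s \<Longrightarrow> 0 < M - W r z"
    by (rule first_nonpositive_time[where ?t1.0=t and ?x1.0=x and f="\<lambda>t x. M - W t x"]) (use t x in auto)
  have lt: "W r z < M" if "0 \<le> r" "r < s" for r z using before[OF that, of z] by simp
  have "s \<noteq> 0" using y W_0[of y] M(3)[of y] by auto
  with s have s0: "0 < s" "s < \<tau>" using t by auto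
  have nb: "at s within {0..<s} \<noteq> bot" using s0 by (simp add: at_within_eq_bot_iff)
  have le: "W s z \<le> M" for z
  proof (rule tendsto_upperbound[OF _ _ nb])
    have "continuous_on {0..t} (\<lambda>r. W r z)" by (rule joint_slice2[OF Wc]) simp
    then have "((\<lambda>r. W r z) \<longlongrightarrow> W s z) (at s within {0..t})" using s by (auto simp: continuous_on_def)
    then show "((\<lambda>r. W r z) \<longlongrightarrow> W s z) (at s within {0..<s})" by (rule tendsto_within_subset) (use s in auto)
    show "\<forall>\<^sub>F r in at s within {0..<s}. W r z \<le> M"
      by (auto simp: eventually_at_filter intro!: always_eventually less_imp_le[OF lt])
  qed
  have Wy: "W s y = M" using y le[of y] by simp
  have "p * F s y - (W s y)\<^sup>2 / p < 0"
  proof -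
    have "p * F s y \<le> 3 * \<bar>\<sigma>\<bar> * M"
      using pF_le[of s y M] U_minus_mean_bound[of s M y] le s0 by auto
    also have "\<dots> < M / 2 * M" using M by (intro mult_strict_right_mono) auto
    also have "\<dots> \<le> (W s y)\<^sup>2 / p" using p M by (auto simp: Wy power2_eq_square)
    finally show ?thesis by simp
  qed
  then obtain d where d: "d > 0" "\<And>h. 0 < h \<Longrightarrow> s - h \<in> {0..\<tau>} \<Longrightarrow> h < d \<Longrightarrow> W s y < W (s - h) y"
    using has_real_derivative_neg_dec_left[OF W_t[of s y]] s0 by auto
  define h where "h = min (d/2) (s/2)"
  have "0 < h" "h < d" "s - h \<in> {0..\<tau>}" "s - h < s" using d s0 by (auto simp: h_def min_def)
  then have "W s y < W (s - h) y" "W (s - h) y < M" using d(2) lt[of "s - h" y] by auto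
  then show False using Wy by simp
qed

lemma phi_upper_bound:
  assumes W: "\<And>s x. 0 \<le> s \<Longrightarrow> s < \<tau> \<Longrightarrow> W s x \<le> M" and M: "M \<ge> 0" and t: "t \<in> {0..\<tau>}"
  shows "\<phi> t x \<le> exp (M * t)"
proof -
  have "\<phi> t x * exp (- M * t) \<le> \<phi> 0 x * exp (- M * 0)"
  proof (rule DERIV_nonpos_within[where f="\<lambda>s. \<phi> s x * exp (- M * s)" and f'="\<lambda>s. (\<psi> s x - M * \<phi> s x) * exp (- M * s)"])
    fix s assume s: "s \<in> {0..t}"
    have "((\<lambda>s. \<phi> s x * exp (- M * s)) has_real_derivative (\<psi> s x - M * \<phi> s x) * exp (- M * s)) (at s within {0..\<tau>})"
      using phi_t[of s x] s t by (auto intro!: derivative_eq_intros simp: algebra_simps)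
    then show "((\<lambda>s. \<phi> s x * exp (- M * s)) has_real_derivative (\<psi> s x - M * \<phi> s x) * exp (- M * s)) (at s within {0..t})"
      by (rule has_field_derivative_subset) (use t in auto)
  next
    fix s assume "0 < s" "s < t"
    then have s: "0 \<le> s" "s < \<tau>" using t by auto
    have "p * \<psi> s x \<le> M * \<phi> s x" using W[OF s, of x] pos[OF s, of x] by (simp add: W_def field_simps)
    moreover have "\<psi> s x \<le> M * \<phi> s x" 
    proof (cases "\<psi> s x \<le> 0")
      case True then show ?thesis using M pos[OF s, of x] by (meson less_imp_le mult_nonneg_nonneg order_trans)
    next
      case False then show ?thesis using p \<open>p * \<psi> s x \<le> M * \<phi> s x\<close> by auto
    qed
    ultimately show "(\<psi> s x - M * \<phi> s x) * exp (- M * s) \<le> 0" by (intro mult_nonpos_nonneg) auto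
  qed (use t in auto)
  then show ?thesis by (simp add: phi_0 exp_minus field_simps)
qed

end

section \<open>From the Lagrangian to the Eulerian solution\<close>

text \<open>
  A chain rule that needs differentiability in the first variable only at one point and is valid at
  the initial time, where only one-sided time derivatives exist.
\<close>

lemma has_derivative_along_curve:
  fixes f fx :: "real \<Rightarrow> real \<Rightarrow> real"
  assumes ft: "((\<lambda>s. f s (c t)) has_real_derivative D) (at t within S)"
    and fx: "\<And>s x. s \<in> S \<Longrightarrow> (f s has_real_derivative fx s x) (at x)"
    and fxc: "continuous_on (S \<times> UNIV) (\<lambda>(s,x). fx s x)"
    and c: "(c has_real_derivative c') (at t within S)" and t: "t \<in> S"
  shows "((\<lambda>s. f s (c s)) has_real_derivative D + fx t (c t) * c') (at t within S)"
proof -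
  have "((\<lambda>(x, y). f x y) has_derivative
      (\<lambda>(tx, ty). D * tx + blinfun_apply (blinfun_mult_right (fx t (c t))) ty)) (at (t, c t) within S \<times> UNIV)"
  proof (rule has_derivative_partialsI)
    show "((\<lambda>x. f x (c t)) has_derivative (*) D) (at t within S)"
      using ft by (simp add: has_field_derivative_def)
    show "((\<lambda>y. f x y) has_derivative blinfun_apply (blinfun_mult_right (fx x y))) (at y within UNIV)" if "x \<in> S" for x y
      using fx[OF that, of y] by (simp add: has_field_derivative_def)
    have "continuous_on (S \<times> UNIV) (\<lambda>(x, y). blinfun_mult_right (fx x y))"
      using fxc by (auto simp: split_beta intro!: continuous_intros)
    then show "continuous (at (t, c t) within S \<times> UNIV) (\<lambda>(x, y). blinfun_mult_right (fx x y))"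
      using t by (simp add: continuous_on_eq_continuous_within)
  qed auto
  then have "((\<lambda>(x, y). f x y) has_derivative (\<lambda>(tx, ty). D * tx + fx t (c t) * ty))
      (at (t, c t) within (\<lambda>s. (s, c s)) ` S)"
    unfolding blinfun_mult_right.rep_eq by (rule has_derivative_subset) auto
  moreover have "((\<lambda>s. (s, c s)) has_derivative (\<lambda>h. (h, c' * h))) (at t within S)"
    using c by (auto intro!: derivative_eq_intros simp: has_field_derivative_def)
  ultimately have "((\<lambda>s. (\<lambda>(x, y). f x y) (s, c s)) has_derivative
      (\<lambda>h. (\<lambda>(tx, ty). D * tx + fx t (c t) * ty) (h, c' * h))) (at t within S)"
    by (rule has_derivative_in_compose[rotated])
  moreover have "(\<lambda>h. (\<lambda>(tx, ty). D * tx + fx t (c t) * ty) (h, c' * h)) = (*) (D + fx t (c t) * c')"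
    by (rule ext) (simp add: algebra_simps)
  ultimately show ?thesis by (simp add: has_field_derivative_def)
qed

lemma integral_scale_unit:
  assumes "t \<ge> 0" "continuous_on {0..t} f"
  shows "integral {0..t} f = t * integral {0..1} (\<lambda>r. f (r * t) :: real)"
proof -
  have "prim f t = integral {0..t} f - integral {0..0} f"
    by (rule prim_eq)
       (use integral_has_real_derivative[OF assms(2)] assms(1) in \<open>auto simp: min_def max_def\<close>)
  then show ?thesis by (simp add: prim_def)
qed

context lagrangian_flow begin

lemma in_time: "0 \<le> t \<Longrightarrow> t < \<tau> \<Longrightarrow> t \<in> {0..\<tau>}" by simp

definition "\<eta> t x = x + integral {0..t} (\<lambda>s. U s x)"

lemma U_cont_t: "t \<in> {0..\<tau>} \<Longrightarrow> continuous_on {0..t} (\<lambda>s. U s x)"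
  by (rule continuous_on_subset[OF joint_slice2[OF U_cont]]) auto

lemma eta_0 [simp]: "\<eta> 0 x = x" by (simp add: \<eta>_def)

lemma eta_t: assumes "t \<in> {0..\<tau>}"
  shows "((\<lambda>s. \<eta> s x) has_real_derivative U t x) (at t within {0..\<tau>})"
  unfolding \<eta>_def
  using integral_has_real_derivative[OF U_cont_t[of \<tau> x] assms] \<tau>_pos
  by (auto intro!: derivative_eq_intros)

lemma eta_x: assumes t: "t \<in> {0..\<tau>}"
  shows "(\<eta> t has_real_derivative \<phi> t x ^ p) (at x)"
proof -
  have "((\<lambda>x. integral {0..t} (\<lambda>s. U s x)) has_real_derivative integral {0..t} (\<lambda>s. g s x)) (at x within UNIV)"
  proof (rule integral_has_derivative_param[where f="\<lambda>x s. U s x" and f'="\<lambda>x s. g s x"])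
    show "((\<lambda>x. U s x) has_real_derivative g s x) (at x within UNIV)" if "s \<in> {0..t}" for s x
      using U_x[of s x] that t by auto
    show "continuous_on (UNIV \<times> {0..t}) (\<lambda>(x, s). g s x)"
      unfolding split_beta by (intro g_comp continuous_intros) (use t in auto)
  qed (use U_cont_t[OF t] in auto)
  moreover have "((\<lambda>s. g s x) has_integral \<phi> t x ^ p - \<phi> 0 x ^ p) {0..t}"
  proof (rule fundamental_theorem_of_calculus)
    show "((\<lambda>s. \<phi> s x ^ p) has_vector_derivative g s x) (at s within {0..t})" if "s \<in> {0..t}" for s
      unfolding has_real_derivative_iff_has_vector_derivative[symmetric]
      by (rule has_field_derivative_subset[OF phi_pow_t]) (use that t in auto)
  qed (use t in auto)
  then have "integral {0..t} (\<lambda>s. g s x) = \<phi> t x ^ p - 1"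
    by (simp add: integral_unique phi_0)
  ultimately show ?thesis
    unfolding \<eta>_def[abs_def] by (auto intro!: derivative_eq_intros)
qed

lemma eta_cont: "continuous_on ({0..\<tau>} \<times> UNIV) (\<lambda>(t,x). \<eta> t x)"
proof -
  have "continuous_on (({0..\<tau>} \<times> UNIV) \<times> {0..1}) (\<lambda>(z,r). U (r * fst z) (snd z))"
    unfolding split_beta
    by (rule joint_compose[OF U_cont])
       (auto intro!: continuous_intros simp: mult_le_one intro: order_trans[OF mult_left_le_one_le])
  then have "continuous_on ({0..\<tau>} \<times> UNIV) (\<lambda>z. integral {0..1} (\<lambda>r. U (r * fst z) (snd z)))"
    using integral_continuous_on_param[of "{0..\<tau>} \<times> UNIV" 0 1 "\<lambda>z r. U (r * fst z) (snd z)"]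
    by (simp add: cbox_interval)
  then have "continuous_on ({0..\<tau>} \<times> UNIV) (\<lambda>z. snd z + fst z * integral {0..1} (\<lambda>r. U (r * fst z) (snd z)))"
    by (intro continuous_intros)
  then show ?thesis
    by (rule continuous_on_cong[THEN iffD1, OF refl, rotated])
       (auto simp: \<eta>_def integral_scale_unit[OF _ U_cont_t])
qed

lemma eta_shift: assumes "t \<in> {0..\<tau>}" shows "\<eta> t (x + 1) = \<eta> t x + 1"
proof -
  have "integral {0..t} (\<lambda>s. U s (x + 1)) = integral {0..t} (\<lambda>s. U s x)"
    by (rule integral_cong) (use U_periodic assms in \<open>auto simp: periodic1_def\<close>)
  then show ?thesis by (simp add: \<eta>_def)
qed

context
  fixes t assumes t: "0 \<le> t" "t < \<tau>"
begin

lemma t': "t \<in> {0..\<tau>}" using t by simp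

lemma eta_strict_mono: "x < y \<Longrightarrow> \<eta> t x < \<eta> t y"
  by (rule DERIV_pos_imp_increasing) (use eta_x[OF t'] pos[OF t] in \<open>auto intro!: exI zero_less_power\<close>)

lemma eta_inj: "inj (\<eta> t)"
  by (rule injI) (metis eta_strict_mono less_irrefl linorder_neqE_linordered_idom)

lemma eta_slice: "continuous_on S (\<eta> t)"
  by (meson DERIV_isCont continuous_at_imp_continuous_on eta_x t')

lemma eta_surj: "surj (\<eta> t)"
proof -
  have c: "continuous_on ({0..0} \<times> UNIV) (\<lambda>(s::real,x). \<eta> t x - x)"
    unfolding split_beta
    by (intro continuous_intros continuous_on_compose2[OF eta_slice[of UNIV]]) auto
  have "periodic1 (\<lambda>x. \<eta> t x - x)" by (simp add: periodic1_def eta_shift[OF t'])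
  with periodic_bounded_joint[OF c] obtain C where C: "\<And>x. \<bar>\<eta> t x - x\<bar> \<le> C"
    by (metis atLeastAtMost_iff order_refl)
  have "\<exists>x. \<eta> t x = \<theta>" for \<theta>
  proof -
    have C0: "C \<ge> 0" using C[of 0] by linarith
    have "\<exists>x\<ge>\<theta> - C. x \<le> \<theta> + C \<and> \<eta> t x = \<theta>"
      by (rule IVT') (use C[of "\<theta> - C"] C[of "\<theta> + C"] C0 eta_slice in auto)
    then show ?thesis by blast
  qed
  then show ?thesis by (metis surj_def)
qed

end

definition "X t = inv (\<eta> t)"

lemma eta_X: "0 \<le> t \<Longrightarrow> t < \<tau> \<Longrightarrow> \<eta> t (X t \<theta>) = \<theta>"
  unfolding X_def by (rule surj_f_inv_f[OF eta_surj])

lemma X_eta: "0 \<le> t \<Longrightarrow> t < \<tau> \<Longrightarrow> X t (\<eta> t x) = x"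
  unfolding X_def by (rule inv_f_f[OF eta_inj])

lemma X_less: "0 \<le> t \<Longrightarrow> t < \<tau> \<Longrightarrow> \<eta> t a < \<theta> \<Longrightarrow> a < X t \<theta>"
  using eta_strict_mono[of t "X t \<theta>" a] eta_X[of t \<theta>] by (cases "X t \<theta> = a") (auto simp: not_less_iff_gr_or_eq intro: ccontr)

lemma X_greater: "0 \<le> t \<Longrightarrow> t < \<tau> \<Longrightarrow> \<eta> t a > \<theta> \<Longrightarrow> a > X t \<theta>"
  using eta_strict_mono[of t a "X t \<theta>"] eta_X[of t \<theta>] by (cases "X t \<theta> = a") (auto simp: not_less_iff_gr_or_eq intro: ccontr)

text \<open>
  Since \<open>\<eta> t\<close> is increasing, \<open>a < X t \<theta>\<close> is equivalent to \<open>\<eta> t a < \<theta>\<close>, an open condition on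
  \<open>(t, \<theta>)\<close>.
\<close>

lemma X_cont: "continuous_on ({0..<\<tau>} \<times> UNIV) (\<lambda>(t,\<theta>). X t \<theta>)"
  unfolding continuous_on_def
proof (intro ballI)
  fix q :: "real \<times> real" assume q: "q \<in> {0..<\<tau>} \<times> UNIV"
  obtain t \<theta> where tq: "q = (t, \<theta>)" by (cases q)
  with q have t: "0 \<le> t" "t < \<tau>" by auto
  let ?F = "at q within {0..<\<tau>} \<times> (UNIV::real set)"
  have ev: "\<forall>\<^sub>F z in ?F. 0 \<le> fst z \<and> fst z < \<tau>"
    unfolding eventually_at_filter by (rule always_eventually) auto
  have lim: "((\<lambda>z. \<eta> (fst z) a - snd z) \<longlongrightarrow> \<eta> t a - \<theta>) ?F" for a
  proof -
    have "continuous_on ({0..<\<tau>} \<times> UNIV) (\<lambda>z. \<eta> (fst z) a - snd z)"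
      by (intro continuous_intros joint_compose[OF eta_cont]) auto
    then show ?thesis using q by (auto simp: continuous_on_def tq)
  qed
  show "((\<lambda>(t, \<theta>). X t \<theta>) \<longlongrightarrow> (case q of (t, \<theta>) \<Rightarrow> X t \<theta>)) ?F"
    unfolding tq split_beta fst_conv snd_conv
  proof (rule order_tendstoI)
    fix a assume "a < X t \<theta>"
    then have "\<eta> t a - \<theta> < 0" using eta_strict_mono[OF t] eta_X[OF t, of \<theta>] by fastforce
    from order_tendstoD(2)[OF lim this] ev
    show "\<forall>\<^sub>F z in at (t, \<theta>) within {0..<\<tau>} \<times> UNIV. a < X (fst z) (snd z)"
      unfolding tq by eventually_elim (auto intro: X_less)
  next
    fix a assume "a > X t \<theta>"
    then have "\<eta> t a - \<theta> > 0" using eta_strict_mono[OF t] eta_X[OF t, of \<theta>] by fastforce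
    from order_tendstoD(1)[OF lim this] ev
    show "\<forall>\<^sub>F z in at (t, \<theta>) within {0..<\<tau>} \<times> UNIV. a > X (fst z) (snd z)"
      unfolding tq by eventually_elim (auto intro: X_greater)
  qed
qed

lemma X_shift: "0 \<le> t \<Longrightarrow> t < \<tau> \<Longrightarrow> X t (\<theta> + 1) = X t \<theta> + 1"
  by (metis X_eta eta_X eta_shift in_time)

lemma X_theta:
  assumes t: "0 \<le> t" "t < \<tau>"
  shows "(X t has_real_derivative 1 / \<phi> t (X t \<theta>) ^ p) (at \<theta>)"
proof -
  have "(X t has_real_derivative inverse (\<phi> t (X t \<theta>) ^ p)) (at \<theta>)"
  proof (rule DERIV_inverse_function[where f="\<eta> t" and a="\<theta> - 1" and b="\<theta> + 1"])
    show "(\<eta> t has_real_derivative \<phi> t (X t \<theta>) ^ p) (at (X t \<theta>))" using eta_x t by simp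
    show "\<phi> t (X t \<theta>) ^ p \<noteq> 0" using pos[OF t, of "X t \<theta>"] by simp
    show "isCont (X t) \<theta>"
      using joint_slice[OF X_cont, of t] t by (auto simp: continuous_on_eq_continuous_at)
  qed (use eta_X[OF t] in auto)
  then show ?thesis by (simp add: inverse_eq_divide)
qed

text \<open>
  The mean value theorem in the label turns the increment of \<open>X\<close> at fixed \<open>\<theta>\<close> into an increment of
  \<open>\<eta>\<close> in time, divided by the Jacobian at an intermediate label.
\<close>

lemma X_t:
  assumes t: "0 \<le> t" "t < \<tau>"
  shows "((\<lambda>s. X s \<theta>) has_real_derivative - U t (X t \<theta>) / \<phi> t (X t \<theta>) ^ p) (at t within {0..<\<tau>})"
proof -
  define x where "x = X t \<theta>"
  let ?F = "at t within {0..<\<tau>}"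
  have "\<exists>\<xi>. \<bar>\<xi> - x\<bar> \<le> \<bar>X s \<theta> - x\<bar> \<and> \<eta> s (X s \<theta>) - \<eta> s x = \<phi> s \<xi> ^ p * (X s \<theta> - x)"
    if s: "0 \<le> s" "s < \<tau>" for s
  proof (cases "X s \<theta>" x rule: linorder_cases)
    case less
    from MVT2[OF less, of "\<eta> s" "\<lambda>y. \<phi> s y ^ p"] eta_x[of s] s
    obtain z where "X s \<theta> < z" "z < x" "\<eta> s x - \<eta> s (X s \<theta>) = (x - X s \<theta>) * \<phi> s z ^ p" by auto
    then show ?thesis by (intro exI[of _ z]) (auto simp: algebra_simps)
  next
    case greater
    from MVT2[OF greater, of "\<eta> s" "\<lambda>y. \<phi> s y ^ p"] eta_x[of s] s
    obtain z where "x < z" "z < X s \<theta>" "\<eta> s (X s \<theta>) - \<eta> s x = (X s \<theta> - x) * \<phi> s z ^ p" by auto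
    then show ?thesis by (intro exI[of _ z]) (auto simp: algebra_simps)
  qed (auto intro: exI[of _ x])
  then obtain \<xi> where \<xi>: "\<And>s. 0 \<le> s \<Longrightarrow> s < \<tau> \<Longrightarrow> \<bar>\<xi> s - x\<bar> \<le> \<bar>X s \<theta> - x\<bar>"
    "\<And>s. 0 \<le> s \<Longrightarrow> s < \<tau> \<Longrightarrow> \<eta> s (X s \<theta>) - \<eta> s x = \<phi> s (\<xi> s) ^ p * (X s \<theta> - x)" by metis
  have ev: "\<forall>\<^sub>F s in ?F. 0 \<le> s \<and> s < \<tau> \<and> s \<noteq> t" by (auto simp: eventually_at_filter)
  have "((\<lambda>s. X s \<theta> - x) \<longlongrightarrow> x - x) ?F"
    using joint_slice2[OF X_cont, of \<theta>] t unfolding continuous_on_def x_def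
    by (intro tendsto_diff tendsto_const) auto
  then have X0: "((\<lambda>s. \<bar>X s \<theta> - x\<bar>) \<longlongrightarrow> 0) ?F" by (simp add: tendsto_rabs_zero)
  have "((\<lambda>s. \<xi> s - x) \<longlongrightarrow> 0) ?F"
    by (rule Lim_null_comparison[OF _ X0]) (use ev \<xi>(1) in \<open>auto elim: eventually_mono\<close>)
  then have \<xi>_lim: "(\<xi> \<longlongrightarrow> x) ?F" by (simp add: LIM_zero_iff)
  have "filterlim (\<lambda>s. (s, \<xi> s)) (at (t, x) within {0..\<tau>} \<times> UNIV) ?F"
    unfolding filterlim_at
    by (intro conjI tendsto_Pair \<xi>_lim tendsto_ident_at) (use ev in \<open>auto elim!: eventually_mono\<close>)
  moreover have "((\<lambda>(s,y). \<phi> s y) \<longlongrightarrow> \<phi> t x) (at (t, x) within {0..\<tau>} \<times> UNIV)"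
    using phi_cont t unfolding continuous_on_def by force
  ultimately have phi_lim: "((\<lambda>s. \<phi> s (\<xi> s)) \<longlongrightarrow> \<phi> t x) ?F"
    using filterlim_compose by fastforce
  have "((\<lambda>s. \<eta> s x) has_real_derivative U t x) ?F"
    by (rule has_field_derivative_subset[OF eta_t]) (use t in auto)
  then have eta_lim: "((\<lambda>s. (\<eta> s x - \<eta> t x) / (s - t)) \<longlongrightarrow> U t x) ?F"
    by (simp add: has_field_derivative_iff)
  have "((\<lambda>s. - ((\<eta> s x - \<eta> t x) / (s - t)) / \<phi> s (\<xi> s) ^ p) \<longlongrightarrow> - U t x / \<phi> t x ^ p) ?F"
    using pos[OF t, of x] by (intro tendsto_intros eta_lim phi_lim) simp
  moreover have "\<forall>\<^sub>F s in ?F. - ((\<eta> s x - \<eta> t x) / (s - t)) / \<phi> s (\<xi> s) ^ p = (X s \<theta> - X t \<theta>) / (s - t)"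
    using ev
  proof eventually_elim
    case (elim s)
    have "\<phi> s (\<xi> s) ^ p \<noteq> 0" using pos[of s "\<xi> s"] elim by simp
    moreover have "\<eta> s x - \<eta> t x = - (\<phi> s (\<xi> s) ^ p * (X s \<theta> - x))"
      using \<xi>(2)[of s] elim eta_X[of s \<theta>] eta_X[OF t, of \<theta>] by (simp add: x_def)
    ultimately show ?case by (simp only:) (simp add: x_def)
  qed
  ultimately show ?thesis
    unfolding has_field_derivative_iff x_def by (rule Lim_transform_eventually)
qed

definition "u t \<theta> = U t (X t \<theta>)"
definition "m0 = momentum u0"

lemma m0_cont: "continuous_on S m0"
  unfolding m0_def momentum_def by (intro continuous_intros C2_circleD[OF u0])

lemma u_eta: "0 \<le> t \<Longrightarrow> t < \<tau> \<Longrightarrow> u t (\<eta> t x) = U t x" by (simp add: u_def X_eta)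

lemma u_theta:
  assumes t: "0 \<le> t" "t < \<tau>"
  shows "(u t has_real_derivative W t (X t \<theta>)) (at \<theta>)"
proof -
  have "(u t has_real_derivative g t (X t \<theta>) * (1 / \<phi> t (X t \<theta>) ^ p)) (at \<theta>)"
    unfolding u_def[abs_def] by (rule DERIV_chain2[OF U_x X_theta]) (use t in auto)
  moreover have "g t (X t \<theta>) * (1 / \<phi> t (X t \<theta>) ^ p) = W t (X t \<theta>)"
    unfolding W_jac[OF t, symmetric] using pos[OF t, of "X t \<theta>"] by simp
  ultimately show ?thesis by (simp only:)
qed

lemma deriv_u: "0 \<le> t \<Longrightarrow> t < \<tau> \<Longrightarrow> deriv (u t) = (\<lambda>\<theta>. W t (X t \<theta>))"
  by (rule ext) (rule DERIV_imp_deriv[OF u_theta])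

definition "Wx t x = \<sigma> * \<phi> t x ^ p - m0 x / (\<phi> t x)\<^sup>2"

lemma W_x': "0 \<le> t \<Longrightarrow> t < \<tau> \<Longrightarrow> (W t has_real_derivative Wx t x) (at x)"
  unfolding Wx_def m0_def by (rule W_x)

lemma u_theta_theta:
  assumes t: "0 \<le> t" "t < \<tau>"
  shows "(deriv (u t) has_real_derivative Wx t (X t \<theta>) / \<phi> t (X t \<theta>) ^ p) (at \<theta>)"
  unfolding deriv_u[OF t] using DERIV_chain2[OF W_x'[OF t] X_theta[OF t, of \<theta>]] by simp

lemma deriv2_u: "0 \<le> t \<Longrightarrow> t < \<tau> \<Longrightarrow> deriv (deriv (u t)) = (\<lambda>\<theta>. Wx t (X t \<theta>) / \<phi> t (X t \<theta>) ^ p)"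
  by (rule ext) (rule DERIV_imp_deriv[OF u_theta_theta])

lemma Wx_cont: "continuous_on ({0..<\<tau>} \<times> UNIV) (\<lambda>(t,x). Wx t x)"
proof -
  have "\<phi> (fst z) (snd z) \<noteq> 0" if "z \<in> {0..<\<tau>} \<times> UNIV" for z
    using pos[of "fst z" "snd z"] that by auto
  then show ?thesis
    unfolding Wx_def split_beta
    by (intro continuous_intros phi_comp continuous_on_compose2[OF m0_cont[of UNIV]]) auto
qed

lemma X_comp: 
  assumes "continuous_on ({0..<\<tau>} \<times> UNIV) (\<lambda>(t,x). f t x)"
  shows "continuous_on ({0..<\<tau>} \<times> UNIV) (\<lambda>(t,\<theta>). f t (X t \<theta>))"
  unfolding split_beta
  by (rule joint_compose[OF assms]) (auto intro!: continuous_intros joint_compose[OF X_cont])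

lemma u_cont: "continuous_on ({0..<\<tau>} \<times> UNIV) (\<lambda>(t,\<theta>). u t \<theta>)"
  unfolding u_def by (rule X_comp[OF continuous_on_subset[OF U_cont]]) auto

lemma u_theta_cont: "continuous_on ({0..<\<tau>} \<times> UNIV) (\<lambda>(t,\<theta>). deriv (u t) \<theta>)"
  using X_comp[OF W_cont]
  by (rule continuous_on_cong[THEN iffD1, OF refl, rotated]) (auto simp: deriv_u)

lemma u_theta_theta_cont: "continuous_on ({0..<\<tau>} \<times> UNIV) (\<lambda>(t,\<theta>). deriv (deriv (u t)) \<theta>)"
proof -
  have ne: "\<phi> (fst z) (snd z) ^ p \<noteq> 0" if "z \<in> {0..<\<tau>} \<times> UNIV" for z
    using pos[of "fst z" "snd z"] that by auto
  have "continuous_on ({0..<\<tau>} \<times> UNIV) (\<lambda>(t,x). Wx t x / \<phi> t x ^ p)"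
    unfolding split_beta using ne by (intro continuous_intros phi_comp joint_compose[OF Wx_cont]) auto
  from X_comp[OF this] show ?thesis
    by (rule continuous_on_cong[THEN iffD1, OF refl, rotated]) (auto simp: deriv2_u)
qed

lemma u_C2: assumes t: "0 \<le> t" "t < \<tau>" shows "C2_circle (u t)"
  unfolding C2_circle_def
proof (intro conjI allI)
  show "u t (\<theta> + 1) = u t \<theta>" for \<theta>
    using X_shift[OF t] U_periodic[of t] t by (simp add: u_def periodic1_def)
  show "u t differentiable_on UNIV" "deriv (u t) differentiable_on UNIV"
    using u_theta[OF t] u_theta_theta[OF t]
    by (auto simp: differentiable_on_def real_differentiable_def)
  show "continuous_on UNIV (deriv (deriv (u t)))"
    using joint_slice[OF u_theta_theta_cont, of t] t by simp
qed

lemma integral_substitution: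
  assumes t: "0 \<le> t" "t < \<tau>" and h: "continuous_on UNIV h" "periodic1 h"
  shows "integral {0..1} h = integral {0..1} (\<lambda>x. h (\<eta> t x) * \<phi> t x ^ p)"
proof -
  have "((\<lambda>x. h (\<eta> t x) * \<phi> t x ^ p) has_integral prim h (\<eta> t 1) - prim h (\<eta> t 0)) {0..1}"
  proof (rule fundamental_theorem_of_calculus)
    show "((\<lambda>x. prim h (\<eta> t x)) has_vector_derivative h (\<eta> t x) * \<phi> t x ^ p) (at x within {0..1})" for x
      unfolding has_real_derivative_iff_has_vector_derivative[symmetric]
      by (rule DERIV_chain2[OF prim_has_derivative[OF h(1)]])
         (rule has_field_derivative_at_within[OF eta_x], use t in auto)
  qed simp
  moreover have "prim h (\<eta> t 1) - prim h (\<eta> t 0) = integral {0..1} h"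
    using prim_period[OF h, of "\<eta> t 0"] eta_shift[of t 0] t by simp
  ultimately show ?thesis by (simp add: integral_unique)
qed

lemma u_mean: assumes t: "0 \<le> t" "t < \<tau>" shows "mean (u t) = \<sigma>"
proof -
  have "integral {0..1} (u t) = integral {0..1} (\<lambda>x. U t x * \<phi> t x ^ p)"
    using integral_substitution[OF t C2_circleD(4,1)[OF u_C2[OF t]]] u_eta[OF t] by simp
  then show ?thesis using U_mean t by (simp add: mean_def)
qed

text \<open>
  For \<open>lam = 3\<close> both sides vanish. For \<open>lam = 2\<close> the substitution \<open>\<theta> = \<eta> t x\<close> turns \<open>u\<^sub>\<theta>\<^sup>2\<close> into
  \<open>W\<^sup>2 \<phi>\<^sup>2 = 4 \<psi>\<^sup>2\<close>.
\<close>

lemma u_dissipation: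
  assumes t: "0 \<le> t" "t < \<tau>"
  shows "((real p + 2) / p - 3) / 2 * integral {0..1} (\<lambda>\<theta>. (deriv (u t) \<theta>)\<^sup>2) = - p * (real p - 1) * energy t"
proof -
  have "integral {0..1} (\<lambda>\<theta>. (deriv (u t) \<theta>)\<^sup>2) = integral {0..1} (\<lambda>x. (W t x)\<^sup>2 * \<phi> t x ^ p)"
    using integral_substitution[OF t, of "\<lambda>\<theta>. (deriv (u t) \<theta>)\<^sup>2"] C2_circleD(5,7)[OF u_C2[OF t]]
    by (simp add: deriv_u[OF t] X_eta[OF t] continuous_on_power periodic1_def)
  moreover have "integral {0..1} (\<lambda>x. (W t x)\<^sup>2 * \<phi> t x ^ p) = 4 * energy t" if "p = 2"
  proof -
    have "(W t x)\<^sup>2 * \<phi> t x ^ p = 4 * (\<psi> t x)\<^sup>2" for x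
    proof -
      have "(W t x)\<^sup>2 * \<phi> t x ^ p = (p * \<psi> t x / \<phi> t x)\<^sup>2 * \<phi> t x ^ p" by (simp only: W_def)
      also have "\<dots> = 4 * (\<psi> t x)\<^sup>2" using pos[OF t, of x] that by (simp add: power_divide power_mult_distrib)
      finally show ?thesis .
    qed
    then show ?thesis by (simp add: energy_def)
  qed
  ultimately show ?thesis using p by auto
qed

text \<open>
  Differentiating \<open>W s (X s \<theta>)\<close> in time, the transport term is \<open>- u u\<^sub>\<theta>\<^sub>\<theta>\<close>; what remains is the
  Riccati equation for \<open>W\<close>.
\<close>

proposition u_is_solution: "is_solution ((real p + 2) / p) u0 (ereal \<tau>) u"
proof -
  have dom: "time_dom (ereal \<tau>) = {0..<\<tau>}" by (auto simp: time_dom_def)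
  have "u 0 \<theta> = u0 \<theta>" for \<theta>
    using X_eta[of 0 \<theta>] \<tau>_pos by (simp add: u_def U_0)
  moreover have "\<exists>D. ((\<lambda>s. deriv (u s) \<theta>) has_real_derivative D) (at t within {0..<\<tau>}) \<and>
        D + u t \<theta> * deriv (deriv (u t)) \<theta> + ((real p + 2) / p - 1) / 2 * (deriv (u t) \<theta>)\<^sup>2
          - (real p + 2) / p * \<sigma> * u t \<theta>
        = ((real p + 2) / p - 3) / 2 * integral {0..1} (\<lambda>x. (deriv (u t) x)\<^sup>2) - (real p + 2) / p * \<sigma>\<^sup>2"
    if t: "0 \<le> t" "t < \<tau>" for t \<theta>
  proof -
    define x where "x = X t \<theta>"
    define D where "D = (p * F t x - (W t x)\<^sup>2 / p) + Wx t x * (- U t x / \<phi> t x ^ p)"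
    have "((\<lambda>s. W s (X s \<theta>)) has_real_derivative D) (at t within {0..<\<tau>})"
      unfolding D_def x_def
    proof (rule has_derivative_along_curve[where f=W and fx=Wx and c="\<lambda>s. X s \<theta>"])
      show "((\<lambda>s. W s (X t \<theta>)) has_real_derivative p * F t (X t \<theta>) - (W t (X t \<theta>))\<^sup>2 / p) (at t within {0..<\<tau>})"
        by (rule has_field_derivative_subset[OF W_t[OF t]]) auto
    qed (use W_x' Wx_cont X_t[OF t] t in auto)
    then have "((\<lambda>s. deriv (u s) \<theta>) has_real_derivative D) (at t within {0..<\<tau>})"
      by (rule has_field_derivative_transform_within[where d=1]) (use t deriv_u in auto)
    moreover have "D + u t \<theta> * deriv (deriv (u t)) \<theta> = p * F t x - (W t x)\<^sup>2 / p"
      unfolding D_def deriv2_u[OF t] u_def x_def by simp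
    moreover have "p * F t x = (real p + 2) / p * \<sigma> * (u t \<theta> - \<sigma>) - p * (real p - 1) * energy t"
      using F_eq_U[of t x] t p_pos by (simp add: \<kappa>_def u_def x_def power2_eq_square field_simps)
    moreover have "deriv (u t) \<theta> = W t x" by (simp add: deriv_u[OF t] x_def)
    moreover have "((real p + 2) / p - 1) / 2 = 1 / p" using p_pos by (simp add: field_simps)
    ultimately have "D + u t \<theta> * deriv (deriv (u t)) \<theta> + ((real p + 2) / p - 1) / 2 * (deriv (u t) \<theta>)\<^sup>2
          - (real p + 2) / p * \<sigma> * u t \<theta>
        = - p * (real p - 1) * energy t - (real p + 2) / p * \<sigma>\<^sup>2"
      by (simp only:) (simp add: power2_eq_square right_diff_distrib left_diff_distrib mult.assoc)
    with \<open>((\<lambda>s. deriv (u s) \<theta>) has_real_derivative D) (at t within {0..<\<tau>})\<close> show ?thesis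
      unfolding u_dissipation[OF t] by blast
  qed
  ultimately show ?thesis
    unfolding is_solution_def dom
    using \<tau>_pos u_C2 u_cont u_theta_cont u_theta_theta_cont u_mean by (auto simp: fun_eq_iff)
qed

lemma eta_particle_path: "is_particle_path (ereal \<tau>) u x (\<lambda>t. \<eta> t x)"
  unfolding is_particle_path_def
proof (intro conjI ballI)
  fix t assume "t \<in> time_dom (ereal \<tau>)"
  then have t: "0 \<le> t" "t < \<tau>" by (auto simp: time_dom_def)
  show "((\<lambda>t. \<eta> t x) has_real_derivative u t (\<eta> t x)) (at t within time_dom (ereal \<tau>))"
    unfolding u_eta[OF t]
    by (rule has_field_derivative_subset[OF eta_t]) (use t in \<open>auto simp: time_dom_def\<close>)
qed simp

lemma deriv_u_eta: "0 \<le> t \<Longrightarrow> t < \<tau> \<Longrightarrow> deriv (u t) (\<eta> t x) = W t x"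
  by (simp add: deriv_u X_eta)

end

section \<open>Uniqueness of solutions\<close>

text \<open>
  All increments of \<open>w\<close> are bounded by \<open>\<integral>\<bar>z\<bar>\<close>, and \<open>w x\<close> is the average of its increments
  \<open>w x - w y\<close>.
\<close>

lemma zero_mean_bound:
  assumes w: "\<And>x. (w has_real_derivative z x) (at x)" and z: "continuous_on UNIV z"
    and w0: "integral {0..1} w = 0" and x: "x \<in> {0..1}"
  shows "\<bar>w x\<bar> \<le> integral {0..1} (\<lambda>x. \<bar>z x\<bar>)"
proof -
  define m where "m = integral {0..1} (\<lambda>x. \<bar>z x\<bar>)"
  have zi: "continuous_on S z" for S using z continuous_on_subset by blast
  have wc: "continuous_on S w" for S by (meson DERIV_isCont continuous_at_imp_continuous_on w)
  have le: "\<bar>w b - w a\<bar> \<le> m" if "0 \<le> a" "a \<le> b" "b \<le> 1" for a b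
  proof -
    have "(z has_integral w b - w a) {a..b}"
      by (rule fundamental_theorem_of_calculus[OF that(2)])
        (use w in \<open>auto simp: has_real_derivative_iff_has_vector_derivative[symmetric] intro: has_field_derivative_at_within\<close>)
    then have "w b - w a = integral {a..b} z" by (simp add: integral_unique)
    also have "\<bar>\<dots>\<bar> \<le> integral {a..b} (\<lambda>x. \<bar>z x\<bar>)"
      using integral_norm_bound_integral[of z "{a..b}" "\<lambda>x. \<bar>z x\<bar>"]
      by (auto intro!: integrable_continuous_interval continuous_intros zi)
    also have "\<dots> \<le> m" unfolding m_def
      by (rule integral_subset_le) (use that in \<open>auto intro!: integrable_continuous_interval continuous_intros zi\<close>)
    finally show ?thesis .
  qed
  have "norm (integral {0..1} (\<lambda>y. w x - w y)) \<le> m * (1 - 0)"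
  proof (rule integral_bound)
    show "norm (w x - w y) \<le> m" if "y \<in> {0..1}" for y
      using le[of x y] le[of y x] x that by (cases "x \<le> y") (auto simp: abs_minus_commute)
  qed (auto intro!: continuous_intros wc)
  moreover have "integral {0..1} (\<lambda>y. w x - w y) = w x"
    using w0 by (subst integral_diff) (auto intro!: integrable_continuous_interval wc)
  ultimately show ?thesis by (simp add: m_def)
qed

lemma integral_abs_squared_le:
  fixes z :: "real \<Rightarrow> real"
  assumes "continuous_on {0..1} z"
  shows "(integral {0..1} (\<lambda>x. \<bar>z x\<bar>))\<^sup>2 \<le> integral {0..1} (\<lambda>x. (z x)\<^sup>2)"
proof -
  define m where "m = integral {0..1} (\<lambda>x. \<bar>z x\<bar>)"
  have "0 \<le> integral {0..1} (\<lambda>x. (\<bar>z x\<bar> - m)\<^sup>2)"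
    by (intro integral_nonneg integrable_continuous_interval continuous_intros assms) auto
  also have "\<dots> = integral {0..1} (\<lambda>x. (z x)\<^sup>2 + (- 2 * m) * \<bar>z x\<bar> + m\<^sup>2)"
    by (intro integral_cong) (simp add: power2_eq_square algebra_simps)
  also have "\<dots> = integral {0..1} (\<lambda>x. (z x)\<^sup>2) + (- 2 * m) * m + m\<^sup>2"
    unfolding m_def
    by (subst integral_add, (intro integrable_continuous_interval continuous_intros assms)+)+
       (simp only: integral_mult_right, simp)
  finally show ?thesis by (simp add: m_def power2_eq_square)
qed

text \<open>
  Let \<open>w\<close> be the difference of two solutions and \<open>z = w\<^sub>\<theta>\<close>. Up to the derivative of a periodic
  function of \<open>\<theta>\<close>, the product \<open>2 z z\<^sub>t\<close> is a quadratic expression in \<open>z\<close> and \<open>w\<close> with bounded coefficients.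
  As \<open>w\<close> has mean zero, it is controlled by \<open>z\<close>, and Gronwall's inequality applies to \<open>\<integral>z\<^sup>2\<close>. The
  nonlocal term of the equation contributes only such a derivative, because it does not depend on \<open>\<theta>\<close>.
\<close>

lemma is_solution_unique:
  assumes u: "is_solution lam u0 T u" and v: "is_solution lam u0 S v"
    and t: "t \<in> time_dom T" "t \<in> time_dom S"
  shows "u t = v t"
proof -
  define I where "I = {0..t}"
  have t0: "t \<ge> 0" using t by (simp add: time_dom_def)
  have sub: "I \<subseteq> time_dom T" "I \<subseteq> time_dom S"
    using t by (auto simp: I_def time_dom_def) (meson ereal_less_eq(3) le_less_trans)+
  have C2: "C2_circle (u s)" "C2_circle (v s)" if "s \<in> I" for s
    using u v sub that unfolding is_solution_def by auto
  have cont: "continuous_on (I \<times> UNIV) (\<lambda>(t, x). u t x)"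
      "continuous_on (I \<times> UNIV) (\<lambda>(t, x). deriv (u t) x)"
      "continuous_on (I \<times> UNIV) (\<lambda>(t, x). deriv (deriv (u t)) x)"
      "continuous_on (I \<times> UNIV) (\<lambda>(t, x). v t x)"
      "continuous_on (I \<times> UNIV) (\<lambda>(t, x). deriv (v t) x)"
      "continuous_on (I \<times> UNIV) (\<lambda>(t, x). deriv (deriv (v t)) x)"
    using u v sub unfolding is_solution_def
    by - (rule continuous_on_subset[OF _ Sigma_mono], (elim conjE, assumption), assumption, rule subset_refl)+
  note comp = cont[THEN joint_compose]
  define w where "w s x = u s x - v s x" for s x
  define z where "z s x = deriv (u s) x - deriv (v s) x" for s x
  define z' where "z' s x = deriv (deriv (u s)) x - deriv (deriv (v s)) x" for s x
  define c where "c s = integral {0..1} (\<lambda>x. (deriv (u s) x)\<^sup>2) - integral {0..1} (\<lambda>x. (deriv (v s) x)\<^sup>2)" for s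
  define zt where "zt s x = - (u s x * deriv (deriv (u s)) x - v s x * deriv (deriv (v s)) x)
     - (lam - 1) / 2 * ((deriv (u s) x)\<^sup>2 - (deriv (v s) x)\<^sup>2) + lam * mean u0 * w s x + (lam - 3) / 2 * c s" for s x
  have w_x: "(w s has_real_derivative z s x) (at x)" and z_x: "(z s has_real_derivative z' s x) (at x)"
    if "s \<in> I" for s x
    unfolding w_def[abs_def] z_def[abs_def] z'_def
    using C2_circleD(2,3)[OF C2(1)[OF that], of x] C2_circleD(2,3)[OF C2(2)[OF that], of x]
    by (auto intro!: derivative_eq_intros)
  have z_cont: "continuous_on (I \<times> UNIV) (\<lambda>(s,x). z s x)"
    unfolding z_def split_beta by (intro continuous_intros comp) auto
  have c_cont: "continuous_on I c"
    unfolding c_def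
    by (intro continuous_intros joint_integral) (auto simp: split_beta intro!: continuous_intros comp)
  have zt_cont: "continuous_on (I \<times> {0..1}) (\<lambda>(s,x). zt s x)"
    unfolding zt_def w_def split_beta
    by (intro continuous_intros comp continuous_on_compose2[OF c_cont]) auto
  have zs: "continuous_on A (z s)" and ws: "continuous_on A (w s)" if "s \<in> I" for s A
    using w_x[OF that] z_x[OF that] by (meson DERIV_isCont continuous_at_imp_continuous_on)+
  have z_t: "((\<lambda>s. z s x) has_real_derivative zt s x) (at s within I)" if s: "s \<in> I" for s x
  proof -
    obtain D where D: "((\<lambda>s. deriv (u s) x) has_real_derivative D) (at s within time_dom T)"
       "D = - (u s x * deriv (deriv (u s)) x) - (lam - 1) / 2 * (deriv (u s) x)\<^sup>2
          + lam * mean u0 * u s x + (lam - 3) / 2 * integral {0..1} (\<lambda>x. (deriv (u s) x)\<^sup>2) - lam * (mean u0)\<^sup>2"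
    proof -
      have "s \<in> time_dom T" using sub(1) s by blast
      then obtain D where "((\<lambda>s. deriv (u s) x) has_real_derivative D) (at s within time_dom T)"
        "D + u s x * deriv (deriv (u s)) x + (lam - 1) / 2 * (deriv (u s) x)\<^sup>2 - lam * mean u0 * u s x
          = (lam - 3) / 2 * integral {0..1} (\<lambda>x. (deriv (u s) x)\<^sup>2) - lam * (mean u0)\<^sup>2"
        using u unfolding is_solution_def by blast
      then show ?thesis using that by fastforce
    qed
    obtain D' where D': "((\<lambda>s. deriv (v s) x) has_real_derivative D') (at s within time_dom S)"
       "D' = - (v s x * deriv (deriv (v s)) x) - (lam - 1) / 2 * (deriv (v s) x)\<^sup>2
          + lam * mean u0 * v s x + (lam - 3) / 2 * integral {0..1} (\<lambda>x. (deriv (v s) x)\<^sup>2) - lam * (mean u0)\<^sup>2"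
    proof -
      have "s \<in> time_dom S" using sub(2) s by blast
      then obtain D where "((\<lambda>s. deriv (v s) x) has_real_derivative D) (at s within time_dom S)"
        "D + v s x * deriv (deriv (v s)) x + (lam - 1) / 2 * (deriv (v s) x)\<^sup>2 - lam * mean u0 * v s x
          = (lam - 3) / 2 * integral {0..1} (\<lambda>x. (deriv (v s) x)\<^sup>2) - lam * (mean u0)\<^sup>2"
        using v unfolding is_solution_def by blast
      then show ?thesis using that by fastforce
    qed
    have "((\<lambda>s. z s x) has_real_derivative D - D') (at s within I)"
      unfolding z_def
      by (intro DERIV_diff has_field_derivative_subset[OF D(1)] has_field_derivative_subset[OF D'(1)] sub)
    moreover have "D - D' = zt s x"
      unfolding D(2) D'(2) zt_def c_def w_def by (simp add: algebra_simps)
    ultimately show ?thesis by simp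
  qed
  define y where "y s = integral {0..1} (\<lambda>x. (z s x)\<^sup>2)" for s
  have y_t: "(y has_real_derivative integral {0..1} (\<lambda>x. 2 * z s x * zt s x)) (at s within I)" if s: "s \<in> I" for s
    unfolding y_def[abs_def]
  proof (rule integral_has_derivative_param)
    show "((\<lambda>t. (z t x)\<^sup>2) has_real_derivative 2 * z t x * zt t x) (at t within I)" if "t \<in> I" for t x
      using z_t[OF that, of x] by (auto intro!: derivative_eq_intros)
    show "continuous_on (I \<times> {0..1}) (\<lambda>(t, x). 2 * z t x * zt t x)"
      unfolding split_beta
      by (intro continuous_intros joint_compose[OF zt_cont] joint_compose[OF z_cont]) auto
  qed (use s in \<open>auto intro!: continuous_intros zs simp: I_def\<close>)
  obtain K where K: "\<And>s x. s \<in> I \<Longrightarrow> \<bar>deriv (u s) x\<bar> \<le> K" "\<And>s x. s \<in> I \<Longrightarrow> \<bar>deriv (v s) x\<bar> \<le> K"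
     "\<And>s x. s \<in> I \<Longrightarrow> \<bar>deriv (deriv (v s)) x\<bar> \<le> K"
  proof -
    have bnd: "\<exists>a. \<forall>s\<in>I. \<forall>x. \<bar>f s x\<bar> \<le> a"
      if f: "continuous_on (I \<times> UNIV) (\<lambda>(t, x). f t x)" "\<And>s. s \<in> I \<Longrightarrow> periodic1 (f s)" for f :: "real \<Rightarrow> real \<Rightarrow> real"
    proof (rule periodic_bounded_joint[OF f[unfolded I_def]])
      fix C assume "\<And>s x. s \<in> {0..t} \<Longrightarrow> \<bar>f s x\<bar> \<le> C"
      then show ?thesis unfolding I_def by blast
    qed
    obtain a where a: "\<forall>s\<in>I. \<forall>x. \<bar>deriv (u s) x\<bar> \<le> a"
      using bnd[OF cont(2) C2_circleD(7)[OF C2(1)]] by blast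
    obtain b where b: "\<forall>s\<in>I. \<forall>x. \<bar>deriv (v s) x\<bar> \<le> b"
      using bnd[OF cont(5) C2_circleD(7)[OF C2(2)]] by blast
    obtain d where d: "\<forall>s\<in>I. \<forall>x. \<bar>deriv (deriv (v s)) x\<bar> \<le> d"
      using bnd[OF cont(6) C2_circleD(8)[OF C2(2)]] by blast
    show ?thesis by (rule that[of "max a (max b d)"]) (use a b d in \<open>auto simp: le_max_iff_disj\<close>)
  qed
  have K0: "K \<ge> 0" using K(1)[of 0 0] t0 by (auto simp: I_def)
  define L where "L = K + 2 * \<bar>lam - 1\<bar> * K + 2 * K"
  have w_bound: "\<bar>w s x\<bar> \<le> integral {0..1} (\<lambda>x. \<bar>z s x\<bar>)" if s: "s \<in> I" and x: "x \<in> {0..1}" for s x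
  proof (rule zero_mean_bound[OF w_x[OF s] zs[OF s] _ x])
    have "mean (u s) = mean u0" "mean (v s) = mean u0"
      using u v sub s unfolding is_solution_def by auto
    then show "integral {0..1} (w s) = 0"
      unfolding w_def mean_def
      by (subst integral_diff) (auto intro!: integrable_continuous_interval C2_circleD(4)[OF C2(1)[OF s]] C2_circleD(4)[OF C2(2)[OF s]])
  qed
  have ineq: "integral {0..1} (\<lambda>x. 2 * z s x * zt s x) \<le> L * y s" if s: "s \<in> I" for s
  proof -
    define R where "R x = deriv (u s) x * (z s x)\<^sup>2 - 2 * z s x * w s x * deriv (deriv (v s)) x
       - (lam - 1) * (deriv (u s) x + deriv (v s) x) * (z s x)\<^sup>2" for x
    \<comment> \<open>\<open>G\<close> is periodic, and its derivative collects the parts of \<open>2 z z\<^sub>t\<close> that cannot be estimated by \<open>z\<close> and \<open>w\<close>\<close>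
    define G where "G x = - u s x * (z s x)\<^sup>2 + lam * mean u0 * (w s x)\<^sup>2 + (lam - 3) * c s * w s x" for x
    define m where "m = integral {0..1} (\<lambda>x. \<bar>z s x\<bar>)"
    have Rc: "continuous_on {0..1} R" 
      unfolding R_def
      by (intro continuous_intros zs ws s C2_circleD(5,6)[OF C2(1)[OF s]] C2_circleD(5,6)[OF C2(2)[OF s]])
    have ztc: "continuous_on {0..1} (\<lambda>x. 2 * z s x * zt s x)"
      by (intro continuous_intros zs s joint_slice[OF zt_cont])
    have "((\<lambda>x. 2 * z s x * zt s x - R x) has_integral G 1 - G 0) {0..1}"
    proof (rule fundamental_theorem_of_calculus)
      fix x
      have "(G has_real_derivative 2 * z s x * zt s x - R x) (at x)"
        unfolding G_def[abs_def] R_def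
        using w_x[OF s, of x] z_x[OF s, of x] C2_circleD(2)[OF C2(1)[OF s], of x]
        by (auto intro!: derivative_eq_intros simp: zt_def)
           (simp add: z_def z'_def w_def power2_eq_square field_simps)
      then show "(G has_vector_derivative 2 * z s x * zt s x - R x) (at x within {0..1})"
        by (simp add: has_real_derivative_iff_has_vector_derivative[symmetric] has_field_derivative_at_within)
    qed simp
    moreover have "G 1 = G 0"
      using C2_circleD(1,7)[OF C2(1)[OF s]] C2_circleD(1,7)[OF C2(2)[OF s]]
      unfolding periodic1_def G_def w_def z_def by (metis add_0)
    ultimately have "integral {0..1} (\<lambda>x. 2 * z s x * zt s x - R x) = 0" by (simp add: integral_unique)
    then have "integral {0..1} (\<lambda>x. 2 * z s x * zt s x) = integral {0..1} R"
      using integral_diff[OF integrable_continuous_interval[OF ztc] integrable_continuous_interval[OF Rc]] by simp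
    also have "\<dots> \<le> integral {0..1} (\<lambda>x. (K + 2 * \<bar>lam - 1\<bar> * K) * (z s x)\<^sup>2 + (2 * K * m) * \<bar>z s x\<bar>)"
    proof (intro integral_le integrable_continuous_interval continuous_intros Rc zs s)
      fix x :: real assume x: "x \<in> {0..1}"
      have "deriv (u s) x * (z s x)\<^sup>2 \<le> K * (z s x)\<^sup>2"
        using K(1)[OF s, of x] by (intro mult_right_mono) auto
      moreover have "- (2 * z s x * w s x * deriv (deriv (v s)) x) \<le> (2 * K * m) * \<bar>z s x\<bar>"
      proof -
        have "- (2 * z s x * w s x * deriv (deriv (v s)) x) \<le> 2 * \<bar>z s x\<bar> * (\<bar>w s x\<bar> * \<bar>deriv (deriv (v s)) x\<bar>)"
          using abs_ge_minus_self[of "2 * z s x * w s x * deriv (deriv (v s)) x"] by (simp add: abs_mult mult.assoc)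
        also have "\<dots> \<le> 2 * \<bar>z s x\<bar> * (m * K)"
          using w_bound[OF s x] K(3)[OF s, of x] by (intro mult_left_mono mult_mono) (auto simp: m_def)
        finally show ?thesis by (simp add: algebra_simps)
      qed
      moreover have "- ((lam - 1) * (deriv (u s) x + deriv (v s) x) * (z s x)\<^sup>2) \<le> 2 * \<bar>lam - 1\<bar> * K * (z s x)\<^sup>2"
      proof -
        have "- ((lam - 1) * (deriv (u s) x + deriv (v s) x)) \<le> \<bar>lam - 1\<bar> * \<bar>deriv (u s) x + deriv (v s) x\<bar>"
          by (simp add: abs_mult[symmetric])
        also have "\<dots> \<le> \<bar>lam - 1\<bar> * (2 * K)"
          using K(1,2)[OF s, of x] by (intro mult_left_mono) auto
        finally show ?thesis using mult_right_mono[of _ _ "(z s x)\<^sup>2"] by fastforce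
      qed
      ultimately show "R x \<le> (K + 2 * \<bar>lam - 1\<bar> * K) * (z s x)\<^sup>2 + (2 * K * m) * \<bar>z s x\<bar>"
        unfolding R_def distrib_right[of K] by linarith
    qed
    also have "\<dots> = (K + 2 * \<bar>lam - 1\<bar> * K) * y s + 2 * K * m\<^sup>2"
      unfolding y_def m_def
      by (subst integral_add, (intro integrable_continuous_interval continuous_intros zs s)+)
         (simp only: integral_mult_right, simp add: power2_eq_square)
    also have "\<dots> \<le> L * y s"
      using mult_left_mono[OF integral_abs_squared_le[OF zs[OF s]], of "2 * K"] K0
      by (simp add: L_def m_def y_def algebra_simps)
    finally show ?thesis .
  qed
  have y_nn: "y s \<ge> 0" if "s \<in> I" for s
    unfolding y_def by (intro integral_nonneg integrable_continuous_interval continuous_intros zs that) auto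
  have "y t * exp (- L * t) \<le> y 0 * exp (- L * 0)"
  proof (rule DERIV_nonpos_within[where f="\<lambda>s. y s * exp (- L * s)"
        and f'="\<lambda>s. (integral {0..1} (\<lambda>x. 2 * z s x * zt s x) - L * y s) * exp (- L * s)"])
    show "((\<lambda>s. y s * exp (- L * s)) has_real_derivative
        (integral {0..1} (\<lambda>x. 2 * z s x * zt s x) - L * y s) * exp (- L * s)) (at s within {0..t})"
      if "s \<in> {0..t}" for s
      using y_t[of s] that unfolding I_def by (auto intro!: derivative_eq_intros simp: algebra_simps)
    show "(integral {0..1} (\<lambda>x. 2 * z s x * zt s x) - L * y s) * exp (- L * s) \<le> 0" if "0 < s" "s < t" for s
      using ineq[of s] that by (intro mult_nonpos_nonneg) (auto simp: I_def)
  qed (rule t0)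
  moreover have "z 0 x = 0" for x using u v by (simp add: z_def is_solution_def)
  then have "y 0 = 0" by (simp add: y_def)
  ultimately have "y t \<le> 0" by (simp add: mult_le_0_iff)
  have tI: "t \<in> I" using t0 by (simp add: I_def)
  have "(integral {0..1} (\<lambda>x. \<bar>z t x\<bar>))\<^sup>2 \<le> 0"
    by (rule order_trans[OF integral_abs_squared_le[OF zs[OF tI]]]) (use \<open>y t \<le> 0\<close> in \<open>simp only: y_def\<close>)
  from order_antisym[OF this zero_le_power2] have m0: "integral {0..1} (\<lambda>x. \<bar>z t x\<bar>) = 0" by simp
  show "u t = v t"
  proof
    fix x
    have "w t (frac x) = 0" using w_bound[OF tI, of "frac x"] m0 frac_in_unit[of x] by simp
    then show "u t x = v t x"
      using periodic1_frac[OF C2_circleD(1)[OF C2(1)[OF tI]], of x] periodic1_frac[OF C2_circleD(1)[OF C2(2)[OF tI]], of x]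
      by (simp add: w_def)
  qed
qed

section \<open>The Jacobian can only vanish at a sign change\<close>

text \<open>
  Take \<open>b\<close> maximal such that \<open>f\<close> vanishes from \<open>x0\<close> to \<open>b\<close>. If \<open>f\<close> were nonnegative just after \<open>b\<close>,
  the hypothesis \<open>step\<close> would extend the interval of zeros.
\<close>

lemma right_end_of_zero_interval:
  fixes f :: "real \<Rightarrow> real"
  assumes f: "continuous_on UNIV f"
    and step: "\<And>x1. x0 < x1 \<Longrightarrow> x1 \<le> x0 + 1 \<Longrightarrow> (\<forall>x\<in>{x0..x1}. 0 \<le> f x) \<Longrightarrow> (\<forall>x\<in>{x0..x1}. f x = 0)"
    and not_zero: "\<not> (\<forall>x\<in>{x0..x0+1}. f x = 0)" and zero: "f x0 = 0"
  obtains b where "x0 \<le> b" "\<forall>x\<in>{x0..b}. f x = 0" "\<exists>\<^sub>F x in at_right b. f x < 0"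
proof -
  define B where "B = {b \<in> {x0..x0+1}. \<forall>x\<in>{x0..b}. f x = 0}"
  define b where "b = Sup B"
  have B0: "x0 \<in> B" using zero by (auto simp: B_def)
  have bb: "bdd_above B" by (auto simp: B_def)
  have xb: "x0 \<le> b" unfolding b_def by (rule cSup_upper[OF B0 bb])
  have b1: "b \<le> x0 + 1" unfolding b_def by (rule cSup_least) (use B0 in blast, simp add: B_def)
  have lt: "f x = 0" if "x0 \<le> x" "x < b" for x
  proof -
    have "B \<noteq> {}" using B0 by blast
    from less_cSup_iff[OF this bb, of x] have "\<exists>c\<in>B. x < c" using that(2) unfolding b_def by blast
    then show ?thesis using that(1) by (auto simp: B_def)
  qed
  have fb: "f b = 0"
  proof (cases "b = x0")
    case False
    have "closed {x. f x = 0}" by (rule closed_Collect_eq) (auto intro: f)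
    moreover have "{x0..<b} \<subseteq> {x. f x = 0}" using lt by auto
    ultimately have "closure {x0..<b} \<subseteq> {x. f x = 0}" by (rule closure_minimal[rotated])
    then show ?thesis using False xb by auto
  qed (simp add: zero)
  have bz: "\<forall>x\<in>{x0..b}. f x = 0" using lt fb by (metis atLeastAtMost_iff order_less_le)
  then have "b < x0 + 1" using not_zero b1 by (metis order_less_le)
  show ?thesis
  proof (rule that[OF xb bz], rule ccontr)
    assume "\<not> (\<exists>\<^sub>F x in at_right b. f x < 0)"
    then have "\<forall>\<^sub>F x in at_right b. 0 \<le> f x" by (simp add: not_frequently not_less)
    then obtain e where e: "e > b" "\<And>x. b < x \<Longrightarrow> x < e \<Longrightarrow> 0 \<le> f x"
      unfolding eventually_at_right_field by blast
    define x1 where "x1 = min (x0 + 1) ((b + e) / 2)"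
    have x1: "b < x1" "x1 \<le> x0 + 1" "x1 < e" using e(1) \<open>b < x0 + 1\<close> by (auto simp: x1_def min_def)
    have "\<forall>x\<in>{x0..x1}. 0 \<le> f x"
    proof
      fix x assume "x \<in> {x0..x1}"
      then show "0 \<le> f x" using bz e(2)[of x] x1 by (cases "x \<le> b") auto
    qed
    from step[OF _ x1(2) this] have "x1 \<in> B" using x1 xb by (auto simp: B_def)
    then have "x1 \<le> b" unfolding b_def by (rule cSup_upper[OF _ bb])
    then show False using x1 by simp
  qed
qed

lemma not_positive_at_start:
  fixes f :: "real \<Rightarrow> real"
  assumes f: "continuous_on UNIV f"
    and step: "\<And>x1. x0 < x1 \<Longrightarrow> x1 \<le> x0 + 1 \<Longrightarrow> (\<forall>x\<in>{x0..x1}. 0 \<le> f x) \<Longrightarrow> (\<forall>x\<in>{x0..x1}. f x = 0)"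
  shows "f x0 \<le> 0"
proof (rule ccontr)
  assume "\<not> ?thesis"
  then have "f x0 > 0" by simp
  moreover have "(f \<longlongrightarrow> f x0) (at_right x0)"
    using f by (simp add: continuous_on_eq_continuous_at isCont_def filterlim_at_split)
  ultimately have "\<forall>\<^sub>F x in at_right x0. 0 < f x" by (rule order_tendstoD(1)[rotated])
  then obtain e where e: "e > x0" "\<And>x. x0 < x \<Longrightarrow> x < e \<Longrightarrow> 0 < f x"
    unfolding eventually_at_right_field by blast
  define x1 where "x1 = min (x0 + 1) ((x0 + e) / 2)"
  have x1: "x0 < x1" "x1 \<le> x0 + 1" "x1 < e" using e(1) by (auto simp: x1_def min_def)
  have "\<forall>x\<in>{x0..x1}. 0 \<le> f x"
    using e(2) \<open>f x0 > 0\<close> x1 by (metis atLeastAtMost_iff le_less_trans less_imp_le order_less_le)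
  from step[OF x1(1,2) this] have "f x0 = 0" using x1 by simp
  then show False using \<open>f x0 > 0\<close> by simp
qed

text \<open>
  The left half of the claim is the right half for the reflected function \<open>- f (- x)\<close>.
\<close>

lemma changes_pos_to_neg_atI:
  fixes f :: "real \<Rightarrow> real"
  assumes f: "continuous_on UNIV f"
    and right: "\<And>x1. x0 < x1 \<Longrightarrow> x1 \<le> x0 + 1 \<Longrightarrow> (\<forall>x\<in>{x0..x1}. 0 \<le> f x) \<Longrightarrow> (\<forall>x\<in>{x0..x1}. f x = 0)"
    and left: "\<And>x1. x1 < x0 \<Longrightarrow> x0 - 1 \<le> x1 \<Longrightarrow> (\<forall>x\<in>{x1..x0}. f x \<le> 0) \<Longrightarrow> (\<forall>x\<in>{x1..x0}. f x = 0)"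
    and not_zero: "\<not> (\<forall>x\<in>{x0..x0+1}. f x = 0)" "\<not> (\<forall>x\<in>{x0-1..x0}. f x = 0)"
  shows "changes_pos_to_neg_at f x0"
proof -
  define h where "h x = - f (- x)" for x
  have h: "continuous_on UNIV h"
    unfolding h_def by (intro continuous_intros continuous_on_compose2[OF f]) auto
  have reflect: "(\<forall>x\<in>{- b.. - a}. P (f (- x))) \<longleftrightarrow> (\<forall>x\<in>{a..b}. P (f x))" for P and a b :: real
    by (metis atLeastAtMost_iff minus_minus neg_le_iff_le)
  have hstep: "\<forall>x\<in>{- x0..x1}. h x = 0"
    if "- x0 < x1" "x1 \<le> - x0 + 1" "\<forall>x\<in>{- x0..x1}. 0 \<le> h x" for x1
    using left[of "- x1"] that reflect[of x0 "- x1" "\<lambda>y. y \<le> 0"] reflect[of x0 "- x1" "\<lambda>y. y = 0"]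
    by (simp add: h_def)
  have "f x0 \<le> 0" by (rule not_positive_at_start[OF f right])
  moreover have "h (- x0) \<le> 0" by (rule not_positive_at_start[OF h hstep])
  ultimately have zero: "f x0 = 0" by (simp add: h_def)
  obtain b where b: "x0 \<le> b" "\<forall>x\<in>{x0..b}. f x = 0" "\<exists>\<^sub>F x in at_right b. f x < 0"
    by (rule right_end_of_zero_interval[OF f right not_zero(1) zero])
  have nz: "\<not> (\<forall>x\<in>{- x0..- x0 + 1}. h x = 0)"
    using not_zero(2) reflect[of x0 "x0 - 1" "\<lambda>y. y = 0"] by (simp add: h_def)
  have hz: "h (- x0) = 0" by (simp add: h_def zero)
  obtain a where a: "- x0 \<le> a" "\<forall>x\<in>{- x0..a}. h x = 0" "\<exists>\<^sub>F x in at_right a. h x < 0"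
    by (rule right_end_of_zero_interval[OF h hstep nz hz])
  have "\<exists>\<^sub>F x in at_left (- a). f x > 0"
    using a(3) by (simp add: at_left_minus frequently_filtermap h_def frequently_def eventually_filtermap)
  moreover have "\<forall>x\<in>{- a..x0}. f x = 0"
    using a(2) reflect[of x0 "- a" "\<lambda>y. y = 0"] by (simp add: h_def)
  then have "\<forall>x\<in>{- a..b}. f x = 0" using b(2) by (metis atLeastAtMost_iff linear)
  ultimately show ?thesis
    unfolding changes_pos_to_neg_at_def using a(1) b(1,3) by (intro exI[of _ "- a"] exI[of _ b]) auto
qed

context lagrangian_flow begin

lemma at_left_eq: "at_left \<tau> = at \<tau> within {0..\<tau>}"
  using \<tau>_pos by (simp add: at_within_Icc_at_left)

lemma eventually_before: "\<forall>\<^sub>F t in at_left \<tau>. 0 \<le> t \<and> t < \<tau>"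
  using \<tau>_pos by (auto simp: eventually_at_left_field intro: exI[of _ 0])

lemma phi_lim: "((\<lambda>t. \<phi> t x) \<longlongrightarrow> \<phi> \<tau> x) (at_left \<tau>)"
  and psi_lim: "((\<lambda>t. \<psi> t x) \<longlongrightarrow> \<psi> \<tau> x) (at_left \<tau>)"
  using joint_slice2[OF phi_cont, of x] joint_slice2[OF psi_cont, of x] \<tau>_pos
  by (auto simp: continuous_on_def at_left_eq)

lemma phi_nonneg_end: "\<phi> \<tau> x \<ge> 0"
  by (rule tendsto_lowerbound[OF phi_lim])
     (use eventually_before pos in \<open>auto elim!: eventually_mono intro: less_imp_le\<close>)

text \<open>
  Both \<open>\<phi>\<close> and \<open>\<psi>\<close> cannot vanish, since then \<open>\<phi>\<close> would be identically zero by backward uniqueness;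
  and a positive \<open>\<psi>\<close> would make \<open>\<phi>\<close> negative before \<open>\<tau>\<close>.
\<close>

lemma psi_neg_at_zero:
  assumes z: "\<phi> \<tau> x = 0" shows "\<psi> \<tau> x < 0"
proof (rule ccontr)
  assume "\<not> ?thesis"
  moreover have "\<psi> \<tau> x \<noteq> 0"
  proof
    assume "\<psi> \<tau> x = 0"
    with linear_ode_zero[of \<tau> "\<lambda>t. \<phi> t x" "\<lambda>t. \<psi> t x" "\<lambda>t. F t x" \<tau> 0] z phi_t psi_t F_cont_t \<tau>_pos
    have "\<phi> 0 x = 0" by auto
    then show False by (simp add: phi_0)
  qed
  ultimately have "\<psi> \<tau> x > 0" by simp
  from has_real_derivative_pos_inc_left[OF phi_t this] \<tau>_pos
  obtain d where d: "d > 0" "\<And>h. 0 < h \<Longrightarrow> \<tau> - h \<in> {0..\<tau>} \<Longrightarrow> h < d \<Longrightarrow> \<phi> (\<tau> - h) x < \<phi> \<tau> x" by auto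
  define h where "h = min (d/2) \<tau>"
  have "0 < h" "h < d" "\<tau> - h \<in> {0..\<tau>}" using d(1) \<tau>_pos by (auto simp: h_def min_def)
  then have "\<phi> (\<tau> - h) x < 0" using d(2) z by auto
  then show False using pos[of "\<tau> - h" x] \<open>0 < h\<close> \<open>\<tau> - h \<in> {0..\<tau>}\<close> by auto
qed

lemma W_at_bot:
  assumes z: "\<phi> \<tau> x = 0" shows "filterlim (\<lambda>t. W t x) at_bot (at_left \<tau>)"
proof -
  have "filterlim (\<lambda>t. inverse (\<phi> t x)) at_top (at_left \<tau>)"
    using phi_lim[of x] z eventually_before pos by (intro filterlim_inverse_at_top) (auto elim!: eventually_mono)
  moreover have "((\<lambda>t. p * \<psi> t x) \<longlongrightarrow> p * \<psi> \<tau> x) (at_left \<tau>)" by (intro tendsto_intros psi_lim)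
  moreover have "p * \<psi> \<tau> x < 0" using psi_neg_at_zero[OF z] p_pos by (simp add: mult_pos_neg)
  ultimately show ?thesis
    unfolding W_def divide_inverse by (intro filterlim_tendsto_neg_mult_at_bot)
qed

text \<open>
  The hypothesis forces \<open>W \<rightarrow> -\<infinity>\<close> also at \<open>y\<close>, whereas \<open>W\<close> has a finite limit wherever \<open>\<phi>\<close> does not
  vanish.
\<close>

lemma vanishing_propagates:
  assumes z: "\<phi> \<tau> x = 0" and le: "\<And>t. 0 \<le> t \<Longrightarrow> t < \<tau> \<Longrightarrow> W t y \<le> W t x + C"
  shows "\<phi> \<tau> y = 0"
proof (rule ccontr)
  assume ne: "\<phi> \<tau> y \<noteq> 0"
  have "filterlim (\<lambda>t. C + W t x) at_bot (at_left \<tau>)"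
    using W_at_bot[OF z] by (simp add: filterlim_tendsto_add_at_bot_iff[OF tendsto_const])
  then have "filterlim (\<lambda>t. W t y) at_bot (at_left \<tau>)"
    unfolding filterlim_at_bot
  proof (intro allI, elim allE)
    fix Z assume "\<forall>\<^sub>F t in at_left \<tau>. C + W t x \<le> Z"
    with eventually_before show "\<forall>\<^sub>F t in at_left \<tau>. W t y \<le> Z"
      by eventually_elim (use le in \<open>fastforce simp: add.commute intro: order_trans\<close>)
  qed
  then have "filterlim (\<lambda>t. W t y) at_infinity (at_left \<tau>)" by (rule filterlim_at_bot_imp_at_infinity)
  moreover have "((\<lambda>t. W t y) \<longlongrightarrow> p * \<psi> \<tau> y / \<phi> \<tau> y) (at_left \<tau>)"
    unfolding W_def by (intro tendsto_intros phi_lim psi_lim ne)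
  ultimately show False
    using not_tendsto_and_filterlim_at_infinity[of "at_left \<tau>"] by (simp add: trivial_limit_at_left_real)
qed

text \<open>
  The other part of \<open>W\<^sub>x\<close>, \<open>\<sigma> \<phi>\<^sup>p\<close>, has an integral of size at most \<open>\<bar>\<sigma>\<bar>\<close> over at most one period.
\<close>

lemma W_increment:
  assumes t: "0 \<le> t" "t < \<tau>" and ab: "a \<le> b" "b \<le> a + 1"
  shows "\<bar>W t b - W t a + integral {a..b} (\<lambda>x. m0 x / (\<phi> t x)\<^sup>2)\<bar> \<le> \<bar>\<sigma>\<bar>"
proof -
  have t': "t \<in> {0..\<tau>}" using t by simp
  have c: "continuous_on S (\<lambda>x. \<phi> t x ^ p)" for S by (intro continuous_intros slices t')
  have cm: "continuous_on S (\<lambda>x. m0 x / (\<phi> t x)\<^sup>2)" for S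
    using pos[OF t] by (intro continuous_intros slices t' m0_cont) (simp add: less_imp_neq[symmetric])
  have "(Wx t has_integral W t b - W t a) {a..b}"
    by (rule fundamental_theorem_of_calculus[OF ab(1)])
      (use W_x'[OF t] in \<open>auto simp: has_real_derivative_iff_has_vector_derivative[symmetric] intro: has_field_derivative_at_within\<close>)
  then have "W t b - W t a = integral {a..b} (\<lambda>x. \<sigma> * \<phi> t x ^ p - m0 x / (\<phi> t x)\<^sup>2)"
    by (simp add: Wx_def[abs_def] integral_unique)
  also have "\<dots> = \<sigma> * integral {a..b} (\<lambda>x. \<phi> t x ^ p) - integral {a..b} (\<lambda>x. m0 x / (\<phi> t x)\<^sup>2)"
    by (subst integral_diff) (auto intro!: integrable_continuous_interval continuous_intros c cm)
  finally have *: "W t b - W t a + integral {a..b} (\<lambda>x. m0 x / (\<phi> t x)\<^sup>2) = \<sigma> * integral {a..b} (\<lambda>x. \<phi> t x ^ p)"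
    by simp
  have "integral {a..b} (\<lambda>x. \<phi> t x ^ p) \<le> integral {a..a+1} (\<lambda>x. \<phi> t x ^ p)"
    by (rule integral_subset_le) (use ab pos[OF t] in \<open>auto intro!: integrable_continuous_interval c less_imp_le\<close>)
  also have "\<dots> = 1" using integral_period[OF c phi_pow_periodic[OF t']] normalisation(1)[OF t'] by simp
  finally have "integral {a..b} (\<lambda>x. \<phi> t x ^ p) \<le> 1" .
  moreover have "0 \<le> integral {a..b} (\<lambda>x. \<phi> t x ^ p)"
    by (intro integral_nonneg integrable_continuous_interval c) (use pos[OF t] in \<open>auto intro: less_imp_le\<close>)
  ultimately show ?thesis
    unfolding * abs_mult by (metis abs_of_nonneg abs_ge_zero mult.right_neutral mult_left_mono)
qed

lemma W_bounded_above: obtains M where "M > 0" "\<And>t x. 0 \<le> t \<Longrightarrow> t < \<tau> \<Longrightarrow> W t x \<le> M"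
proof -
  obtain B where B: "\<And>x. \<bar>v x\<bar> \<le> B" using C2_circle_deriv_bounded[OF u0] by blast
  show ?thesis
  proof (rule that[of "B + 6 * \<bar>\<sigma>\<bar> + 1"])
    show "0 < B + 6 * \<bar>\<sigma>\<bar> + 1" using B[of 0] by linarith
    show "W t x \<le> B + 6 * \<bar>\<sigma>\<bar> + 1" if "0 \<le> t" "t < \<tau>" for t x
      using W_upper_bound[OF B that] by (rule less_imp_le)
  qed
qed

text \<open>
  As \<open>\<phi>\<close> has a simple zero at \<open>\<tau>\<close>, \<open>W = p \<psi> / \<phi>\<close> is of order \<open>1 / (\<tau> - t)\<close>, and
  \<open>(\<tau> - t)\<^sup>2 W\<close> tends to zero.
\<close>

lemma no_quadratic_blowup:
  assumes z: "\<phi> \<tau> x = 0" and d: "d > 0"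
    and le: "\<And>t. 0 \<le> t \<Longrightarrow> t < \<tau> \<Longrightarrow> W t x \<le> C - d / (\<tau> - t)\<^sup>2"
  shows False
proof -
  have nb: "at_left \<tau> \<noteq> bot" by simp
  have id: "((\<lambda>t. t) \<longlongrightarrow> \<tau>) (at_left \<tau>)" by (rule tendsto_ident_at)
  have "((\<lambda>t. (\<phi> t x - \<phi> \<tau> x) / (t - \<tau>)) \<longlongrightarrow> \<psi> \<tau> x) (at_left \<tau>)"
    using phi_t[of \<tau> x] \<tau>_pos by (simp add: has_field_derivative_iff at_left_eq)
  then have q: "((\<lambda>t. \<phi> t x / (t - \<tau>)) \<longlongrightarrow> \<psi> \<tau> x) (at_left \<tau>)" by (simp add: z)
  have "((\<lambda>t. - (\<tau> - t) * (p * \<psi> t x) / (\<phi> t x / (t - \<tau>))) \<longlongrightarrow> - (\<tau> - \<tau>) * (p * \<psi> \<tau> x) / \<psi> \<tau> x) (at_left \<tau>)"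
    using psi_neg_at_zero[OF z] by (intro tendsto_intros psi_lim q id) simp
  moreover have "\<forall>\<^sub>F t in at_left \<tau>. - (\<tau> - t) * (p * \<psi> t x) / (\<phi> t x / (t - \<tau>)) = (\<tau> - t)\<^sup>2 * W t x"
    using eventually_before
  proof eventually_elim
    case (elim t)
    then show ?case using pos[of t x] by (simp add: W_def field_simps power2_eq_square)
  qed
  ultimately have "((\<lambda>t. (\<tau> - t)\<^sup>2 * W t x) \<longlongrightarrow> - (\<tau> - \<tau>) * (p * \<psi> \<tau> x) / \<psi> \<tau> x) (at_left \<tau>)"
    by (rule Lim_transform_eventually)
  then have l1: "((\<lambda>t. (\<tau> - t)\<^sup>2 * W t x) \<longlongrightarrow> 0) (at_left \<tau>)" by simp
  have l2: "((\<lambda>t. C * (\<tau> - t)\<^sup>2 - d) \<longlongrightarrow> C * (\<tau> - \<tau>)\<^sup>2 - d) (at_left \<tau>)"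
    by (intro tendsto_intros id)
  have "\<forall>\<^sub>F t in at_left \<tau>. (\<tau> - t)\<^sup>2 * W t x \<le> C * (\<tau> - t)\<^sup>2 - d"
    using eventually_before
  proof eventually_elim
    case (elim t)
    then have "(\<tau> - t)\<^sup>2 * W t x \<le> (\<tau> - t)\<^sup>2 * (C - d / (\<tau> - t)\<^sup>2)"
      by (intro mult_left_mono le) auto
    also have "\<dots> = C * (\<tau> - t)\<^sup>2 - d" using elim by (simp add: right_diff_distrib)
    finally show ?case .
  qed
  from tendsto_le[OF nb l2 l1 this] d show False by simp
qed

text \<open>
  On such an interval \<open>\<phi> \<le> C (\<tau> - t)\<close>, so \<open>m0 / \<phi>\<^sup>2\<close> would have an integral of order
  \<open>1 / (\<tau> - t)\<^sup>2\<close> if \<open>m0\<close> were not zero throughout, and \<open>W\<close> would tend to \<open>-\<infinity>\<close> at this rate at one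
  of the end points: at \<open>b\<close> if \<open>s = 1\<close> and at \<open>a\<close> if \<open>s = -1\<close>.
\<close>

lemma m0_zero_on_vanishing_interval:
  assumes ab: "a < b" "b \<le> a + 1" and z: "\<And>x. x \<in> {a..b} \<Longrightarrow> \<phi> \<tau> x = 0"
    and s: "s = 1 \<or> s = -1" and sm: "\<And>x. x \<in> {a..b} \<Longrightarrow> 0 \<le> s * m0 x"
    and y: "y \<in> {a..b}"
  shows "m0 y = 0"
proof (rule ccontr)
  assume ne: "m0 y \<noteq> 0"
  define J where "J = integral {a..b} (\<lambda>x. s * m0 x)"
  have "J > 0"
  proof (rule ccontr)
    assume "\<not> J > 0"
    then have "s * m0 y = 0"
      by (intro integral_nonneg_eq_0_imp[of a b "\<lambda>x. s * m0 x" y])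
        (use sm y ab in \<open>auto simp: J_def intro!: continuous_intros m0_cont\<close>)
    then show False using s ne by auto
  qed
  obtain C where C: "\<And>t x. t \<in> {0..\<tau>} \<Longrightarrow> \<bar>\<psi> t x\<bar> \<le> C" "C > 0"
    using periodic_bounded_joint[OF psi_cont phi_psi_periodic(2)] by metis
  note C = C(2,1)
  have phi_le: "\<phi> t x \<le> C * (\<tau> - t)" if t: "0 \<le> t" "t < \<tau>" and x: "x \<in> {a..b}" for t x
  proof -
    have "- \<phi> \<tau> x - C * \<tau> \<le> - \<phi> t x - C * t"
    proof (rule DERIV_nonpos_within[where f="\<lambda>s. - \<phi> s x - C * s" and f'="\<lambda>s. - \<psi> s x - C"])
      show "((\<lambda>s. - \<phi> s x - C * s) has_real_derivative - \<psi> s x - C) (at s within {t..\<tau>})" if "s \<in> {t..\<tau>}" for s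
      proof -
        have "((\<lambda>s. \<phi> s x) has_real_derivative \<psi> s x) (at s within {t..\<tau>})"
          by (rule has_field_derivative_subset[OF phi_t]) (use that t in auto)
        then show ?thesis by (auto intro!: derivative_eq_intros)
      qed
      show "- \<psi> s x - C \<le> 0" if "t < s" "s < \<tau>" for s
        using C(2)[of s x] that t by (auto simp: abs_le_iff)
    qed (use t in auto)
    then show ?thesis by (simp add: z[OF x] algebra_simps)
  qed
  have lower: "J / C\<^sup>2 / (\<tau> - t)\<^sup>2 \<le> s * integral {a..b} (\<lambda>x. m0 x / (\<phi> t x)\<^sup>2)" if t: "0 \<le> t" "t < \<tau>" for t
  proof -
    have ne: "(\<phi> t x)\<^sup>2 \<noteq> 0" for x using pos[OF t, of x] by simp
    have "J / C\<^sup>2 / (\<tau> - t)\<^sup>2 = integral {a..b} (\<lambda>x. s * m0 x / (C * (\<tau> - t))\<^sup>2)"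
      by (simp add: J_def power_mult_distrib)
    also have "\<dots> \<le> integral {a..b} (\<lambda>x. s * m0 x / (\<phi> t x)\<^sup>2)"
    proof (intro integral_le integrable_continuous_interval continuous_intros slices m0_cont ballI ne)
      fix x assume x: "x \<in> {a..b}"
      show "s * m0 x / (C * (\<tau> - t))\<^sup>2 \<le> s * m0 x / (\<phi> t x)\<^sup>2"
        using phi_le[OF t x] pos[OF t, of x] sm[OF x] C(1) t
        by (intro divide_left_mono power_mono) auto
    qed (use t C(1) in auto)
    also have "\<dots> = s * integral {a..b} (\<lambda>x. m0 x / (\<phi> t x)\<^sup>2)"
      using integral_mult_right[of "{a..b}" s "\<lambda>x. m0 x / (\<phi> t x)\<^sup>2"] by simp
    finally show ?thesis .
  qed
  obtain M where M: "\<And>t x. 0 \<le> t \<Longrightarrow> t < \<tau> \<Longrightarrow> W t x \<le> M" using W_bounded_above by metis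
  have d: "J / C\<^sup>2 > 0" using \<open>J > 0\<close> C(1) by simp
  from s show False
  proof
    assume s: "s = 1"
    have "W t b \<le> (M + \<bar>\<sigma>\<bar>) - J / C\<^sup>2 / (\<tau> - t)\<^sup>2" if t: "0 \<le> t" "t < \<tau>" for t
      using W_increment[OF t less_imp_le[OF ab(1)] ab(2)] lower[OF t] M[OF t, of a] unfolding s abs_le_iff by linarith
    from no_quadratic_blowup[OF z d this] show False using ab by simp
  next
    assume s: "s = -1"
    have "W t a \<le> (M + \<bar>\<sigma>\<bar>) - J / C\<^sup>2 / (\<tau> - t)\<^sup>2" if t: "0 \<le> t" "t < \<tau>" for t
      using W_increment[OF t less_imp_le[OF ab(1)] ab(2)] lower[OF t] M[OF t, of b] unfolding s abs_le_iff by linarith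
    from no_quadratic_blowup[OF z d this] show False using ab by simp
  qed
qed

lemma vanishing_to_the_right:
  assumes z: "\<phi> \<tau> x0 = 0" and x1: "x0 < x1" "x1 \<le> x0 + 1" and m: "\<forall>x\<in>{x0..x1}. 0 \<le> m0 x"
  shows "\<forall>x\<in>{x0..x1}. \<phi> \<tau> x = 0 \<and> m0 x = 0"
proof -
  have zz: "\<phi> \<tau> x = 0" if x: "x \<in> {x0..x1}" for x
  proof (rule vanishing_propagates[OF z])
    fix t assume t: "0 \<le> t" "t < \<tau>"
    have "0 \<le> integral {x0..x} (\<lambda>x. m0 x / (\<phi> t x)\<^sup>2)"
      using m x by (intro integral_nonneg integrable_continuous_interval continuous_intros slices m0_cont)
        (use t pos[OF t] in \<open>auto simp: less_imp_neq[symmetric]\<close>)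
    then show "W t x \<le> W t x0 + \<bar>\<sigma>\<bar>" using W_increment[OF t, of x0 x] x x1 by (auto simp: abs_le_iff)
  qed
  then show ?thesis
    using m0_zero_on_vanishing_interval[OF x1, of 1] m by auto
qed

lemma vanishing_to_the_left:
  assumes z: "\<phi> \<tau> x0 = 0" and x1: "x1 < x0" "x0 - 1 \<le> x1" and m: "\<forall>x\<in>{x1..x0}. m0 x \<le> 0"
  shows "\<forall>x\<in>{x1..x0}. \<phi> \<tau> x = 0 \<and> m0 x = 0"
proof -
  have zz: "\<phi> \<tau> x = 0" if x: "x \<in> {x1..x0}" for x
  proof (rule vanishing_propagates[OF z])
    fix t assume t: "0 \<le> t" "t < \<tau>"
    have "0 \<le> integral {x..x0} (\<lambda>x. - (m0 x / (\<phi> t x)\<^sup>2))"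
      using m x by (intro integral_nonneg integrable_continuous_interval continuous_intros slices m0_cont)
        (use t pos[OF t] in \<open>auto simp: less_imp_neq[symmetric] divide_nonpos_nonneg\<close>)
    then show "W t x \<le> W t x0 + \<bar>\<sigma>\<bar>" using W_increment[OF t, of x x0] x x1 by (auto simp: abs_le_iff)
  qed
  then show ?thesis
    using m0_zero_on_vanishing_interval[OF x1(1), of "-1"] m x1 by auto
qed

text \<open>
  The Jacobian \<open>\<phi>\<^sup>p\<close> still has integral one at time \<open>\<tau>\<close>.
\<close>

lemma not_all_vanish: "\<not> (\<forall>x\<in>{a..a+1}. \<phi> \<tau> x = 0)"
proof
  assume *: "\<forall>x\<in>{a..a+1}. \<phi> \<tau> x = 0"
  have t': "\<tau> \<in> {0..\<tau>}" using \<tau>_pos by simp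
  have "integral {a..a+1} (\<lambda>x. \<phi> \<tau> x ^ p) = integral {a..a+1} (\<lambda>x. 0)"
    by (rule integral_cong) (use * p_pos in auto)
  moreover have "integral {a..a+1} (\<lambda>x. \<phi> \<tau> x ^ p) = 1"
    using integral_period[OF _ phi_pow_periodic[OF t'], of a] normalisation(1)[OF t']
    by (auto intro!: continuous_intros slices t')
  ultimately show False by simp
qed

proposition vanishing_label_is_sign_change:
  assumes z: "\<phi> \<tau> x0 = 0" shows "changes_pos_to_neg_at m0 x0"
proof (rule changes_pos_to_neg_atI[OF m0_cont])
  show "\<not> (\<forall>x\<in>{x0..x0+1}. m0 x = 0)"
  proof
    assume "\<forall>x\<in>{x0..x0+1}. m0 x = 0"
    then have "\<forall>x\<in>{x0..x0+1}. 0 \<le> m0 x" by simp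
    from vanishing_to_the_right[OF z _ _ this] have "\<forall>x\<in>{x0..x0+1}. \<phi> \<tau> x = 0" by simp
    then show False using not_all_vanish[of x0] by blast
  qed
  show "\<not> (\<forall>x\<in>{x0-1..x0}. m0 x = 0)"
  proof
    assume "\<forall>x\<in>{x0-1..x0}. m0 x = 0"
    then have "\<forall>x\<in>{x0-1..x0}. m0 x \<le> 0" by simp
    from vanishing_to_the_left[OF z _ _ this] have "\<forall>x\<in>{x0-1..x0}. \<phi> \<tau> x = 0" by simp
    then show False using not_all_vanish[of "x0-1"] by simp
  qed
  show "\<forall>x\<in>{x0..x1}. m0 x = 0" if "x0 < x1" "x1 \<le> x0 + 1" "\<forall>x\<in>{x0..x1}. 0 \<le> m0 x" for x1
    using vanishing_to_the_right[OF z that] by simp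
  show "\<forall>x\<in>{x1..x0}. m0 x = 0" if "x1 < x0" "x0 - 1 \<le> x1" "\<forall>x\<in>{x1..x0}. m0 x \<le> 0" for x1
    using vanishing_to_the_left[OF z that] by simp
qed

end

section \<open>Bounds on the lifespan\<close>

context lagrangian_flow begin

text \<open>
  If \<open>W\<close> is very negative at time \<open>t\<close>, then \<open>\<phi>\<close> would vanish within one unit of time. Indeed
  \<open>F \<le> k\<^sup>2\<close>, so \<open>\<phi>\<close> grows no faster than the solution of \<open>f'' = k\<^sup>2 f\<close> with the same data at \<open>t\<close>; the
  comparison is carried out by dividing \<open>\<phi>\<close> by \<open>cosh (k (r - t))\<close>.
\<close>

lemma W_lower_bound:
  assumes M: "\<And>t x. 0 \<le> t \<Longrightarrow> t < \<tau> \<Longrightarrow> W t x \<le> M"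
    and t: "0 \<le> t" "t + 1 \<le> \<tau>"
  shows "W t x \<ge> - 2 * (cosh (3 * \<bar>\<sigma>\<bar> * M + 1))\<^sup>2"
proof (cases "\<psi> t x \<ge> 0")
  case True
  then have "W t x \<ge> 0" using pos[of t x] t by (simp add: W_def)
  then show ?thesis by (rule order_trans[rotated]) simp
next
  case False
  \<comment> \<open>adding one ensures \<open>k \<le> k\<^sup>2\<close>\<close>
  define k where "k = 3 * \<bar>\<sigma>\<bar> * M + 1"
  have U: "\<bar>U r y - \<sigma>\<bar> \<le> M" if "0 \<le> r" "r < \<tau>" for r y
    using U_minus_mean_bound[OF that M[OF that]] .
  have "M \<ge> 0" using U[of 0 0] \<tau>_pos by linarith
  then have k: "k \<ge> 1" by (simp add: k_def)
  have F_k: "F r x \<le> k\<^sup>2" if "0 \<le> r" "r < \<tau>" for r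
  proof -
    have "F r x \<le> k" using F_le[OF _ U[OF that]] that by (simp add: k_def add_increasing2)
    also have "k \<le> k\<^sup>2" using k by (simp add: power2_eq_square)
    finally show ?thesis .
  qed
  define c where "c r = cosh (k * (r - t))" for r
  \<comment> \<open>the numerator of the derivative of \<open>\<phi> / c\<close>\<close>
  define Y where "Y r = \<psi> r x * c r - k * \<phi> r x * sinh (k * (r - t))" for r
  have c_pos: "c r > 0" for r by (simp add: c_def cosh_real_pos)
  have sub: "at r within {t..s} \<le> at r within {0..\<tau>}" if "s \<le> \<tau>" for r s
    by (rule at_le) (use that t in auto)
  have Y_le: "Y r \<le> \<psi> t x" if r: "t \<le> r" "r \<le> t + 1" for r
  proof -
    have "Y r \<le> Y t"
    proof (rule DERIV_nonpos_within[where f=Y and f'="\<lambda>r. (F r x - k\<^sup>2) * \<phi> r x * c r"])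
      fix s assume s: "s \<in> {t..r}"
      have s': "s \<in> {0..\<tau>}" using s r t by auto
      have d1: "((\<lambda>s. \<phi> s x) has_real_derivative \<psi> s x) (at s within {t..r})"
        by (rule has_field_derivative_subset[OF phi_t[OF s']]) (use r t in auto)
      have d2: "((\<lambda>s. \<psi> s x) has_real_derivative F s x * \<phi> s x) (at s within {t..r})"
        by (rule has_field_derivative_subset[OF psi_t[OF s']]) (use r t in auto)
      show "(Y has_real_derivative (F s x - k\<^sup>2) * \<phi> s x * c s) (at s within {t..r})"
        unfolding Y_def[abs_def] c_def using d1 d2
        by (auto intro!: derivative_eq_intros simp: algebra_simps power2_eq_square)
    next
      fix s assume s: "t < s" "s < r"
      then have s': "0 \<le> s" "s < \<tau>" using r t by auto
      show "(F s x - k\<^sup>2) * \<phi> s x * c s \<le> 0"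
        using F_k[OF s'] pos[OF s', of x] c_pos[of s]
        by (intro mult_nonpos_nonneg) (auto intro: less_imp_le)
    qed (use r in auto)
    also have "Y t = \<psi> t x" by (simp add: Y_def c_def)
    finally show ?thesis .
  qed
  have ct: "c t = 1" by (simp add: c_def)
  have decr: "\<phi> (t + 1) x / c (t + 1) - \<psi> t x / (cosh k)\<^sup>2 * (t + 1) \<le> \<phi> t x / c t - \<psi> t x / (cosh k)\<^sup>2 * t"
  proof (rule DERIV_nonpos_within[where f="\<lambda>r. \<phi> r x / c r - \<psi> t x / (cosh k)\<^sup>2 * r"
        and f'="\<lambda>r. Y r / (c r)\<^sup>2 - \<psi> t x / (cosh k)\<^sup>2"])
    fix s assume s: "s \<in> {t..t+1}"
    have s': "s \<in> {0..\<tau>}" using s t by auto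
    have d1: "((\<lambda>s. \<phi> s x) has_real_derivative \<psi> s x) (at s within {t..t+1})"
      by (rule has_field_derivative_subset[OF phi_t[OF s']]) (use t in auto)
    have "(c has_real_derivative k * sinh (k * (s - t))) (at s within {t..t+1})"
      unfolding c_def[abs_def] by (auto intro!: derivative_eq_intros)
    with d1 have "((\<lambda>r. \<phi> r x / c r) has_real_derivative (\<psi> s x * c s - \<phi> s x * (k * sinh (k * (s - t)))) / (c s * c s))
       (at s within {t..t+1})"
      using c_pos[of s] by (intro DERIV_divide) auto
    then have "((\<lambda>r. \<phi> r x / c r) has_real_derivative Y s / (c s)\<^sup>2) (at s within {t..t+1})"
      by (simp add: Y_def power2_eq_square ac_simps)
    from DERIV_diff[OF this DERIV_cmult_Id]
    show "((\<lambda>r. \<phi> r x / c r - \<psi> t x / (cosh k)\<^sup>2 * r) has_real_derivative Y s / (c s)\<^sup>2 - \<psi> t x / (cosh k)\<^sup>2)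
        (at s within {t..t+1})" .
  next
    fix s assume s: "t < s" "s < t + 1"
    have "Y s / (c s)\<^sup>2 \<le> \<psi> t x / (c s)\<^sup>2" using Y_le[of s] s by (intro divide_right_mono) auto
    also have "\<dots> \<le> \<psi> t x / (cosh k)\<^sup>2"
    proof -
      have "k * (s - t) \<le> k * 1" using s k by (intro mult_left_mono) auto
      then have "c s \<le> cosh k" unfolding c_def using s k by (subst cosh_real_nonneg_le_iff) auto
      then have "(c s)\<^sup>2 \<le> (cosh k)\<^sup>2" using c_pos[of s] by (intro power_mono) auto
      then show ?thesis using False c_pos[of s] by (intro divide_left_mono_neg) auto
    qed
    finally show "Y s / (c s)\<^sup>2 - \<psi> t x / (cosh k)\<^sup>2 \<le> 0" by simp
  qed simp
  have "\<phi> (t + 1) x \<ge> 0"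
    using pos[of "t+1" x] phi_nonneg_end[of x] t by (cases "t + 1 = \<tau>") (auto intro: less_imp_le)
  then have "0 \<le> \<phi> (t + 1) x / c (t + 1)" using c_pos by (rule divide_nonneg_pos)
  with decr have "0 \<le> \<phi> t x + \<psi> t x / (cosh k)\<^sup>2"
    unfolding ct distrib_left mult_1_right div_by_1 by linarith
  then have "- ((cosh k)\<^sup>2 * \<phi> t x) \<le> \<psi> t x"
    using cosh_real_pos[of k] by (simp add: field_simps)
  then have "\<psi> t x / \<phi> t x \<ge> - (cosh k)\<^sup>2" using pos[of t x] t by (simp add: field_simps)
  from mult_left_mono[OF this, of p] have "W t x \<ge> - (p * (cosh k)\<^sup>2)" by (simp add: W_def)
  moreover have "p * (cosh k)\<^sup>2 \<le> 2 * (cosh k)\<^sup>2" using p by (intro mult_right_mono) auto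
  ultimately show ?thesis unfolding k_def by linarith
qed

text \<open>
  For \<open>\<sigma> = 0\<close> the force is nonpositive, so \<open>\<phi>\<close> is concave in time and lies below its initial tangent.
\<close>

lemma concave_case:
  assumes "\<sigma> = 0" shows "0 \<le> 1 + v x / p * \<tau>"
proof -
  have F: "F t x \<le> 0" if "t \<in> {0..\<tau>}" for t
    using F_eq_U[OF that] energy_nonneg[OF that] assms by (simp add: \<kappa>_def)
  have \<psi>: "\<psi> t x \<le> v x / p" if t: "t \<in> {0..\<tau>}" for t
  proof -
    have "\<psi> t x \<le> \<psi> 0 x"
    proof (rule DERIV_nonpos_within[where f="\<lambda>t. \<psi> t x" and f'="\<lambda>t. F t x * \<phi> t x"])
      show "((\<lambda>t. \<psi> t x) has_real_derivative F s x * \<phi> s x) (at s within {0..t})" if "s \<in> {0..t}" for s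
        by (rule has_field_derivative_subset[OF psi_t]) (use that t in auto)
      show "F s x * \<phi> s x \<le> 0" if "0 < s" "s < t" for s
        using F[of s] pos[of s x] that t by (intro mult_nonpos_nonneg) (auto intro: less_imp_le)
    qed (use t in auto)
    then show ?thesis by (simp add: psi_0)
  qed
  have "\<phi> \<tau> x - v x / p * \<tau> \<le> \<phi> 0 x - v x / p * 0"
  proof (rule DERIV_nonpos_within[where f="\<lambda>t. \<phi> t x - v x / p * t" and f'="\<lambda>t. \<psi> t x - v x / p"])
    show "((\<lambda>t. \<phi> t x - v x / p * t) has_real_derivative \<psi> s x - v x / p) (at s within {0..\<tau>})" if "s \<in> {0..\<tau>}" for s
      using phi_t[OF that, of x] p_pos by (auto intro!: derivative_eq_intros)
  qed (use \<psi> \<tau>_pos in auto)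
  then show ?thesis using phi_nonneg_end[of x] by (simp add: phi_0)
qed

text \<open>
  Let \<open>t = \<tau> - 1\<close>. On \<open>[a, b]\<close> both terms of \<open>s W\<^sub>x\<close> are positive, whence \<open>s W\<^sub>x \<ge> c\<close>, and
  \<open>s ln \<phi>\<close> differs by at least \<open>c d t / p\<close> between a label in the left third and one in the right third
  of the interval, at distance at least \<open>d\<close>. On the other hand each third contains a label with \<open>\<phi>\<close> not large,
  since \<open>\<integral>\<phi>\<^sup>p = 1\<close> over a period, and, since \<open>s W\<close> oscillates by at most \<open>C\<close>, one with \<open>\<phi>\<close> not small.
\<close>

lemma lifespan_estimate:
  assumes s: "s = 1 \<or> s = -1" and s\<sigma>: "s * \<sigma> > 0"
    and M: "\<And>t x. 0 \<le> t \<Longrightarrow> t < \<tau> \<Longrightarrow> W t x \<le> M"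
    and ab: "a < b" "b \<le> a + 1" and \<delta>: "\<delta> > 0" "\<And>x. x \<in> {a..b} \<Longrightarrow> s * m0 x \<le> - \<delta>"
    and d: "d = (b - a) / 3" and c: "c = min (s * \<sigma>) \<delta>"
    and C: "C = M + 2 * (cosh (3 * \<bar>\<sigma>\<bar> * M + 1))\<^sup>2"
    and q: "q = (C + 1) / (\<delta> * d)"
    and \<tau>1: "\<tau> > 1"
  shows "c * d / 2 * (\<tau> - 1) \<le> ln (2 / d) + ln q / 2"
proof -
  define t where "t = \<tau> - 1"
  have t: "0 \<le> t" "t < \<tau>" "t + 1 \<le> \<tau>" using \<tau>1 by (auto simp: t_def)
  have d0: "d > 0" "d < 1" using ab d by auto
  have c0: "c > 0" using s\<sigma> \<delta> by (simp add: c)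
  have Wx_ge: "s * Wx r x \<ge> c" "s * Wx r x \<ge> \<delta> / (\<phi> r x)\<^sup>2" if r: "0 \<le> r" "r < \<tau>" and x: "x \<in> {a..b}" for r x
  proof -
    have \<phi>: "\<phi> r x > 0" by (rule pos[OF r])
    have "s * Wx r x = (s * \<sigma>) * \<phi> r x ^ p + (- (s * m0 x)) / (\<phi> r x)\<^sup>2" by (simp add: Wx_def algebra_simps)
    moreover have "\<delta> / (\<phi> r x)\<^sup>2 \<le> (- (s * m0 x)) / (\<phi> r x)\<^sup>2"
      using \<delta>(2)[OF x] by (intro divide_right_mono) auto
    ultimately have *: "s * Wx r x \<ge> (s * \<sigma>) * \<phi> r x ^ p + \<delta> / (\<phi> r x)\<^sup>2" by simp
    have nn: "(s * \<sigma>) * \<phi> r x ^ p \<ge> 0" "\<delta> / (\<phi> r x)\<^sup>2 \<ge> 0" using s\<sigma> \<delta> \<phi> by auto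
    show "s * Wx r x \<ge> \<delta> / (\<phi> r x)\<^sup>2" using * nn by simp
    show "s * Wx r x \<ge> c"
    proof (cases "\<phi> r x \<ge> 1")
      case True
      then have "(s * \<sigma>) * 1 \<le> (s * \<sigma>) * \<phi> r x ^ p" using s\<sigma> by (intro mult_left_mono one_le_power) auto
      then show ?thesis using * nn by (simp add: c)
    next
      case False
      then have "(\<phi> r x)\<^sup>2 \<le> 1" using \<phi> by (simp add: power_le_one)
      then have "\<delta> \<le> \<delta> / (\<phi> r x)\<^sup>2" using \<delta>(1) \<phi> by (simp add: le_divide_eq)
      then show ?thesis using * nn by (simp add: c)
    qed
  qed
  have W_int: "(Wx r has_integral W r y - W r x) {x..y}" if "0 \<le> r" "r < \<tau>" "x \<le> y" for r x y
    by (rule fundamental_theorem_of_calculus[OF that(3)])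
      (use W_x'[OF that(1,2)] in \<open>auto simp: has_real_derivative_iff_has_vector_derivative[symmetric] intro: has_field_derivative_at_within\<close>)
  have sW_int: "integral {x..y} (\<lambda>z. s * Wx r z) = s * (W r y - W r x)" if "0 \<le> r" "r < \<tau>" "x \<le> y" for r x y
    using has_integral_mult_right[OF W_int[OF that], of s] by (rule integral_unique)
  have Wxc: "continuous_on S (Wx r)" if "0 \<le> r" "r < \<tau>" for r S
    using joint_slice[OF Wx_cont, of r] that by (auto intro: continuous_on_subset)
  have spread: "c * (y - x) \<le> s * (W r y - W r x)"
    if "0 \<le> r" "r < \<tau>" "a \<le> x" "x \<le> y" "y \<le> b" for r x y
    unfolding sW_int[OF that(1,2,4), symmetric]
    by (rule integral_lower_bound) (use that Wx_ge in \<open>auto intro!: continuous_intros Wxc\<close>)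
  have log_spread: "c * (y - x) * t / p \<le> s * (ln (\<phi> t y) - ln (\<phi> t x))"
    if xy: "a \<le> x" "x \<le> y" "y \<le> b" for x y
  proof -
    have "- s * (ln (\<phi> t y) - ln (\<phi> t x)) + c * (y - x) / p * t
       \<le> - s * (ln (\<phi> 0 y) - ln (\<phi> 0 x)) + c * (y - x) / p * 0"
    proof (rule DERIV_nonpos_within[where f="\<lambda>t. - s * (ln (\<phi> t y) - ln (\<phi> t x)) + c * (y - x) / p * t"
          and f'="\<lambda>r. - s * (\<psi> r y / \<phi> r y - \<psi> r x / \<phi> r x) + c * (y - x) / p"])
      fix r assume r: "r \<in> {0..t}"
      then have r': "0 \<le> r" "r < \<tau>" using t by auto
      have ld: "((\<lambda>t. ln (\<phi> t z)) has_real_derivative \<psi> r z / \<phi> r z) (at r within {0..t})" for z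
      proof -
        have "((\<lambda>t. \<phi> t z) has_real_derivative \<psi> r z) (at r within {0..t})"
          by (rule has_field_derivative_subset[OF phi_t]) (use r t in auto)
        from DERIV_chain2[where f=ln and g="\<lambda>t. \<phi> t z", OF DERIV_ln_divide[OF pos[OF r', of z]] this]
        show ?thesis by simp
      qed
      show "((\<lambda>t. - s * (ln (\<phi> t y) - ln (\<phi> t x)) + c * (y - x) / p * t) has_real_derivative
         - s * (\<psi> r y / \<phi> r y - \<psi> r x / \<phi> r x) + c * (y - x) / p) (at r within {0..t})"
        using DERIV_add[OF DERIV_cmult[OF DERIV_diff[OF ld[of y] ld[of x]], of "- s"] DERIV_cmult_Id[of "c * (y - x) / p"]]
        by simp
    next
      fix r assume "0 < r" "r < t"
      then have r': "0 \<le> r" "r < \<tau>" using t by auto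
      have "c * (y - x) / p \<le> s * (W r y - W r x) / p"
        using spread[OF r' xy] by (intro divide_right_mono) auto
      also have "\<dots> = s * (\<psi> r y / \<phi> r y - \<psi> r x / \<phi> r x)" using p_pos by (simp add: W_def field_simps)
      finally show "- s * (\<psi> r y / \<phi> r y - \<psi> r x / \<phi> r x) + c * (y - x) / p \<le> 0" by simp
    qed (use t in auto)
    then show ?thesis by (simp add: phi_0)
  qed
  have osc: "s * (W t y - W t x) \<le> C" for x y
  proof -
    have "W t z \<le> M" "- 2 * (cosh (3 * \<bar>\<sigma>\<bar> * M + 1))\<^sup>2 \<le> W t z" for z
      using M[OF t(1,2)] W_lower_bound[OF M t(1,3)] by auto
    from this[of x] this[of y] show ?thesis using s unfolding C by auto
  qed
  have C0: "C \<ge> 0" using osc[of 0 0] by simp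
  have t': "t \<in> {0..\<tau>}" using t by simp
  have q0: "q > 0" using C0 \<delta> d0 by (simp add: q)
  \<comment> \<open>otherwise \<open>\<phi>\<^sup>p\<close> would have integral at least 2 over a part of one period\<close>
  have small: "\<exists>x\<in>{e..e+d}. ln (\<phi> t x) \<le> ln (2 / d)" for e
  proof (rule ccontr)
    assume "\<not> ?thesis"
    then have big: "ln (2 / d) < ln (\<phi> t x)" if "x \<in> {e..e+d}" for x using that by force
    have cc: "continuous_on S (\<lambda>x. \<phi> t x ^ p)" for S by (intro continuous_intros slices t')
    have "2 / d * (e + d - e) \<le> integral {e..e+d} (\<lambda>x. \<phi> t x ^ p)"
    proof (rule integral_lower_bound[OF cc])
      fix x assume x: "x \<in> {e..e+d}"
      have "2 / d < \<phi> t x" using big[OF x] pos[OF t(1,2), of x] d0 by simp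
      moreover have "2 / d \<ge> 1" using d0 by simp
      ultimately have "1 \<le> \<phi> t x" by linarith
      then have "\<phi> t x ^ 1 \<le> \<phi> t x ^ p" using p_pos by (intro power_increasing) auto
      then show "2 / d \<le> \<phi> t x ^ p" using \<open>2 / d < \<phi> t x\<close> by simp
    qed (use d0 in auto)
    also have "\<dots> \<le> integral {e..e+1} (\<lambda>x. \<phi> t x ^ p)"
      by (rule integral_subset_le) (use d0 pos[OF t(1,2)] in \<open>auto intro!: integrable_continuous_interval cc less_imp_le\<close>)
    also have "\<dots> = 1" using integral_period[OF cc phi_pow_periodic[OF t']] normalisation(1)[OF t'] by simp
    finally show False using d0 by simp
  qed
  \<comment> \<open>otherwise \<open>1 / \<phi>\<^sup>2 \<ge> q\<close> on the interval and \<open>s W\<close> would rise by at least \<open>\<delta> q d = C + 1\<close>\<close>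
  have large: "\<exists>x\<in>{e..e+d}. - (ln q / 2) \<le> ln (\<phi> t x)" if e: "a \<le> e" "e + d \<le> b" for e
  proof (rule ccontr)
    assume "\<not> ?thesis"
    then have low: "ln (\<phi> t x) < - (ln q / 2)" if "x \<in> {e..e+d}" for x using that by force
    have "\<delta> * q * (e + d - e) \<le> integral {e..e+d} (\<lambda>x. s * Wx t x)"
    proof (rule integral_lower_bound)
      fix x assume x: "x \<in> {e..e+d}"
      have \<phi>: "\<phi> t x > 0" by (rule pos[OF t(1,2)])
      have "ln (q * (\<phi> t x)\<^sup>2) \<le> ln 1"
        using low[OF x] \<phi> q0 by (simp add: ln_mult ln_realpow)
      then have "q * (\<phi> t x)\<^sup>2 \<le> 1" using q0 \<phi> by (subst (asm) ln_le_cancel_iff) auto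
      then have "q \<le> 1 / (\<phi> t x)\<^sup>2" using \<phi> by (simp add: le_divide_eq)
      from mult_left_mono[OF this, of \<delta>] \<delta>(1) have "\<delta> * q \<le> \<delta> / (\<phi> t x)\<^sup>2" by simp
      also have "\<dots> \<le> s * Wx t x" using Wx_ge(2)[OF t(1,2), of x] x e by auto
      finally show "\<delta> * q \<le> s * Wx t x" .
    qed (use d0 t in \<open>auto intro!: continuous_intros Wxc\<close>)
    also have "\<dots> = s * (W t (e + d) - W t e)" by (rule sW_int[OF t(1,2)]) (use d0 in simp)
    also have "\<dots> \<le> C" by (rule osc)
    finally show False using \<delta> d0 by (simp add: q)
  qed
  have ad: "a + d \<le> b" "b - d + d \<le> b" "a \<le> b - d" "d \<le> (b - d) - (a + d)" using d ab by (auto simp: field_simps)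
  obtain x y where xy: "x \<in> {a..a+d}" "y \<in> {b-d..b}" and
    "s * (ln (\<phi> t y) - ln (\<phi> t x)) \<le> ln (2 / d) + ln q / 2"
  proof -
    from s show ?thesis
    proof
      assume s1: "s = 1"
      obtain x where x: "x \<in> {a..a+d}" "- (ln q / 2) \<le> ln (\<phi> t x)" using large[of a] ad by auto
      obtain y where "y \<in> {b-d..b-d+d}" "ln (\<phi> t y) \<le> ln (2 / d)" using small[of "b - d"] by auto
      then show ?thesis by (intro that[OF x(1), of y]) (use x s1 in auto)
    next
      assume s1: "s = -1"
      obtain x where x: "x \<in> {a..a+d}" "ln (\<phi> t x) \<le> ln (2 / d)" using small[of a] by auto
      obtain y where "y \<in> {b-d..b-d+d}" "- (ln q / 2) \<le> ln (\<phi> t y)" using large[of "b-d"] ad by auto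
      then show ?thesis by (intro that[OF x(1), of y]) (use x s1 in auto)
    qed
  qed
  moreover have "c * (y - x) * t / p \<le> s * (ln (\<phi> t y) - ln (\<phi> t x))"
    by (rule log_spread) (use xy ad in auto)
  moreover have "c * d / 2 * t \<le> c * (y - x) * t / p"
  proof -
    have "d \<le> y - x" using xy ad by auto
    then have "c * d * t \<le> c * (y - x) * t" using c0 t by (intro mult_right_mono mult_left_mono) auto
    moreover have "0 \<le> c * d * t" using c0 d0 t by simp
    ultimately show ?thesis using p by auto
  qed
  ultimately show ?thesis unfolding t_def by linarith
qed

lemma psi_bound:
  assumes M: "\<And>t x. 0 \<le> t \<Longrightarrow> t < \<tau> \<Longrightarrow> W t x \<le> M" and B: "\<And>x. \<bar>v x\<bar> \<le> B"
    and t: "t \<in> {0..\<tau>}" and N: "\<tau> \<le> N"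
  shows "\<bar>\<psi> t x\<bar> \<le> B + (3 * \<bar>\<sigma>\<bar> * M + integral {0..1} (\<lambda>x. (v x / p)\<^sup>2)) * exp (M * N) * N"
proof -
  define K where "K = 3 * \<bar>\<sigma>\<bar> * M + integral {0..1} (\<lambda>x. (v x / p)\<^sup>2)"
  have U: "\<bar>U r y - \<sigma>\<bar> \<le> M" if "0 \<le> r" "r < \<tau>" for r y
    using U_minus_mean_bound[OF that M[OF that]] .
  have M0: "M \<ge> 0" using U[of 0 0] \<tau>_pos by linarith
  have e0: "energy 0 = integral {0..1} (\<lambda>x. (v x / p)\<^sup>2)" by (simp add: energy_def psi_0)
  have en: "energy 0 \<ge> 0" unfolding energy_def
    by (intro integral_nonneg integrable_continuous_interval continuous_intros slices) (use \<tau>_pos in auto)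
  have K0: "K \<ge> 0" using M0 en by (simp add: K_def e0[symmetric])
  have F_abs: "\<bar>F s x\<bar> \<le> K" if s: "0 \<le> s" "s < \<tau>" for s
  proof -
    have "\<bar>F s x\<bar> \<le> \<bar>\<kappa> * (U s x - \<sigma>)\<bar> + \<bar>(real p - 1) * energy 0\<bar>"
      using F_eq_U[of s x] energy_conserved[of s] s by simp
    also have "\<bar>\<kappa> * (U s x - \<sigma>)\<bar> \<le> (3 * \<bar>\<sigma>\<bar>) * M"
      unfolding abs_mult using p U[OF s, of x] by (intro mult_mono) (auto simp: \<kappa>_def abs_mult)
    also have "\<bar>(real p - 1) * energy 0\<bar> \<le> energy 0" using p en by auto
    finally show ?thesis by (simp add: K_def e0)
  qed
  have bound: "\<bar>F s x * \<phi> s x\<bar> \<le> K * exp (M * N)" if s: "0 \<le> s" "s < \<tau>" for s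
  proof -
    have "\<phi> s x \<le> exp (M * s)" using phi_upper_bound[OF M M0, of s x] s by simp
    also have "\<dots> \<le> exp (M * N)" using s N M0 by (simp add: mult_left_mono)
    finally show ?thesis unfolding abs_mult
      using F_abs[OF s] K0 pos[OF s, of x] by (intro mult_mono) auto
  qed
  have d: "((\<lambda>s. \<psi> s x) has_real_derivative F s x * \<phi> s x) (at s within {0..t})" if "s \<in> {0..t}" for s
    by (rule has_field_derivative_subset[OF psi_t]) (use that t in auto)
  have "\<psi> t x - K * exp (M * N) * t \<le> \<psi> 0 x - K * exp (M * N) * 0"
    by (rule DERIV_nonpos_within[where f="\<lambda>s. \<psi> s x - K * exp (M * N) * s" and f'="\<lambda>s. F s x * \<phi> s x - K * exp (M * N)"])
       (use d bound t in \<open>auto intro!: derivative_eq_intros simp: abs_le_iff\<close>)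
  moreover have "- \<psi> t x - K * exp (M * N) * t \<le> - \<psi> 0 x - K * exp (M * N) * 0"
  proof (rule DERIV_nonpos_within[where f="\<lambda>s. - \<psi> s x - K * exp (M * N) * s" and f'="\<lambda>s. - (F s x * \<phi> s x) - K * exp (M * N)"])
    show "((\<lambda>s. - \<psi> s x - K * exp (M * N) * s) has_real_derivative - (F s x * \<phi> s x) - K * exp (M * N)) (at s within {0..t})"
      if "s \<in> {0..t}" for s
      using DERIV_diff[OF DERIV_minus[OF d[OF that]] DERIV_cmult_Id[of "K * exp (M * N)"]] by simp
    show "- (F s x * \<phi> s x) - K * exp (M * N) \<le> 0" if "0 < s" "s < t" for s
      using bound[of s] that t abs_ge_minus_self[of "F s x * \<phi> s x"] by simp
  qed (use t in simp)
  moreover have "K * exp (M * N) * t \<le> K * exp (M * N) * N" using K0 t N by (intro mult_left_mono) auto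
  moreover have "\<bar>\<psi> 0 x\<bar> \<le> B"
    using B[of x] p by (auto simp: psi_0)
  ultimately show ?thesis unfolding K_def[symmetric] by linarith
qed

end

section \<open>Maximal solutions\<close>

text \<open>
  The constants of the preceding estimates depend only on \<open>u0\<close>. For \<open>\<sigma> \<noteq> 0\<close> the hypothesis enters
  only through the existence of a label with \<open>\<sigma> m\<^sub>0 < 0\<close>.
\<close>

lemma bounded_lifespan:
  assumes u0: "C2_circle u0" and p: "p = 1 \<or> p = 2" and sign: "\<not> never_changes_sign (momentum u0)"
  obtains N where "\<And>\<tau> \<phi> \<psi>. lagrangian_flow p u0 \<tau> \<phi> \<psi> \<Longrightarrow> \<tau> \<le> N"
proof (cases "mean u0 = 0")
  case True
  have "\<exists>x. deriv u0 x < 0"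
  proof (rule ccontr)
    assume "\<not> ?thesis"
    then have nn: "deriv u0 x \<ge> 0" for x by (simp add: not_less)
    have "deriv u0 x = 0" for x
    proof -
      have "deriv u0 (frac x) = 0"
        by (rule integral_nonneg_eq_0_imp[of 0 1 "deriv u0"])
          (use nn frac_in_unit[of x] C2_circleD(9)[OF u0] in \<open>auto intro: C2_circleD(5)[OF u0]\<close>)
      then show ?thesis using periodic1_frac[OF C2_circleD(7)[OF u0], of x] by simp
    qed
    then have "deriv u0 = (\<lambda>x. 0)" by (rule ext)
    then have "momentum u0 = (\<lambda>x. 0)" using True by (simp add: momentum_def[abs_def])
    then show False using sign by (simp add: never_changes_sign_def)
  qed
  then obtain x where x: "deriv u0 x < 0" by blast
  show ?thesis
  proof (rule that[of "p / (- deriv u0 x)"])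
    fix \<tau> \<phi> \<psi> assume "lagrangian_flow p u0 \<tau> \<phi> \<psi>"
    then interpret lagrangian_flow p u0 \<tau> \<phi> \<psi> .
    show "\<tau> \<le> p / (- deriv u0 x)"
      using concave_case[OF True, of x] x p_pos by (simp add: field_simps)
  qed
next
  case False
  define s :: real where "s = sgn (mean u0)"
  have s: "s = 1 \<or> s = -1" and s\<sigma>: "s * mean u0 > 0" using False by (auto simp: s_def sgn_if)
  have mc: "continuous_on UNIV (momentum u0)"
    unfolding momentum_def[abs_def] by (intro continuous_intros C2_circleD(6)[OF u0])
  obtain y where y: "s * momentum u0 y < 0"
    using sign s by (auto simp: never_changes_sign_def not_le)
  define \<delta> where "\<delta> = - (s * momentum u0 y) / 2"
  have \<delta>: "\<delta> > 0" using y by (simp add: \<delta>_def)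
  have "\<exists>r>0. \<forall>x. dist x y < r \<longrightarrow> dist (momentum u0 x) (momentum u0 y) < \<delta>"
    using mc \<delta> by (auto simp: continuous_on_iff)
  then obtain r where r: "r > 0" "\<And>x. dist x y < r \<Longrightarrow> dist (momentum u0 x) (momentum u0 y) < \<delta>" by blast
  define a b where "a = y" and "b = y + min (r/2) 1"
  have ab: "a < b" "b \<le> a + 1" using r(1) by (auto simp: a_def b_def)
  have neg: "s * momentum u0 x \<le> - \<delta>" if "x \<in> {a..b}" for x
  proof -
    have "\<bar>momentum u0 x - momentum u0 y\<bar> < \<delta>"
      using r(2)[of x] that r(1) by (auto simp: a_def b_def dist_real_def)
    moreover have "s * momentum u0 y = - 2 * \<delta>" by (simp add: \<delta>_def)
    ultimately show ?thesis using s by (auto simp: abs_if split: if_splits)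
  qed
  obtain B where B: "\<And>x. \<bar>deriv u0 x\<bar> \<le> B"
    using C2_circle_deriv_bounded[OF u0] by blast
  define M where "M = B + 6 * \<bar>mean u0\<bar> + 1"
  define d where "d = (b - a) / 3"
  define c where "c = min (s * mean u0) \<delta>"
  define C where "C = M + 2 * (cosh (3 * \<bar>mean u0\<bar> * M + 1))\<^sup>2"
  define q where "q = (C + 1) / (\<delta> * d)"
  define Q where "Q = (ln (2 / d) + ln q / 2) / (c * d / 2)"
  have cd: "c * d / 2 > 0" using \<delta> s\<sigma> ab by (simp add: c_def d_def)
  show ?thesis
  proof (rule that[of "\<bar>Q\<bar> + 1"])
    fix \<tau> \<phi> \<psi> assume "lagrangian_flow p u0 \<tau> \<phi> \<psi>"
    then interpret lagrangian_flow p u0 \<tau> \<phi> \<psi> .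
    have M: "W t x \<le> M" if "0 \<le> t" "t < \<tau>" for t x
      unfolding M_def by (rule less_imp_le[OF W_upper_bound[OF B that]])
    show "\<tau> \<le> \<bar>Q\<bar> + 1"
    proof (cases "\<tau> > 1")
      case True
      have "c * d / 2 * (\<tau> - 1) \<le> ln (2 / d) + ln q / 2"
        by (rule lifespan_estimate[OF s s\<sigma> M ab \<delta> _ d_def c_def C_def q_def True])
          (use neg in \<open>auto simp: m0_def\<close>)
      then have "\<tau> - 1 \<le> Q" unfolding Q_def using cd by (subst pos_le_divide_eq) (auto simp: mult.commute)
      then show ?thesis by linarith
    qed simp
  qed
qed

lemma lagrangian_system_subset:
  assumes "lagrangian_system p \<sigma> v \<tau> \<phi> \<psi>" "0 < T" "T \<le> \<tau>"
  shows "lagrangian_system p \<sigma> v T \<phi> \<psi>"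
proof -
  have sub: "{0..T} \<subseteq> {0..\<tau>}" using assms by auto
  then have sub2: "{0..T} \<times> UNIV \<subseteq> {0..\<tau>} \<times> (UNIV :: real set)" by auto
  show ?thesis
    using assms sub unfolding lagrangian_system_def
    by (auto intro: continuous_on_subset[OF _ sub2] has_field_derivative_subset[OF _ sub])
qed

text \<open>
  The radii \<open>r1\<close> and \<open>r2\<close> are chosen as the a priori bounds up to time \<open>N\<close>, which hold as long as \<open>\<phi>\<close> is
  positive. So either \<open>\<phi>\<close> has a first zero, or the solution reaches time \<open>N\<close>.
\<close>

lemma lagrangian_flow_exists:
  assumes u0: "C2_circle u0" and p: "p = 1 \<or> p = 2" and N: "N > 0"
  obtains \<tau> \<phi> \<psi> where "lagrangian_flow p u0 \<tau> \<phi> \<psi>" "\<tau> = N \<or> (\<exists>x. \<phi> \<tau> x = 0)"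
proof -
  obtain B where B: "\<And>x. \<bar>deriv u0 x\<bar> \<le> B"
    using C2_circle_deriv_bounded[OF u0] by blast
  define M where "M = B + 6 * \<bar>mean u0\<bar> + 1"
  define r1 where "r1 = exp (M * N)"
  define r2 where "r2 = B + (3 * \<bar>mean u0\<bar> * M + integral {0..1} (\<lambda>x. (deriv u0 x / p)\<^sup>2)) * exp (M * N) * N"
  have M0: "M \<ge> 0" using B[of 0] by (simp add: M_def)
  have "p > 0" using p by auto
  then obtain T \<phi> \<psi> where sys: "lagrangian_system p (mean u0) (deriv u0) T \<phi> \<psi>" "T \<le> N"
    "T = N \<or> (\<exists>x. \<bar>\<phi> T x\<bar> > r1 \<or> \<bar>\<psi> T x\<bar> > r2)"
    using lagrangian_system_exists[of "deriv u0" B p N "mean u0" r1 r2] C2_circleD(5)[OF u0] B N by blast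
  interpret motion: lagrangian_motion p u0 T \<phi> \<psi> by unfold_locales (use p u0 sys in auto)
  show ?thesis
  proof (cases "\<forall>t x. 0 \<le> t \<longrightarrow> t < T \<longrightarrow> \<phi> t x > 0")
    case True
    then interpret lagrangian_flow p u0 T \<phi> \<psi> by unfold_locales auto
    have W: "W t x \<le> M" if "0 \<le> t" "t < T" for t x
      unfolding M_def by (rule less_imp_le[OF W_upper_bound[OF B that]])
    have T: "T \<in> {0..T}" using motion.\<tau>_pos by simp
    have "\<bar>\<phi> T x\<bar> \<le> r1" for x
    proof -
      have "\<phi> T x \<le> exp (M * T)" by (rule phi_upper_bound[OF W M0 T])
      also have "\<dots> \<le> r1" using M0 sys(2) by (simp add: r1_def mult_left_mono)
      finally show ?thesis using phi_nonneg_end[of x] by simp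
    qed
    moreover have "\<bar>\<psi> T x\<bar> \<le> r2" for x
      unfolding r2_def by (rule psi_bound[OF W B T sys(2)])
    ultimately have "T = N" using sys(3) by (meson not_le)
    then show ?thesis by (intro that[OF lagrangian_flow_axioms]) simp
  next
    case False
    then obtain t1 x1 where t1: "0 \<le> t1" "t1 < T" "\<phi> t1 x1 \<le> 0" by (auto simp: not_less)
    obtain \<tau> x where \<tau>: "\<tau> \<in> {0..T}" and x: "\<phi> \<tau> x \<le> 0"
      and pos: "\<And>t x. 0 \<le> t \<Longrightarrow> t < \<tau> \<Longrightarrow> \<phi> t x > 0"
      by (rule first_nonpositive_time[OF motion.phi_cont motion.phi_psi_periodic(1) _ t1(3)]) (use t1 in auto)
    have "\<tau> \<noteq> 0" using x motion.phi_0[of x] by auto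
    with \<tau> have \<tau>0: "0 < \<tau>" "\<tau> \<le> T" by auto
    interpret lagrangian_flow p u0 \<tau> \<phi> \<psi>
      by unfold_locales (use p u0 pos lagrangian_system_subset[OF sys(1) \<tau>0] in auto)
    have "\<phi> \<tau> x = 0" using x phi_nonneg_end[of x] by simp
    then show ?thesis using that[OF lagrangian_flow_axioms] by blast
  qed
qed

lemma time_dom_ereal: "time_dom (ereal T) = {0..<T}" by (auto simp: time_dom_def)
lemma time_dom_infinity: "time_dom \<infinity> = {0..}" by (auto simp: time_dom_def)

lemma is_solution_cong:
  assumes "is_solution lam u0 T u" "\<And>t. t \<in> time_dom T \<Longrightarrow> v t = u t"
  shows "is_solution lam u0 T v"
proof -
  have z: "0 \<in> time_dom T" using assms(1) by (simp add: is_solution_def time_dom_def zero_ereal_def)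
  have c: "continuous_on (time_dom T \<times> UNIV) (\<lambda>(t, \<theta>). f (v t) \<theta>)"
    if "continuous_on (time_dom T \<times> UNIV) (\<lambda>(t, \<theta>). f (u t) \<theta> :: real)" for f :: "(real \<Rightarrow> real) \<Rightarrow> real \<Rightarrow> real"
    using that by (rule continuous_on_cong[THEN iffD1, OF refl, rotated]) (auto simp: assms(2))
  have d: "((\<lambda>s. deriv (v s) \<theta>) has_real_derivative D) (at t within time_dom T)"
    if "((\<lambda>s. deriv (u s) \<theta>) has_real_derivative D) (at t within time_dom T)" "t \<in> time_dom T" for t \<theta> D
    by (rule has_field_derivative_transform_within[OF that(1) zero_less_one that(2)]) (simp add: assms(2))
  show ?thesis
    unfolding is_solution_def
  proof (intro conjI ballI allI)
    show "continuous_on (time_dom T \<times> UNIV) (\<lambda>(t, \<theta>). v t \<theta>)"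
      using c[of "\<lambda>f. f"] assms(1) by (simp add: is_solution_def)
    show "continuous_on (time_dom T \<times> UNIV) (\<lambda>(t, \<theta>). deriv (v t) \<theta>)"
      using c[of deriv] assms(1) by (simp add: is_solution_def)
    show "continuous_on (time_dom T \<times> UNIV) (\<lambda>(t, \<theta>). deriv (deriv (v t)) \<theta>)"
      using c[of "\<lambda>f. deriv (deriv f)"] assms(1) by (simp add: is_solution_def)
    fix t \<theta> assume t: "t \<in> time_dom T"
    have "\<exists>D. ((\<lambda>s. deriv (u s) \<theta>) has_real_derivative D) (at t within time_dom T) \<and>
        D + u t \<theta> * deriv (deriv (u t)) \<theta> + (lam - 1) / 2 * (deriv (u t) \<theta>)\<^sup>2
          - lam * mean u0 * u t \<theta>
        = (lam - 3) / 2 * integral {0..1} (\<lambda>x. (deriv (u t) x)\<^sup>2) - lam * (mean u0)\<^sup>2"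
      using assms(1) t unfolding is_solution_def by blast
    then show "\<exists>D. ((\<lambda>s. deriv (v s) \<theta>) has_real_derivative D) (at t within time_dom T) \<and>
        D + v t \<theta> * deriv (deriv (v t)) \<theta> + (lam - 1) / 2 * (deriv (v t) \<theta>)\<^sup>2
          - lam * mean u0 * v t \<theta>
        = (lam - 3) / 2 * integral {0..1} (\<lambda>x. (deriv (v t) x)\<^sup>2) - lam * (mean u0)\<^sup>2"
      unfolding assms(2)[OF t] using d[OF _ t] by blast
  qed (use assms z in \<open>auto simp: is_solution_def\<close>)
qed

lemma at_within_time: 
  assumes "t < (r::real)" shows "at t within {0..<r} = at t within {0..}"
  by (rule at_within_nhd[of t "{..<r}"]) (use assms in auto)

lemma is_solution_infinity:
  assumes "\<And>r. r > 0 \<Longrightarrow> is_solution lam u0 (ereal r) u"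
  shows "is_solution lam u0 \<infinity> u"
proof -
  note sol = assms[unfolded is_solution_def time_dom_ereal]
  have r: "t \<in> {0..<t + 1}" "t + 1 > 0" if "t \<ge> 0" for t :: real using that by auto
  have c: "continuous_on ({0..} \<times> UNIV) (\<lambda>(t, \<theta>). f t \<theta> :: real)"
    if f: "\<And>r. r > 0 \<Longrightarrow> continuous_on ({0..<r} \<times> UNIV) (\<lambda>(t, \<theta>). f t \<theta>)" for f :: "real \<Rightarrow> real \<Rightarrow> real"
    unfolding continuous_on_eq_continuous_within
  proof
    fix z :: "real \<times> real" assume z: "z \<in> {0..} \<times> UNIV"
    define r where "r = fst z + 1"
    have zr: "z \<in> {0..<r} \<times> UNIV" "r > 0" using z by (auto simp: r_def)
    have "at z within {0..} \<times> UNIV = at z within {0..<r} \<times> UNIV"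
      by (rule at_within_nhd[of z "{..<r} \<times> UNIV"]) (use zr in \<open>auto intro: open_Times\<close>)
    moreover have "continuous (at z within {0..<r} \<times> UNIV) (\<lambda>(t, \<theta>). f t \<theta>)"
      using f[OF zr(2)] zr(1) unfolding continuous_on_eq_continuous_within by blast
    ultimately show "continuous (at z within {0..} \<times> UNIV) (\<lambda>(t, \<theta>). f t \<theta>)" by simp
  qed
  show ?thesis
    unfolding is_solution_def time_dom_infinity
  proof (intro conjI ballI allI)
    show "continuous_on ({0..} \<times> UNIV) (\<lambda>(t, \<theta>). u t \<theta>)"
      by (rule c) (use sol in blast)
    show "continuous_on ({0..} \<times> UNIV) (\<lambda>(t, \<theta>). deriv (u t) \<theta>)"
      by (rule c) (use sol in blast)
    show "continuous_on ({0..} \<times> UNIV) (\<lambda>(t, \<theta>). deriv (deriv (u t)) \<theta>)"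
      by (rule c) (use sol in blast)
    fix t :: real assume "t \<in> {0..}"
    then have t: "t \<in> {0..<t + 1}" "t + 1 > 0" by auto
    show "C2_circle (u t)" "mean (u t) = mean u0" using sol[OF t(2)] t(1) by blast+
    fix \<theta>
    have "at t within {0..<t+1} = at t within {0..}" by (rule at_within_time) simp
    then show "\<exists>D. ((\<lambda>s. deriv (u s) \<theta>) has_real_derivative D) (at t within {0..}) \<and>
        D + u t \<theta> * deriv (deriv (u t)) \<theta> + (lam - 1) / 2 * (deriv (u t) \<theta>)\<^sup>2
          - lam * mean u0 * u t \<theta>
        = (lam - 3) / 2 * integral {0..1} (\<lambda>x. (deriv (u t) x)\<^sup>2) - lam * (mean u0)\<^sup>2"
      using sol[OF t(2)] t(1) by fastforce
  qed (use sol[OF zero_less_one] in auto)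
qed

lemma changes_sign_not_never:
  assumes "changes_pos_to_neg_at f x" shows "\<not> never_changes_sign f"
proof -
  obtain y z where "f y > 0" "f z < 0"
    using assms unfolding changes_pos_to_neg_at_def by (meson frequently_ex)
  then show ?thesis unfolding never_changes_sign_def by (meson not_le)
qed

context lagrangian_flow begin

text \<open>
  A solution that exists beyond \<open>\<tau>\<close> has a bounded slope on \<open>[0, \<tau>]\<close>, but it agrees with \<open>u\<close> before
  \<open>\<tau>\<close>, whose slope is unbounded along the trajectory of \<open>x\<close>.
\<close>

lemma maximal_if_vanishing:
  assumes z: "\<phi> \<tau> x = 0"
  shows "is_maximal_solution ((real p + 2) / p) u0 (ereal \<tau>) u"
  unfolding is_maximal_solution_def
proof (intro conjI allI impI)
  show "is_solution ((real p + 2) / p) u0 (ereal \<tau>) u" by (rule u_is_solution)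
  fix S w assume w: "is_solution ((real p + 2) / p) u0 S w"
  have eq: "w t = u t" if "t \<in> time_dom S" "0 \<le> t" "t < \<tau>" for t
    using is_solution_unique[OF w u_is_solution that(1)] that by (simp add: time_dom_ereal)
  show S: "S \<le> ereal \<tau>"
  proof (rule ccontr)
    assume "\<not> ?thesis"
    then have gt: "ereal \<tau> < S" by simp
    then have sub: "{0..\<tau>} \<subseteq> time_dom S" 
      by (auto simp: time_dom_def intro: le_less_trans[of _ "ereal \<tau>"])
    then have "continuous_on ({0..\<tau>} \<times> UNIV) (\<lambda>(t, \<theta>). deriv (w t) \<theta>)"
      using w unfolding is_solution_def by (blast intro: continuous_on_subset[OF _ Sigma_mono[OF _ subset_refl]])
    moreover have "periodic1 (deriv (w t))" if "t \<in> {0..\<tau>}" for t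
      using w sub that C2_circleD(7)[of "w t"] unfolding is_solution_def by blast
    ultimately obtain C where C: "\<And>t \<theta>. t \<in> {0..\<tau>} \<Longrightarrow> \<bar>deriv (w t) \<theta>\<bar> \<le> C"
      using periodic_bounded_joint[of 0 \<tau> "\<lambda>t. deriv (w t)"] by metis
    have "\<forall>\<^sub>F t in at_left \<tau>. W t x \<le> - C - 1"
      using W_at_bot[OF z] by (simp add: filterlim_at_bot)
    with eventually_before have "\<forall>\<^sub>F t in at_left \<tau>. False"
    proof eventually_elim
      case (elim t)
      then have t: "0 \<le> t" "t < \<tau>" "t \<in> time_dom S" using sub by auto
      have "W t x = deriv (w t) (\<eta> t x)" using deriv_u_eta[OF t(1,2)] eq[OF t(3,1,2)] by simp
      then show False using C[of t "\<eta> t x"] t elim by auto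
    qed
    then show False by simp
  qed
  show "\<forall>t\<in>time_dom S. w t = u t"
  proof
    fix t assume t: "t \<in> time_dom S"
    then have "ereal t < ereal \<tau>" using less_le_trans[OF _ S, of "ereal t"] by (simp add: time_dom_def)
    then show "w t = u t" using eq[OF t] t by (simp add: time_dom_def)
  qed
qed

end

text \<open>
  By uniqueness, solutions on bounded time intervals fit together.
\<close>

lemma global_solution_exists:
  assumes "\<And>N. N > 0 \<Longrightarrow> \<exists>w. is_solution lam u0 (ereal N) w"
  obtains u where "is_maximal_solution lam u0 \<infinity> u"
proof -
  from assms obtain w where w: "\<And>N. N > 0 \<Longrightarrow> is_solution lam u0 (ereal N) (w N)" by metis
  define u where "u t = w (t + 1) t" for t
  have "is_solution lam u0 (ereal r) u" if r: "r > 0" for r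
  proof (rule is_solution_cong[OF w[OF r]])
    fix t assume t: "t \<in> time_dom (ereal r)"
    then have "t + 1 > 0" by (simp add: time_dom_ereal)
    from is_solution_unique[OF w[OF this] w[OF r] _ t] t show "u t = w r t"
      by (simp add: u_def time_dom_ereal)
  qed
  then have sol: "is_solution lam u0 \<infinity> u" by (rule is_solution_infinity)
  have "is_maximal_solution lam u0 \<infinity> u"
    unfolding is_maximal_solution_def
  proof (intro conjI allI impI ballI)
    fix S v t assume v: "is_solution lam u0 S v" and t: "t \<in> time_dom S"
    have "t \<in> time_dom \<infinity>" using t by (simp add: time_dom_def)
    then show "v t = u t" using is_solution_unique[OF v sol t] by simp
  qed (auto intro: sol)
  then show ?thesis by (rule that)
qed

theorem theorem1:
  fixes lam :: real and u0 :: "real \<Rightarrow> real"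
  assumes "C2_circle u0"
    and "lam = 2 \<or> lam = 3"
  shows "\<exists>T u. is_maximal_solution lam u0 T u \<and>
    (T = \<infinity> \<longleftrightarrow> never_changes_sign (momentum u0)) \<and>
    (\<not> never_changes_sign (momentum u0) \<longrightarrow>
      (\<exists>T\<^sub>b. T = ereal T\<^sub>b \<and>
        (\<exists>\<theta> \<gamma>. changes_pos_to_neg_at (momentum u0) \<theta> \<and> is_particle_path T u \<theta> \<gamma> \<and>
          filterlim (\<lambda>t. deriv (u t) (\<gamma> t)) at_bot (at_left T\<^sub>b))))"
proof -
  define p :: nat where "p = (if lam = 3 then 1 else 2)"
  have p: "p = 1 \<or> p = 2" and lam: "lam = (real p + 2) / p" using assms(2) by (auto simp: p_def)
  show ?thesis
  proof (cases "\<exists>\<tau> \<phi> \<psi> x. lagrangian_flow p u0 \<tau> \<phi> \<psi> \<and> \<phi> \<tau> x = 0")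
    case True
    then obtain \<tau> \<phi> \<psi> x where "lagrangian_flow p u0 \<tau> \<phi> \<psi>" and x: "\<phi> \<tau> x = 0" by blast
    then interpret lagrangian_flow p u0 \<tau> \<phi> \<psi> by simp
    have max: "is_maximal_solution lam u0 (ereal \<tau>) u" unfolding lam by (rule maximal_if_vanishing[OF x])
    have change: "changes_pos_to_neg_at (momentum u0) x"
      using vanishing_label_is_sign_change[OF x] by (simp add: m0_def)
    have "filterlim (\<lambda>t. deriv (u t) (\<eta> t x)) at_bot (at_left \<tau>)"
      by (rule filterlim_cong[THEN iffD1, OF refl refl _ W_at_bot[OF x]])
        (rule eventually_mono[OF eventually_before], simp add: deriv_u_eta)
    then have "\<exists>\<theta> \<gamma>. changes_pos_to_neg_at (momentum u0) \<theta> \<and> is_particle_path (ereal \<tau>) u \<theta> \<gamma> \<and>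
          filterlim (\<lambda>t. deriv (u t) (\<gamma> t)) at_bot (at_left \<tau>)"
      using change eta_particle_path[of x] by blast
    then show ?thesis
      using max changes_sign_not_never[OF change] by (intro exI[of _ "ereal \<tau>"] exI[of _ u]) auto
  next
    case False
    have flow: "\<exists>\<phi> \<psi>. lagrangian_flow p u0 N \<phi> \<psi>" if "N > 0" for N
      using lagrangian_flow_exists[OF assms(1) p that] False by metis
    have sign: "never_changes_sign (momentum u0)"
    proof (rule ccontr)
      assume "\<not> ?thesis"
      from bounded_lifespan[OF assms(1) p this] obtain N
        where N: "\<And>\<tau> \<phi> \<psi>. lagrangian_flow p u0 \<tau> \<phi> \<psi> \<Longrightarrow> \<tau> \<le> N" by metis
      have "\<bar>N\<bar> + 1 > 0" by linarith
      from flow[OF this] obtain \<phi> \<psi> where "lagrangian_flow p u0 (\<bar>N\<bar> + 1) \<phi> \<psi>" by blast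
      from N[OF this] show False by linarith
    qed
    have "\<exists>w. is_solution lam u0 (ereal N) w" if "N > 0" for N
      using flow[OF that] lagrangian_flow.u_is_solution lam by metis
    from global_solution_exists[OF this] obtain u where "is_maximal_solution lam u0 \<infinity> u" by metis
    then show ?thesis using sign by (intro exI[of _ \<infinity>] exI[of _ u]) simp
  qed
qed

end
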